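(* Let $\mathbb{G}$ be a non-abelian directly indecomposable partially commutative group. Then $\mathbb{G}$ freely lifts every sentence in $L_{\mathbb{G}}$ that is true in $\mathbb{G}$.
   Context: Partially commutative group: given a finite, undirected, simple graph with vertex set $A=\{a_1,\dots,a_n\}$, it is the group $\mathbb{G}=\langle A \mid [a_i,a_j]=1 \text{ whenever } a_i,a_j \text{ are joined by an edge}\rangle$. It is directly indecomposable if it is not the direct product of two non-trivial groups. $L_{\mathbb{G}}$ is the language of groups enriched by constants for all elements of $\mathbb{G}$. $\mathbb{G}[X]=\mathbb{G}*F(X)$, where $F(X)$ is the free group on $X=\{x_1,\dots,x_k\}$. Free lifting: let $\phi$ be a sentence in $L_{\mathbb{G}}$ written in the standard form $\phi=\forall x_1\exists y_1\ldots\forall x_k\exists y_k\,\phi_0(x_1,y_1,\ldots,x_k,y_k)$, where $\phi_0$ is a quantifier-free formula in $L_{\mathbb{G}}$. One says that $\mathbb{G}$ freely lifts $\phi$ if there exist words (with constants from $\mathbb{G}$) $q_1(x_1),\ldots,q_k(x_1,\ldots,x_k)\in\mathbb{G}[X]$ (with $q_i\in\mathbb{G}*F(x_1,\dots,x_i)$) such that $$\mathbb{G}[X]\models\phi_0(x_1,q_1(x_1),\ldots,x_k,q_k(x_1,\ldots,x_k)),$$ where $x_1,\dots,x_k$ are interpreted as the free generators of $F(X)$. *)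

theory Defs
  imports
    "HOL-Algebra.Generated_Groups"
    "HOL-Algebra.Elementary_Groups"
    "Graph_Theory.Pair_Digraph"
begin

section \<open>Groups given by generators and relators\<close>

text \<open>A word over \<open>S\<close> is a list of letters \<open>(s, b)\<close> with \<open>s \<in> S\<close>; the letter \<open>(s, True)\<close> stands
  for \<open>s\<close> and \<open>(s, False)\<close> for its inverse.\<close>

abbreviation words :: "'s set \<Rightarrow> ('s \<times> bool) list set" where
  "words S \<equiv> lists (S \<times> UNIV)"

inductive_set word_cong ::
    "'s set \<Rightarrow> ('s \<times> bool) list set \<Rightarrow> (('s \<times> bool) list \<times> ('s \<times> bool) list) set"
  for S :: "'s set" and R :: "('s \<times> bool) list set" where
  refl: "w \<in> words S \<Longrightarrow> (w, w) \<in> word_cong S R"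
| sym: "(u, v) \<in> word_cong S R \<Longrightarrow> (v, u) \<in> word_cong S R"
| trans: "(u, v) \<in> word_cong S R \<Longrightarrow> (v, w) \<in> word_cong S R \<Longrightarrow> (u, w) \<in> word_cong S R"
| append: "(u, u') \<in> word_cong S R \<Longrightarrow> (v, v') \<in> word_cong S R \<Longrightarrow> (u @ v, u' @ v') \<in> word_cong S R"
| cancel: "s \<in> S \<Longrightarrow> ([(s, b), (s, \<not> b)], []) \<in> word_cong S R"
| relator: "r \<in> R \<Longrightarrow> r \<in> words S \<Longrightarrow> (r, []) \<in> word_cong S R"

definition presented_group ::
    "'s set \<Rightarrow> ('s \<times> bool) list set \<Rightarrow> ('s \<times> bool) list set monoid" where
  "presented_group S R =
     \<lparr>carrier = words S // word_cong S R,
      monoid.mult = (\<lambda>A B. \<Union>a\<in>A. \<Union>b\<in>B. word_cong S R `` {a @ b}),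
      one = word_cong S R `` {[]}\<rparr>"

definition generator :: "'s set \<Rightarrow> ('s \<times> bool) list set \<Rightarrow> 's \<Rightarrow> ('s \<times> bool) list set" where
  "generator S R s = word_cong S R `` {[(s, True)]}"

lemma word_cong_words: "(u, v) \<in> word_cong S R \<Longrightarrow> u \<in> words S \<and> v \<in> words S"
  by (induction rule: word_cong.induct) auto

lemma equiv_word_cong: "equiv (words S) (word_cong S R)"
proof (rule equivI)
  show "word_cong S R \<subseteq> words S \<times> words S" using word_cong_words by fast
  show "refl_on (words S) (word_cong S R)" by (auto simp: refl_on_def intro: word_cong.refl)
  show "sym (word_cong S R)" by (auto simp: sym_def intro: word_cong.sym)
  show "trans (word_cong S R)" unfolding trans_def by (blast intro: word_cong.trans)
qed

lemma mult_presented_group: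
  assumes "u \<in> words S" "v \<in> words S"
  shows "(word_cong S R `` {u}) \<otimes>\<^bsub>presented_group S R\<^esub> (word_cong S R `` {v})
           = word_cong S R `` {u @ v}"
proof -
  let ?E = "word_cong S R"
  have *: "?E `` {a @ b} = ?E `` {u @ v}" if "(u, a) \<in> ?E" "(v, b) \<in> ?E" for a b
    using that by (metis equiv_class_eq equiv_word_cong word_cong.append)
  have u: "u \<in> ?E `` {u}" and v: "v \<in> ?E `` {v}" using assms by (auto intro: word_cong.refl)
  have "(\<Union>b\<in>?E `` {v}. ?E `` {a @ b}) = ?E `` {u @ v}" if "a \<in> ?E `` {u}" for a
  proof (rule UN_constant_eq[OF v], rule ballI)
    fix b assume "b \<in> ?E `` {v}"
    with that show "?E `` {a @ b} = ?E `` {u @ v}" unfolding Image_singleton_iff by (rule *)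
  qed
  then have "(\<Union>a\<in>?E `` {u}. \<Union>b\<in>?E `` {v}. ?E `` {a @ b}) = ?E `` {u @ v}"
    by (intro UN_constant_eq[OF u] ballI)
  then show ?thesis by (simp only: presented_group_def monoid.simps)
qed

lemma word_inverse:
  "w \<in> words S \<Longrightarrow> (rev (map (\<lambda>(s, b). (s, \<not> b)) w) @ w, []) \<in> word_cong S R"
proof (induction w)
  case Nil
  then show ?case by (auto intro: word_cong.refl)
next
  case (Cons l w)
  obtain s b where l: "l = (s, b)" by (cases l)
  let ?i = "\<lambda>w. rev (map (\<lambda>(s, b). (s, \<not> b)) w)"
  have s: "s \<in> S" and w: "w \<in> words S" using Cons.prems l by auto
  have i: "?i w \<in> words S" using w by (auto simp: lists_eq_set)
  have "([(s, \<not> b), (s, b)], []) \<in> word_cong S R"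
    using word_cong.cancel[OF s, of "\<not> b" R] by simp
  from word_cong.append[OF word_cong.append[OF word_cong.refl[OF i] this] word_cong.refl[OF w]]
  have "(?i (l # w) @ l # w, ?i w @ w) \<in> word_cong S R" by (simp add: l)
  then show ?case using Cons.IH[OF w] by (rule word_cong.trans)
qed

lemma group_presented_group: "group (presented_group S R)"
proof -
  let ?G = "presented_group S R"
  have cl: "word_cong S R `` {w} \<in> carrier ?G" if "w \<in> words S" for w
    using that by (auto simp: presented_group_def quotient_def)
  have ex: "\<exists>w\<in>words S. A = word_cong S R `` {w}" if "A \<in> carrier ?G" for A
    using that by (auto simp: presented_group_def quotient_def)
  have one: "\<one>\<^bsub>?G\<^esub> = word_cong S R `` {[]}" by (simp add: presented_group_def)
  note m = mult_presented_group[of _ S _ R]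
  show ?thesis
  proof (rule groupI)
    fix A B assume "A \<in> carrier ?G" "B \<in> carrier ?G"
    then obtain u v where "u \<in> words S" "v \<in> words S"
      "A = word_cong S R `` {u}" "B = word_cong S R `` {v}" using ex by meson
    then show "A \<otimes>\<^bsub>?G\<^esub> B \<in> carrier ?G" using m[of u v] cl[of "u @ v"] by simp
  next
    show "\<one>\<^bsub>?G\<^esub> \<in> carrier ?G" unfolding one by (rule cl) simp
  next
    fix A B C assume "A \<in> carrier ?G" "B \<in> carrier ?G" "C \<in> carrier ?G"
    then obtain u v w where "u \<in> words S" "v \<in> words S" "w \<in> words S"
      "A = word_cong S R `` {u}" "B = word_cong S R `` {v}" "C = word_cong S R `` {w}"
      using ex by meson
    then show "A \<otimes>\<^bsub>?G\<^esub> B \<otimes>\<^bsub>?G\<^esub> C = A \<otimes>\<^bsub>?G\<^esub> (B \<otimes>\<^bsub>?G\<^esub> C)"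
      using m[of u v] m[of "u @ v" w] m[of v w] m[of u "v @ w"] by simp
  next
    fix A assume "A \<in> carrier ?G"
    then obtain w where w: "w \<in> words S" "A = word_cong S R `` {w}" using ex by meson
    then show "\<one>\<^bsub>?G\<^esub> \<otimes>\<^bsub>?G\<^esub> A = A" unfolding one using m[of "[]" w] by simp
    let ?i = "rev (map (\<lambda>(s, b). (s, \<not> b)) w)"
    have i: "?i \<in> words S" using w(1) by (auto simp: lists_eq_set)
    have "word_cong S R `` {?i @ w} = word_cong S R `` {[]}"
      by (rule equiv_class_eq[OF equiv_word_cong word_inverse[OF w(1)]])
    then have "word_cong S R `` {?i} \<otimes>\<^bsub>?G\<^esub> A = \<one>\<^bsub>?G\<^esub>"
      unfolding one w(2) m[OF i w(1)] .
    then show "\<exists>B\<in>carrier ?G. B \<otimes>\<^bsub>?G\<^esub> A = \<one>\<^bsub>?G\<^esub>" using cl[OF i] by blast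
  qed
qed


section \<open>Partially commutative groups, free groups and free products\<close>

text \<open>A finite, undirected, simple graph is a \<^locale>\<open>pair_graph\<close>: each edge \<open>{a, b}\<close> is
  represented by the two arcs \<open>(a, b)\<close> and \<open>(b, a)\<close>.\<close>

definition pc_group :: "'a pair_pre_digraph \<Rightarrow> ('a \<times> bool) list set monoid" where
  "pc_group \<Gamma> = presented_group (pverts \<Gamma>)
     {[(a, False), (b, False), (a, True), (b, True)] | a b. (a, b) \<in> parcs \<Gamma>}"

definition free_group :: "'x set \<Rightarrow> ('x \<times> bool) list set monoid" where
  "free_group X = presented_group X {}"

definition free_gen :: "'x set \<Rightarrow> 'x \<Rightarrow> ('x \<times> bool) list set" where
  "free_gen X = generator X {}"

text \<open>The relators of a free product are the multiplication tables of the two factors.\<close>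

definition free_product_relators ::
    "('g, 'm) monoid_scheme \<Rightarrow> ('h, 'n) monoid_scheme \<Rightarrow> (('g + 'h) \<times> bool) list set" where
  "free_product_relators G H =
     {[(Inl a, True), (Inl b, True), (Inl (a \<otimes>\<^bsub>G\<^esub> b), False)] | a b. a \<in> carrier G \<and> b \<in> carrier G}
   \<union> {[(Inr a, True), (Inr b, True), (Inr (a \<otimes>\<^bsub>H\<^esub> b), False)] | a b. a \<in> carrier H \<and> b \<in> carrier H}"

definition free_product ::
    "('g, 'm) monoid_scheme \<Rightarrow> ('h, 'n) monoid_scheme \<Rightarrow> (('g + 'h) \<times> bool) list set monoid" where
  "free_product G H = presented_group (carrier G <+> carrier H) (free_product_relators G H)"

definition free_product_inl ::
    "('g, 'm) monoid_scheme \<Rightarrow> ('h, 'n) monoid_scheme \<Rightarrow> 'g \<Rightarrow> (('g + 'h) \<times> bool) list set" where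
  "free_product_inl G H g = generator (carrier G <+> carrier H) (free_product_relators G H) (Inl g)"

definition free_product_inr ::
    "('g, 'm) monoid_scheme \<Rightarrow> ('h, 'n) monoid_scheme \<Rightarrow> 'h \<Rightarrow> (('g + 'h) \<times> bool) list set" where
  "free_product_inr G H h = generator (carrier G <+> carrier H) (free_product_relators G H) (Inr h)"

text \<open>\<open>poly_group G k\<close> is \<open>G[X] = G * F(X)\<close> for \<open>X = {x\<^sub>1, \<dots>, x\<^sub>k}\<close>, with \<open>x\<^sub>i\<close> indexed by \<open>i\<close>.\<close>

type_synonym 'g poly = "(('g + (nat \<times> bool) list set) \<times> bool) list set"

definition poly_group :: "('g, 'm) monoid_scheme \<Rightarrow> nat \<Rightarrow> 'g poly monoid" where
  "poly_group G k = free_product G (free_group {1..k})"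

definition poly_const :: "('g, 'm) monoid_scheme \<Rightarrow> nat \<Rightarrow> 'g \<Rightarrow> 'g poly" where
  "poly_const G k = free_product_inl G (free_group {1..k})"

definition poly_var :: "('g, 'm) monoid_scheme \<Rightarrow> nat \<Rightarrow> nat \<Rightarrow> 'g poly" where
  "poly_var G k i = free_product_inr G (free_group {1..k}) (free_gen {1..k} i)"

text \<open>\<open>poly_upto G k i\<close> is \<open>G * F(x\<^sub>1, \<dots>, x\<^sub>i)\<close> as a subgroup of \<open>G * F(x\<^sub>1, \<dots>, x\<^sub>k)\<close>, for \<open>i \<le> k\<close>.\<close>

definition poly_upto :: "('g, 'm) monoid_scheme \<Rightarrow> nat \<Rightarrow> nat \<Rightarrow> 'g poly set" where
  "poly_upto G k i =
     generate (poly_group G k) (poly_const G k ` carrier G \<union> poly_var G k ` {1..i})"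

text \<open>Two factors of a direct decomposition of \<open>G\<close> embed in \<open>G\<close>, so that it suffices to let them
  range over groups on the type of elements of \<open>G\<close>.\<close>

definition directly_indecomposable :: "'g monoid \<Rightarrow> bool" where
  "directly_indecomposable G \<longleftrightarrow>
     \<not> (\<exists>(H :: 'g monoid) (K :: 'g monoid).
          group H \<and> group K \<and> \<not> trivial_group H \<and> \<not> trivial_group K \<and> G \<cong> H \<times>\<times> K)"


section \<open>The language of groups with constants\<close>

datatype var = X nat | Y nat

datatype (trm_consts: 'c) trm =
    Var var
  | Const 'c
  | One
  | Mult "'c trm" "'c trm"
  | Inv "'c trm"

datatype (consts_of: 'c) formula =
    Eq "'c trm" "'c trm"
  | Neg "'c formula"
  | Conj "'c formula" "'c formula"
  | Disj "'c formula" "'c formula"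
  | Forall var "'c formula"
  | Exists var "'c formula"

primrec trm_vars :: "'c trm \<Rightarrow> var set" where
  "trm_vars (Var v) = {v}"
| "trm_vars (Const a) = {}"
| "trm_vars One = {}"
| "trm_vars (Mult s t) = trm_vars s \<union> trm_vars t"
| "trm_vars (Inv t) = trm_vars t"

primrec free_vars :: "'c formula \<Rightarrow> var set" where
  "free_vars (Eq s t) = trm_vars s \<union> trm_vars t"
| "free_vars (Neg \<phi>) = free_vars \<phi>"
| "free_vars (Conj \<phi> \<psi>) = free_vars \<phi> \<union> free_vars \<psi>"
| "free_vars (Disj \<phi> \<psi>) = free_vars \<phi> \<union> free_vars \<psi>"
| "free_vars (Forall v \<phi>) = free_vars \<phi> - {v}"
| "free_vars (Exists v \<phi>) = free_vars \<phi> - {v}"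

primrec quantifier_free :: "'c formula \<Rightarrow> bool" where
  "quantifier_free (Eq s t) = True"
| "quantifier_free (Neg \<phi>) = quantifier_free \<phi>"
| "quantifier_free (Conj \<phi> \<psi>) = (quantifier_free \<phi> \<and> quantifier_free \<psi>)"
| "quantifier_free (Disj \<phi> \<psi>) = (quantifier_free \<phi> \<and> quantifier_free \<psi>)"
| "quantifier_free (Forall v \<phi>) = False"
| "quantifier_free (Exists v \<phi>) = False"

text \<open>A structure for the language consists of a group \<open>H\<close> and an interpretation \<open>c\<close> of the
  constants in \<open>H\<close>; \<open>e\<close> is a variable assignment.\<close>

primrec trm_val :: "('h, 'm) monoid_scheme \<Rightarrow> ('c \<Rightarrow> 'h) \<Rightarrow> (var \<Rightarrow> 'h) \<Rightarrow> 'c trm \<Rightarrow> 'h" where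
  "trm_val H c e (Var v) = e v"
| "trm_val H c e (Const a) = c a"
| "trm_val H c e One = \<one>\<^bsub>H\<^esub>"
| "trm_val H c e (Mult s t) = trm_val H c e s \<otimes>\<^bsub>H\<^esub> trm_val H c e t"
| "trm_val H c e (Inv t) = inv\<^bsub>H\<^esub> (trm_val H c e t)"

primrec sat :: "('h, 'm) monoid_scheme \<Rightarrow> ('c \<Rightarrow> 'h) \<Rightarrow> (var \<Rightarrow> 'h) \<Rightarrow> 'c formula \<Rightarrow> bool" where
  "sat H c e (Eq s t) \<longleftrightarrow> trm_val H c e s = trm_val H c e t"
| "sat H c e (Neg \<phi>) \<longleftrightarrow> \<not> sat H c e \<phi>"
| "sat H c e (Conj \<phi> \<psi>) \<longleftrightarrow> sat H c e \<phi> \<and> sat H c e \<psi>"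
| "sat H c e (Disj \<phi> \<psi>) \<longleftrightarrow> sat H c e \<phi> \<or> sat H c e \<psi>"
| "sat H c e (Forall v \<phi>) \<longleftrightarrow> (\<forall>a\<in>carrier H. sat H c (e(v := a)) \<phi>)"
| "sat H c e (Exists v \<phi>) \<longleftrightarrow> (\<exists>a\<in>carrier H. sat H c (e(v := a)) \<phi>)"

definition models :: "('h, 'm) monoid_scheme \<Rightarrow> ('c \<Rightarrow> 'h) \<Rightarrow> 'c formula \<Rightarrow> bool" where
  "models H c \<phi> \<longleftrightarrow> (\<forall>e \<in> UNIV \<rightarrow> carrier H. sat H c e \<phi>)"

definition sentence :: "('g, 'm) monoid_scheme \<Rightarrow> 'g formula \<Rightarrow> bool" where
  "sentence G \<phi> \<longleftrightarrow> free_vars \<phi> = {} \<and> consts_of \<phi> \<subseteq> carrier G"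

definition true_in :: "('g, 'm) monoid_scheme \<Rightarrow> 'g formula \<Rightarrow> bool" where
  "true_in G \<phi> \<longleftrightarrow> models G (\<lambda>g. g) \<phi>"


section \<open>Standard form and free lifting\<close>

definition vars_upto :: "nat \<Rightarrow> var set" where
  "vars_upto k = X ` {1..k} \<union> Y ` {1..k}"

definition quantify :: "nat \<Rightarrow> nat \<Rightarrow> 'c formula \<Rightarrow> 'c formula" where
  "quantify i k \<phi> = foldr (\<lambda>j \<psi>. Forall (X j) (Exists (Y j) \<psi>)) [i..<Suc k] \<phi>"

text \<open>\<open>standard_sentence k \<phi>\<^sub>0\<close> is the sentence \<open>\<forall>x\<^sub>1\<exists>y\<^sub>1 \<dots> \<forall>x\<^sub>k\<exists>y\<^sub>k \<phi>\<^sub>0\<close>.\<close>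

definition standard_sentence :: "nat \<Rightarrow> 'c formula \<Rightarrow> 'c formula" where
  "standard_sentence k \<phi>\<^sub>0 = quantify 1 k \<phi>\<^sub>0"

definition standard_matrix :: "('g, 'm) monoid_scheme \<Rightarrow> nat \<Rightarrow> 'g formula \<Rightarrow> bool" where
  "standard_matrix G k \<phi>\<^sub>0 \<longleftrightarrow>
     quantifier_free \<phi>\<^sub>0 \<and> free_vars \<phi>\<^sub>0 \<subseteq> vars_upto k \<and> consts_of \<phi>\<^sub>0 \<subseteq> carrier G"

text \<open>Logical equivalence over all groups with an interpretation of the constants. If \<open>G\<close> is
  countable and its type of elements is infinite, as is the case for \<open>pc_group \<Gamma>\<close> over a finite
  graph, then by the Loewenheim-Skolem theorem groups on this type are sufficient.\<close>

definition equivalent :: "'g monoid \<Rightarrow> 'g formula \<Rightarrow> 'g formula \<Rightarrow> bool" where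
  "equivalent G \<phi> \<psi> \<longleftrightarrow>
     (\<forall>(H :: 'g monoid) c. group H \<and> c \<in> carrier G \<rightarrow> carrier H \<longrightarrow> (models H c \<phi> \<longleftrightarrow> models H c \<psi>))"

definition standard_form_of :: "'g monoid \<Rightarrow> 'g formula \<Rightarrow> nat \<Rightarrow> 'g formula \<Rightarrow> bool" where
  "standard_form_of G \<phi> k \<phi>\<^sub>0 \<longleftrightarrow>
     standard_matrix G k \<phi>\<^sub>0 \<and> equivalent G \<phi> (standard_sentence k \<phi>\<^sub>0)"

definition lift_assignment :: "'g monoid \<Rightarrow> nat \<Rightarrow> (nat \<Rightarrow> 'g poly) \<Rightarrow> var \<Rightarrow> 'g poly" where
  "lift_assignment G k q v = (case v of X i \<Rightarrow> poly_var G k i | Y i \<Rightarrow> q i)"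

definition freely_lifts_standard :: "'g monoid \<Rightarrow> nat \<Rightarrow> 'g formula \<Rightarrow> bool" where
  "freely_lifts_standard G k \<phi>\<^sub>0 \<longleftrightarrow>
     (\<exists>q. (\<forall>i\<in>{1..k}. q i \<in> poly_upto G k i) \<and>
          sat (poly_group G k) (poly_const G k) (lift_assignment G k q) \<phi>\<^sub>0)"

text \<open>A sentence can be written in standard form in many ways. It is lifted freely if this is so
  however it is written in standard form; a sentence that already is in standard form is one of its
  own standard forms. By \<open>ex_standard_form\<close> below, the quantification is never vacuous.\<close>

definition freely_lifts :: "'g monoid \<Rightarrow> 'g formula \<Rightarrow> bool" where
  "freely_lifts G \<phi> \<longleftrightarrow>
     (\<forall>k \<phi>\<^sub>0. standard_form_of G \<phi> k \<phi>\<^sub>0 \<longrightarrow> freely_lifts_standard G k \<phi>\<^sub>0)"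


subsection \<open>Existence of standard forms\<close>

lemma trm_val_cong: "(\<And>v. v \<in> trm_vars t \<Longrightarrow> e v = e' v) \<Longrightarrow> trm_val H c e t = trm_val H c e' t"
  by (induction t) auto

lemma sat_cong: "(\<And>v. v \<in> free_vars \<phi> \<Longrightarrow> e v = e' v) \<Longrightarrow> sat H c e \<phi> = sat H c e' \<phi>"
proof (induction \<phi> arbitrary: e e')
  case (Eq s t)
  then show ?case using trm_val_cong[of s e e' H c] trm_val_cong[of t e e' H c] by simp
next
  case (Forall v \<phi>)
  have "sat H c (e(v := a)) \<phi> = sat H c (e'(v := a)) \<phi>" for a
    by (rule Forall.IH) (use Forall.prems in auto)
  then show ?case by simp
next
  case (Exists v \<phi>)
  have "sat H c (e(v := a)) \<phi> = sat H c (e'(v := a)) \<phi>" for a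
    by (rule Exists.IH) (use Exists.prems in auto)
  then show ?case by simp
next
  case (Neg \<phi>)
  then show ?case by (metis free_vars.simps(2) sat.simps(2))
next
  case (Conj \<phi> \<psi>)
  then show ?case by (metis UnCI free_vars.simps(3) sat.simps(3))
next
  case (Disj \<phi> \<psi>)
  then show ?case by (metis UnCI free_vars.simps(4) sat.simps(4))
qed

primrec rename :: "(var \<Rightarrow> var) \<Rightarrow> 'c trm \<Rightarrow> 'c trm" where
  "rename r (Var v) = Var (r v)"
| "rename r (Const a) = Const a"
| "rename r One = One"
| "rename r (Mult s t) = Mult (rename r s) (rename r t)"
| "rename r (Inv t) = Inv (rename r t)"

lemma trm_val_rename: "trm_val H c e (rename r t) = trm_val H c (e \<circ> r) t"
  by (induction t) auto

lemma trm_vars_rename: "trm_vars (rename r t) = r ` trm_vars t"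
  by (induction t) auto

lemma trm_consts_rename: "trm_consts (rename r t) = trm_consts t"
  by (induction t) auto

lemma quantify_simps:
  "quantify (Suc n) n m = m"
  "i \<le> n \<Longrightarrow> quantify i n m = Forall (X i) (Exists (Y i) (quantify (Suc i) n m))"
  by (simp_all add: quantify_def upt_conv_Cons)

primrec blocks :: "'h set \<Rightarrow> nat \<Rightarrow> nat \<Rightarrow> ((var \<Rightarrow> 'h) \<Rightarrow> bool) \<Rightarrow> (var \<Rightarrow> 'h) \<Rightarrow> bool" where
  "blocks C n 0 P e = P e"
| "blocks C n (Suc k) P e =
     (\<forall>a\<in>C. \<exists>b\<in>C. blocks C (Suc n) k P (e(X (Suc n) := a, Y (Suc n) := b)))"

lemma sat_quantify:
  "sat H c e (quantify (Suc n) (n + k) m) = blocks (carrier H) n k (\<lambda>e. sat H c e m) e"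
proof (induction k arbitrary: n e)
  case 0
  then show ?case by (simp add: quantify_simps)
next
  case (Suc k)
  have q: "quantify (Suc n) (n + Suc k) m =
      Forall (X (Suc n)) (Exists (Y (Suc n)) (quantify (Suc (Suc n)) (Suc n + k) m))"
    by (simp add: quantify_simps)
  show ?case unfolding q sat.simps blocks.simps Suc.IH ..
qed

lemma blocks_add: "blocks C n (k + l) P e = blocks C n k (blocks C (n + k) l P) e"
  by (induction k arbitrary: n e) auto

lemma range_upd: "range e \<subseteq> C \<Longrightarrow> a \<in> C \<Longrightarrow> b \<in> C \<Longrightarrow> range (e(v := a, w := b)) \<subseteq> C"
  by auto

lemma blocks_cong:
  assumes "\<And>e'. range e' \<subseteq> C \<Longrightarrow> (\<And>v. v \<in> vars_upto n \<Longrightarrow> e' v = e v) \<Longrightarrow> P e' = Q e'"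
    and "range e \<subseteq> C"
  shows "blocks C n k P e = blocks C n k Q e"
  using assms
proof (induction k arbitrary: n e)
  case 0
  then show ?case by simp
next
  case (Suc k)
  have "blocks C (Suc n) k P (e(X (Suc n) := a, Y (Suc n) := b)) =
        blocks C (Suc n) k Q (e(X (Suc n) := a, Y (Suc n) := b))" if "a \<in> C" "b \<in> C" for a b
  proof (rule Suc.IH)
    fix e' assume e': "range e' \<subseteq> C"
      "\<And>v. v \<in> vars_upto (Suc n) \<Longrightarrow> e' v = (e(X (Suc n) := a, Y (Suc n) := b)) v"
    have "e' v = e v" if v: "v \<in> vars_upto n" for v
    proof -
      have "v \<in> vars_upto (Suc n)" "v \<noteq> X (Suc n)" "v \<noteq> Y (Suc n)"
        using v by (auto simp: vars_upto_def)
      then show ?thesis using e'(2)[of v] by simp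
    qed
    then show "P e' = Q e'" using Suc.prems(1) e'(1) by blast
  next
    show "range (e(X (Suc n) := a, Y (Suc n) := b)) \<subseteq> C"
      using Suc.prems(2) that by (intro range_upd)
  qed
  then show ?case unfolding blocks.simps by (intro ball_cong bex_cong HOL.refl)
qed

lemma blocks_const:
  assumes "C \<noteq> {}"
  shows "blocks C n k (\<lambda>e. P e \<and> A) e = (blocks C n k P e \<and> A)"
    and "blocks C n k (\<lambda>e. P e \<or> A) e = (blocks C n k P e \<or> A)"
proof -
  have t: "blocks C n k (\<lambda>_. True) e" "\<not> blocks C n k (\<lambda>_. False) e" for n e
    using assms by (induction k arbitrary: n e) auto
  show "blocks C n k (\<lambda>e. P e \<and> A) e = (blocks C n k P e \<and> A)"
    "blocks C n k (\<lambda>e. P e \<or> A) e = (blocks C n k P e \<or> A)"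
    using t by (cases A; simp)+
qed

definition prenexable ::
    "'h itself \<Rightarrow> 'c set \<Rightarrow> nat \<Rightarrow> ('h monoid \<Rightarrow> ('c \<Rightarrow> 'h) \<Rightarrow> (var \<Rightarrow> 'h) \<Rightarrow> bool) \<Rightarrow> bool" where
  "prenexable _ K n P \<longleftrightarrow>
     (\<exists>k m. quantifier_free m \<and> free_vars m \<subseteq> vars_upto (n + k) \<and> consts_of m \<subseteq> K \<and>
        (\<forall>H c e. carrier H \<noteq> {} \<and> range e \<subseteq> carrier H \<longrightarrow>
           P H c e = blocks (carrier H) n k (\<lambda>e. sat H c e m) e))"

definition local_upto :: "nat \<Rightarrow> ('h monoid \<Rightarrow> ('c \<Rightarrow> 'h) \<Rightarrow> (var \<Rightarrow> 'h) \<Rightarrow> bool) \<Rightarrow> bool" where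
  "local_upto n P \<longleftrightarrow> (\<forall>H c e e'. (\<forall>v\<in>vars_upto n. e v = e' v) \<longrightarrow> P H c e = P H c e')"

lemma vars_upto_mono: "n \<le> n' \<Longrightarrow> vars_upto n \<subseteq> vars_upto n'"
  by (auto simp: vars_upto_def)

lemma prenexable_conj_disj:
  fixes P Q :: "'h monoid \<Rightarrow> ('c \<Rightarrow> 'h) \<Rightarrow> (var \<Rightarrow> 'h) \<Rightarrow> bool"
  assumes P: "prenexable T K n P"
    and Q: "\<And>n'. n' \<ge> n \<Longrightarrow> prenexable T K n' Q" and loc: "local_upto n Q"
  shows "prenexable T K n (\<lambda>H c e. P H c e \<and> Q H c e)"
    and "prenexable T K n (\<lambda>H c e. P H c e \<or> Q H c e)"
proof -
  obtain k m where m: "quantifier_free m" "free_vars m \<subseteq> vars_upto (n + k)" "consts_of m \<subseteq> K"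
    and mP: "\<And>H c e. carrier H \<noteq> {} \<Longrightarrow> range e \<subseteq> carrier H \<Longrightarrow>
           P H c e = blocks (carrier H) n k (\<lambda>e. sat H c e m) e"
    using P unfolding prenexable_def by (elim exE conjE) simp
  obtain k' m' where m': "quantifier_free m'" "free_vars m' \<subseteq> vars_upto (n + k + k')" "consts_of m' \<subseteq> K"
    and mQ: "\<And>H c e. carrier H \<noteq> {} \<Longrightarrow> range e \<subseteq> carrier H \<Longrightarrow>
           Q H c e = blocks (carrier H) (n + k) k' (\<lambda>e. sat H c e m') e"
    using Q[of "n + k", OF le_add1] unfolding prenexable_def by (elim exE conjE) simp
  have fv: "free_vars m \<union> free_vars m' \<subseteq> vars_upto (n + (k + k'))"
    using m(2) m'(2) vars_upto_mono[of "n + k" "n + (k + k')"] unfolding add.assoc by simp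
  have swap: "sat H c e' m = sat H c e m" if "\<And>v. v \<in> vars_upto (n + k) \<Longrightarrow> e' v = e v"
    for H :: "'h monoid" and c e e'
    using sat_cong[of m e' e H c] that m(2) by blast
  have loc': "Q H c e' = Q H c e" if "\<And>v. v \<in> vars_upto n \<Longrightarrow> e' v = e v" for H c e e'
    using loc that unfolding local_upto_def by blast
  have "P H c e \<and> Q H c e \<longleftrightarrow>
      blocks (carrier H) n (k + k') (\<lambda>e. sat H c e (Conj m m')) e" (is "_ \<longleftrightarrow> ?R")
    if H: "carrier H \<noteq> {}" and e: "range e \<subseteq> carrier H" for H c e
  proof -
    have "?R \<longleftrightarrow> blocks (carrier H) n k
        (blocks (carrier H) (n + k) k' (\<lambda>e. sat H c e (Conj m m'))) e" by (rule blocks_add)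
    also have "\<dots> \<longleftrightarrow> blocks (carrier H) n k (\<lambda>e'. sat H c e' m \<and> Q H c e) e"
    proof (rule blocks_cong[OF _ e])
      fix e' assume e': "range e' \<subseteq> carrier H" "\<And>v. v \<in> vars_upto n \<Longrightarrow> e' v = e v"
      have "blocks (carrier H) (n + k) k' (\<lambda>e. sat H c e (Conj m m')) e' =
          blocks (carrier H) (n + k) k' (\<lambda>e. sat H c e m' \<and> sat H c e' m) e'"
      proof (rule blocks_cong[OF _ e'(1)])
        fix e'' assume "\<And>v. v \<in> vars_upto (n + k) \<Longrightarrow> e'' v = e' v"
        then have "sat H c e'' m = sat H c e' m" by (rule swap)
        then show "sat H c e'' (Conj m m') = (sat H c e'' m' \<and> sat H c e' m)" by auto
      qed
      also have "\<dots> \<longleftrightarrow> sat H c e' m \<and> Q H c e'"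
        unfolding blocks_const[OF H] mQ[OF H e'(1)] by blast
      finally show "blocks (carrier H) (n + k) k' (\<lambda>e. sat H c e (Conj m m')) e' =
          (sat H c e' m \<and> Q H c e)" using loc'[OF e'(2)] by simp
    qed
    finally show ?thesis unfolding blocks_const[OF H] mP[OF H e] by blast
  qed
  then show "prenexable T K n (\<lambda>H c e. P H c e \<and> Q H c e)"
    unfolding prenexable_def using m m' fv
    by (intro exI[of _ "k + k'"] exI[of _ "Conj m m'"] conjI allI impI) simp_all
  have "P H c e \<or> Q H c e \<longleftrightarrow>
      blocks (carrier H) n (k + k') (\<lambda>e. sat H c e (Disj m m')) e" (is "_ \<longleftrightarrow> ?R")
    if H: "carrier H \<noteq> {}" and e: "range e \<subseteq> carrier H" for H c e
  proof -
    have "?R \<longleftrightarrow> blocks (carrier H) n k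
        (blocks (carrier H) (n + k) k' (\<lambda>e. sat H c e (Disj m m'))) e" by (rule blocks_add)
    also have "\<dots> \<longleftrightarrow> blocks (carrier H) n k (\<lambda>e'. sat H c e' m \<or> Q H c e) e"
    proof (rule blocks_cong[OF _ e])
      fix e' assume e': "range e' \<subseteq> carrier H" "\<And>v. v \<in> vars_upto n \<Longrightarrow> e' v = e v"
      have "blocks (carrier H) (n + k) k' (\<lambda>e. sat H c e (Disj m m')) e' =
          blocks (carrier H) (n + k) k' (\<lambda>e. sat H c e m' \<or> sat H c e' m) e'"
      proof (rule blocks_cong[OF _ e'(1)])
        fix e'' assume "\<And>v. v \<in> vars_upto (n + k) \<Longrightarrow> e'' v = e' v"
        then have "sat H c e'' m = sat H c e' m" by (rule swap)
        then show "sat H c e'' (Disj m m') = (sat H c e'' m' \<or> sat H c e' m)" by auto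
      qed
      also have "\<dots> \<longleftrightarrow> sat H c e' m \<or> Q H c e'"
        unfolding blocks_const[OF H] mQ[OF H e'(1)] by blast
      finally show "blocks (carrier H) (n + k) k' (\<lambda>e. sat H c e (Disj m m')) e' =
          (sat H c e' m \<or> Q H c e)" using loc'[OF e'(2)] by simp
    qed
    finally show ?thesis unfolding blocks_const[OF H] mP[OF H e] by blast
  qed
  then show "prenexable T K n (\<lambda>H c e. P H c e \<or> Q H c e)"
    unfolding prenexable_def using m m' fv
    by (intro exI[of _ "k + k'"] exI[of _ "Disj m m'"] conjI allI impI) simp_all
qed

lemma prenexable_block:
  fixes P :: "'h monoid \<Rightarrow> ('c \<Rightarrow> 'h) \<Rightarrow> (var \<Rightarrow> 'h) \<Rightarrow> bool"
  assumes "prenexable T K (Suc n) P"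
  shows "prenexable T K n (\<lambda>H c e. \<forall>a\<in>carrier H. \<exists>b\<in>carrier H.
           P H c (e(X (Suc n) := a, Y (Suc n) := b)))"
proof -
  obtain k m where m: "quantifier_free m" "free_vars m \<subseteq> vars_upto (Suc n + k)" "consts_of m \<subseteq> K"
    and mP: "\<And>H c e. carrier H \<noteq> {} \<Longrightarrow> range e \<subseteq> carrier H \<Longrightarrow>
           P H c e = blocks (carrier H) (Suc n) k (\<lambda>e. sat H c e m) e"
    using assms unfolding prenexable_def by (elim exE conjE) simp
  have mP': "P H c (e(X (Suc n) := a, Y (Suc n) := b)) =
      blocks (carrier H) (Suc n) k (\<lambda>e. sat H c e m) (e(X (Suc n) := a, Y (Suc n) := b))"
    if "carrier H \<noteq> {}" "range e \<subseteq> carrier H" "a \<in> carrier H" "b \<in> carrier H" for H c e a b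
    using that by (intro mP range_upd)
  show ?thesis
    unfolding prenexable_def
  proof (intro exI[of _ "Suc k"] exI[of _ m] conjI allI impI)
    fix H :: "'h monoid" and c :: "'c \<Rightarrow> 'h" and e :: "var \<Rightarrow> 'h"
    assume "carrier H \<noteq> {} \<and> range e \<subseteq> carrier H"
    then show "(\<forall>a\<in>carrier H. \<exists>b\<in>carrier H. P H c (e(X (Suc n) := a, Y (Suc n) := b))) =
        blocks (carrier H) n (Suc k) (\<lambda>e. sat H c e m) e"
      unfolding blocks.simps by (intro ball_cong bex_cong HOL.refl mP') simp_all
  qed (use m in simp_all)
qed

lemma prenexable_equiv:
  fixes P Q :: "'h monoid \<Rightarrow> ('c \<Rightarrow> 'h) \<Rightarrow> (var \<Rightarrow> 'h) \<Rightarrow> bool"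
  assumes "prenexable T K n P"
    and "\<And>H c e. carrier H \<noteq> {} \<Longrightarrow> range e \<subseteq> carrier H \<Longrightarrow> P H c e = Q H c e"
  shows "prenexable T K n Q"
proof -
  obtain k m where m: "quantifier_free m" "free_vars m \<subseteq> vars_upto (n + k)" "consts_of m \<subseteq> K"
    and mP: "\<forall>H c e. carrier H \<noteq> {} \<and> range e \<subseteq> carrier H \<longrightarrow>
           P H c e = blocks (carrier H) n k (\<lambda>e. sat H c e m) e"
    using assms(1) unfolding prenexable_def by (elim exE conjE)
  show ?thesis
    unfolding prenexable_def
  proof (intro exI[of _ k] exI[of _ m] conjI allI impI m)
    fix H :: "'h monoid" and c :: "'c \<Rightarrow> 'h" and e :: "var \<Rightarrow> 'h"
    assume "carrier H \<noteq> {} \<and> range e \<subseteq> carrier H"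
    then show "Q H c e = blocks (carrier H) n k (\<lambda>e. sat H c e m) e"
      using mP assms(2)[of H e c] by simp
  qed
qed

lemma prenexable_mono:
  assumes "prenexable T K n P" "K \<subseteq> K'"
  shows "prenexable T K' n P"
proof -
  obtain k m where "quantifier_free m" "free_vars m \<subseteq> vars_upto (n + k)" "consts_of m \<subseteq> K"
    and "\<forall>H c e. carrier H \<noteq> {} \<and> range e \<subseteq> carrier H \<longrightarrow>
           P H c e = blocks (carrier H) n k (\<lambda>e. sat H c e m) e"
    using assms(1) unfolding prenexable_def by (elim exE conjE)
  moreover from this have "consts_of m \<subseteq> K'" using assms(2) by (rule_tac subset_trans)
  ultimately show ?thesis
    unfolding prenexable_def by (intro exI[of _ k] exI[of _ m] conjI)
qed

lemma local_upto_sat: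
  fixes \<phi> :: "'c formula"
  assumes "r ` free_vars \<phi> \<subseteq> vars_upto n"
  shows "local_upto n (\<lambda>(H :: 'h monoid) c e. sat H c (e \<circ> r) \<phi> = s)"
  unfolding local_upto_def
proof (intro allI impI)
  fix H :: "'h monoid" and c :: "'c \<Rightarrow> 'h" and e e' :: "var \<Rightarrow> 'h"
  assume "\<forall>v\<in>vars_upto n. e v = e' v"
  then have "sat H c (e \<circ> r) \<phi> = sat H c (e' \<circ> r) \<phi>"
    using assms by (intro sat_cong) auto
  then show "(sat H c (e \<circ> r) \<phi> = s) = (sat H c (e' \<circ> r) \<phi> = s)" by simp
qed

lemma prenexable_sat:
  fixes T :: "'h itself" and \<phi> :: "'c formula"
  assumes "r ` free_vars \<phi> \<subseteq> vars_upto n"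
  shows "prenexable T (consts_of \<phi>) n (\<lambda>H c e. sat H c (e \<circ> r) \<phi> = s)"
  using assms
proof (induction \<phi> arbitrary: r n s)
  case (Eq t u)
  let ?m = "Eq (rename r t) (rename r u)"
  have "free_vars ?m \<subseteq> vars_upto n" using Eq by (auto simp: trm_vars_rename)
  then show ?case unfolding prenexable_def
    by (intro exI[of _ 0] exI[of _ "if s then ?m else Neg ?m"])
       (auto simp: trm_val_rename trm_consts_rename)
next
  case (Neg \<phi>)
  show ?case
  proof (rule prenexable_equiv)
    show "prenexable T (consts_of (Neg \<phi>)) n (\<lambda>H c e. sat H c (e \<circ> r) \<phi> = (\<not> s))"
      using Neg.IH[of r n "\<not> s"] Neg.prems by (simp del: o_apply)
  qed (simp_all only: sat.simps, blast)
next
  case (Conj \<phi> \<psi>)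
  have 1: "prenexable T (consts_of (Conj \<phi> \<psi>)) n (\<lambda>H c e. sat H c (e \<circ> r) \<phi> = s)"
    by (rule prenexable_mono[OF Conj.IH(1)]) (use Conj.prems in auto)
  have 2: "prenexable T (consts_of (Conj \<phi> \<psi>)) n' (\<lambda>H c e. sat H c (e \<circ> r) \<psi> = s)"
    if "n' \<ge> n" for n'
    by (rule prenexable_mono[OF Conj.IH(2)]) (use Conj.prems vars_upto_mono[OF that] in auto)
  have 3: "local_upto n (\<lambda>H c e. sat H c (e \<circ> r) \<psi> = s)"
    by (rule local_upto_sat) (use Conj.prems in auto)
  show ?case
  proof (cases s)
    case True
    show ?thesis
      by (rule prenexable_equiv[OF prenexable_conj_disj(1)[OF 1 2 3]])
        (simp_all only: sat.simps True, blast)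
  next
    case False
    show ?thesis
      by (rule prenexable_equiv[OF prenexable_conj_disj(2)[OF 1 2 3]])
        (simp_all only: sat.simps False, blast)
  qed
next
  case (Disj \<phi> \<psi>)
  have 1: "prenexable T (consts_of (Disj \<phi> \<psi>)) n (\<lambda>H c e. sat H c (e \<circ> r) \<phi> = s)"
    by (rule prenexable_mono[OF Disj.IH(1)]) (use Disj.prems in auto)
  have 2: "prenexable T (consts_of (Disj \<phi> \<psi>)) n' (\<lambda>H c e. sat H c (e \<circ> r) \<psi> = s)"
    if "n' \<ge> n" for n'
    by (rule prenexable_mono[OF Disj.IH(2)]) (use Disj.prems vars_upto_mono[OF that] in auto)
  have 3: "local_upto n (\<lambda>H c e. sat H c (e \<circ> r) \<psi> = s)"
    by (rule local_upto_sat) (use Disj.prems in auto)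
  show ?case
  proof (cases s)
    case True
    show ?thesis
      by (rule prenexable_equiv[OF prenexable_conj_disj(2)[OF 1 2 3]])
        (simp_all only: sat.simps True, blast)
  next
    case False
    show ?thesis
      by (rule prenexable_equiv[OF prenexable_conj_disj(1)[OF 1 2 3]])
        (simp_all only: sat.simps False, blast)
  qed
next
  case (Forall v \<phi>)
  let ?w = "if s then X (Suc n) else Y (Suc n)"
  have w: "?w \<in> vars_upto (Suc n)" by (auto simp: vars_upto_def)
  have fv: "r u \<in> vars_upto n" if "u \<in> free_vars \<phi>" "u \<noteq> v" for u
    using Forall.prems that by auto
  have "prenexable T (consts_of \<phi>) (Suc n) (\<lambda>H c e. sat H c (e \<circ> r(v := ?w)) \<phi> = s)"
    by (rule Forall.IH) (use fv w vars_upto_mono[of n "Suc n"] in auto)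
  from prenexable_block[OF this]
  have blk: "prenexable T (consts_of \<phi>) n (\<lambda>H c e. \<forall>a\<in>carrier H. \<exists>b\<in>carrier H.
      sat H c (e(X (Suc n) := a, Y (Suc n) := b) \<circ> r(v := ?w)) \<phi> = s)" .
  have eq: "sat H c (e(X (Suc n) := a, Y (Suc n) := b) \<circ> r(v := ?w)) \<phi> =
      sat H c ((e \<circ> r)(v := if s then a else b)) \<phi>" for H :: "'h monoid" and c e a b
  proof (rule sat_cong)
    fix u assume "u \<in> free_vars \<phi>"
    then have "u \<noteq> v \<Longrightarrow> r u \<noteq> X (Suc n) \<and> r u \<noteq> Y (Suc n)"
      using fv[of u] by (auto simp: vars_upto_def)
    then show "(e(X (Suc n) := a, Y (Suc n) := b) \<circ> r(v := ?w)) u =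
        ((e \<circ> r)(v := if s then a else b)) u" by auto
  qed
  have "prenexable T (consts_of \<phi>) n (\<lambda>H c e. sat H c (e \<circ> r) (Forall v \<phi>) = s)"
    by (rule prenexable_equiv[OF blk])
      (unfold eq sat.simps, cases s, auto simp only: if_True if_False simp_thms)
  then show ?case by (simp only: formula.set)
next
  case (Exists v \<phi>)
  let ?w = "if s then Y (Suc n) else X (Suc n)"
  have w: "?w \<in> vars_upto (Suc n)" by (auto simp: vars_upto_def)
  have fv: "r u \<in> vars_upto n" if "u \<in> free_vars \<phi>" "u \<noteq> v" for u
    using Exists.prems that by auto
  have "prenexable T (consts_of \<phi>) (Suc n) (\<lambda>H c e. sat H c (e \<circ> r(v := ?w)) \<phi> = s)"
    by (rule Exists.IH) (use fv w vars_upto_mono[of n "Suc n"] in auto)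
  from prenexable_block[OF this]
  have blk: "prenexable T (consts_of \<phi>) n (\<lambda>H c e. \<forall>a\<in>carrier H. \<exists>b\<in>carrier H.
      sat H c (e(X (Suc n) := a, Y (Suc n) := b) \<circ> r(v := ?w)) \<phi> = s)" .
  have eq: "sat H c (e(X (Suc n) := a, Y (Suc n) := b) \<circ> r(v := ?w)) \<phi> =
      sat H c ((e \<circ> r)(v := if s then b else a)) \<phi>" for H :: "'h monoid" and c e a b
  proof (rule sat_cong)
    fix u assume "u \<in> free_vars \<phi>"
    then have "u \<noteq> v \<Longrightarrow> r u \<noteq> X (Suc n) \<and> r u \<noteq> Y (Suc n)"
      using fv[of u] by (auto simp: vars_upto_def)
    then show "(e(X (Suc n) := a, Y (Suc n) := b) \<circ> r(v := ?w)) u =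
        ((e \<circ> r)(v := if s then b else a)) u" by auto
  qed
  have "prenexable T (consts_of \<phi>) n (\<lambda>H c e. sat H c (e \<circ> r) (Exists v \<phi>) = s)"
    by (rule prenexable_equiv[OF blk])
      (unfold eq sat.simps, cases s, auto simp only: if_True if_False simp_thms)
  then show ?case by (simp only: formula.set)
qed

theorem ex_standard_form:
  fixes G :: "'g monoid"
  assumes "sentence G \<phi>"
  shows "\<exists>k \<phi>\<^sub>0. standard_form_of G \<phi> k \<phi>\<^sub>0"
proof -
  have "prenexable TYPE('g) (consts_of \<phi>) 0 (\<lambda>H c e. sat H c (e \<circ> id) \<phi> = True)"
    by (rule prenexable_sat) (use assms in \<open>simp add: sentence_def\<close>)
  then obtain k m where m: "quantifier_free m" "free_vars m \<subseteq> vars_upto k"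
      "consts_of m \<subseteq> consts_of \<phi>"
    and eq: "\<And>(H :: 'g monoid) c e. carrier H \<noteq> {} \<Longrightarrow> range e \<subseteq> carrier H \<Longrightarrow>
        sat H c e \<phi> = blocks (carrier H) 0 k (\<lambda>e. sat H c e m) e"
    unfolding prenexable_def by auto
  have "sat H c e \<phi> = sat H c e (standard_sentence k m)"
    if "group H" "e \<in> UNIV \<rightarrow> carrier H" for H :: "'g monoid" and c e
  proof -
    have "carrier H \<noteq> {}" "range e \<subseteq> carrier H"
      using that group.is_monoid monoid.one_closed by blast+
    then show ?thesis
      using eq sat_quantify[of H c e 0 k m] by (simp add: standard_sentence_def)
  qed
  then have "equivalent G \<phi> (standard_sentence k m)"
    by (auto simp: equivalent_def models_def)
  then show ?thesis
    using m assms unfolding standard_form_of_def standard_matrix_def sentence_def by blast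
qed

end

theory Submission
  imports Defs
begin

text \<open>
  Why the theorem holds. Let \<open>G\<close> be the group and \<open>\<phi>\<^sub>0\<close> the matrix of a true sentence in standard form.
  Play the quantifiers in \<open>G\<close>: choose \<open>g\<^sub>1\<close>, let truth supply an answer \<open>y\<^sub>1\<close>, choose \<open>g\<^sub>2\<close>, and so on,
  where each \<open>g\<^sub>n\<close> is generic with respect to everything that came before it. Afterwards replace
  \<open>g\<^sub>k, \<dots>, g\<^sub>1\<close>, in this order, by the variables \<open>x\<^sub>k, \<dots>, x\<^sub>1\<close>. One replacement is a map \<open>f\<close> that sends
  \<open>g\<^sub>n\<close> to \<open>x\<^sub>n\<close>, fixes the constants, the other variables and the elements chosen before \<open>g\<^sub>n\<close>, respects
  the finitely many products that occur in the evaluation of \<open>\<phi>\<^sub>0\<close>, and is undone by the specialization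
  \<open>x\<^sub>n \<mapsto> g\<^sub>n\<close> (\<open>exists_generic_lift\<close>, used in \<open>lifted_step\<close>). The equations that hold for the values in
  \<open>G\<close> therefore survive the replacement; those that fail for the values in \<open>G\<close> must also fail
  afterwards, because the specialization leads back to these values. So \<open>\<phi>\<^sub>0\<close> holds in \<open>G[X]\<close>. The
  replacements are carried out in the partially commutative group \<open>P\<close> on the graph of \<open>G\<close> together
  with one isolated vertex for each variable, which has a homomorphism to \<open>G[X]\<close>.

  The map \<open>f\<close> is built like a Brooks counting quasimorphism. Fix a vertex \<open>a\<close>. Its link generates a
  subgroup \<open>L\<close>, and the cosets of \<open>L\<close> are the edges of the Bass-Serre tree for the decomposition of
  the group as an HNN extension with stable letter \<open>a\<close>. The sequence of edges that the geodesic from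
  the base vertex to its translate by \<open>y\<close> crosses is encoded by \<open>crossings a y\<close>. It is obtained without
  a normal form theorem, as the unique crossed homomorphism to the free group on the cosets of \<open>L\<close>
  that sends \<open>a\<close> to \<open>L\<close> and the other generators to 1. The generic element is a product of blocks
  \<open>g = B\<^sub>0 B\<^sub>1 \<cdots> B\<^bsub>M-1\<^esub> a\<close>. For a fixed index \<open>i\<close>, the map \<open>f\<close> inserts a conjugate of \<open>x g\<^sup>-\<^sup>1\<close> wherever a
  translate \<open>(h L, h B\<^sub>i L)\<close> of the block \<open>B\<^sub>i\<close> appears as two consecutive edges in the path of \<open>y\<close>. In the
  free group the paths of \<open>y\<close>, \<open>z\<close> and \<open>y z\<close> form a tripod, so that \<open>f (y z) = f y f z\<close> unless the
  block straddles one of the three junctions of the tripod. Two consecutive edges determine the index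
  of the block between them, so each junction spoils at most one index. Hence, if there are more
  blocks than junctions and turns in the paths of the constants, then some index \<open>i\<close> is good for all
  of them at once.

  All this needs that \<open>h\<close> can be read off from \<open>(h L, h B\<^sub>i L)\<close>, that is, \<open>L\<close> meets its conjugate by \<open>B\<^sub>i\<close>
  trivially. This is the point where the hypotheses enter: if \<open>G\<close> is directly indecomposable, the complement of
  its graph is connected (\<open>decomposable_if_complement_disconnected\<close>), and as \<open>G\<close> is not abelian, there are at
  least two vertices. Then the complement has a vertex \<open>a\<close> whose removal leaves it connected, and a
  block can be taken to spell \<open>a\<close> followed by a walk in the complement through all other vertices.
  An element of \<open>L\<close> whose conjugate by such a word is again in \<open>L\<close> commutes with one letter after the
  other, lies in the link of every vertex, and is trivial (\<open>conjugate_into_link\<close>, \<open>block_stabilizer\<close>).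
\<close>

section \<open>Reduced paths in a free group\<close>

text \<open>A signed edge is an element of a set with an orientation, and a list of signed edges
  without adjacent inverse pairs is a normal form of an element of the free group on this set. Paths are kept as
  lists, because later it matters which edges stand next to each other.\<close>

definition opp :: "'e \<times> bool \<Rightarrow> 'e \<times> bool" where
  "opp e = (fst e, \<not> snd e)"

lemma opp_opp [simp]: "opp (opp e) = e"
  by (simp add: opp_def)

lemma opp_eq_iff: "opp e = e' \<longleftrightarrow> e = opp e'"
  by (metis opp_opp)

definition inv_path :: "('e \<times> bool) list \<Rightarrow> ('e \<times> bool) list" where
  "inv_path W = rev (map opp W)"

lemma inv_path_simps [simp]:
  "inv_path [] = []" "inv_path (e # W) = inv_path W @ [opp e]" "inv_path (U @ W) = inv_path W @ inv_path U"
  "inv_path W = [] \<longleftrightarrow> W = []"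
  by (simp_all add: inv_path_def)

abbreviation reduced :: "('e \<times> bool) list \<Rightarrow> bool" where
  "reduced \<equiv> successively (\<lambda>e e'. e' \<noteq> opp e)"

text \<open>Left multiplication of a reduced path by one signed edge.\<close>

fun push :: "'e \<times> bool \<Rightarrow> ('e \<times> bool) list \<Rightarrow> ('e \<times> bool) list" where
  "push e [] = [e]"
| "push e (e' # W) = (if e' = opp e then W else e # e' # W)"

lemma reduced_push: "reduced W \<Longrightarrow> reduced (push e W)"
  by (cases W) (auto simp: successively_Cons)

lemma push_opp: "reduced W \<Longrightarrow> push (opp e) (push e W) = W"
  by (cases W; cases "tl W") (auto simp: successively_Cons opp_eq_iff)

lemma push_opp': "reduced W \<Longrightarrow> push e (push (opp e) W) = W"
  using push_opp[of W "opp e"] by simp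

lemma set_push: "set (push e W) \<subseteq> insert e (set W)"
  by (cases W) auto

text \<open>The product in the free group, for a reduced second factor.\<close>

definition join :: "('e \<times> bool) list \<Rightarrow> ('e \<times> bool) list \<Rightarrow> ('e \<times> bool) list" where
  "join U W = foldr push U W"

lemma join_simps [simp]: "join [] W = W" "join (e # U) W = push e (join U W)"
  by (simp_all add: join_def)

lemma reduced_join: "reduced W \<Longrightarrow> reduced (join U W)"
  by (induction U) (auto intro: reduced_push)

lemma set_join: "set (join U W) \<subseteq> set U \<union> set W"
proof (induction U)
  case (Cons e U)
  then show ?case using set_push[of e "join U W"] by auto
qed simp

lemma join_push: "reduced U \<Longrightarrow> reduced W \<Longrightarrow> join (push e U) W = push e (join U W)"
  by (cases U) (auto simp: push_opp' reduced_join)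

lemma join_Nil_right: "reduced U \<Longrightarrow> join U [] = U"
proof (induction U)
  case (Cons e U)
  then have "join U [] = U" by (cases "U = []") (auto simp: successively_Cons)
  then show ?case using Cons by (cases U) (auto simp: successively_Cons)
qed simp

text \<open>Injectivity ensures that no new cancellation appears after the relabelling.\<close>

lemma map_push:
  assumes "inj_on f (insert (fst e) (fst ` set W))"
  shows "push (apfst f e) (map (apfst f) W) = map (apfst f) (push e W)"
proof (cases W)
  case (Cons e' V)
  have "f (fst e') = f (fst e) \<longleftrightarrow> fst e' = fst e"
    by (rule inj_on_eq_iff[OF assms]) (simp_all add: Cons)
  then have "apfst f e' = opp (apfst f e) \<longleftrightarrow> e' = opp e"
    unfolding opp_def by (cases e; cases e') auto
  then show ?thesis unfolding Cons by simp
qed simp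

text \<open>In a tree, three points span a tripod: \<open>B\<close> is the part that cancels in the product of \<open>U\<close>
  and \<open>W\<close>, and the three legs are \<open>A\<close>, \<open>B\<close> and \<open>C\<close>.\<close>

lemma tripod:
  assumes "reduced U" "reduced W"
  shows "\<exists>A B C. U = A @ B \<and> W = inv_path B @ C \<and> join U W = A @ C"
  using assms(1)
proof (induction U)
  case Nil
  have "W = inv_path [] @ W" by simp
  then show ?case by (metis append_Nil join_simps(1))
next
  case (Cons e U)
  then obtain A B C where ABC: "U = A @ B" "W = inv_path B @ C" "join U W = A @ C"
    by (auto simp: successively_Cons)
  show ?case
  proof (cases A)
    case (Cons a A')
    then have "a \<noteq> opp e" using Cons.prems ABC by auto
    then show ?thesis
      using ABC Cons by (intro exI[of _ "e # A"] exI[of _ B] exI[of _ C]) auto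
  next
    case Nil
    show ?thesis
    proof (cases "C \<noteq> [] \<and> hd C = opp e")
      case True
      then obtain C' where "C = opp e # C'" by (cases C) auto
      then show ?thesis
        using ABC Nil by (intro exI[of _ "[]"] exI[of _ "e # B"] exI[of _ C']) auto
    next
      case False
      then show ?thesis
        using ABC Nil by (intro exI[of _ "[e]"] exI[of _ B] exI[of _ C]) (cases C; auto)
    qed
  qed
qed

section \<open>Products over consecutive edges\<close>

fun pair_prod :: "('g, 'm) monoid_scheme \<Rightarrow> ('e \<Rightarrow> 'e \<Rightarrow> 'g) \<Rightarrow> 'e list \<Rightarrow> 'g" where
  "pair_prod G f [] = \<one>\<^bsub>G\<^esub>"
| "pair_prod G f [e] = \<one>\<^bsub>G\<^esub>"
| "pair_prod G f (e # e' # W) = f e e' \<otimes>\<^bsub>G\<^esub> pair_prod G f (e' # W)"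

text \<open>The factor contributed by the pair of edges that becomes adjacent when two paths are
  concatenated.\<close>

definition junction :: "('g, 'm) monoid_scheme \<Rightarrow> ('e \<Rightarrow> 'e \<Rightarrow> 'g) \<Rightarrow> 'e list \<Rightarrow> 'e list \<Rightarrow> 'g" where
  "junction G f U W = (if U = [] \<or> W = [] then \<one>\<^bsub>G\<^esub> else f (last U) (hd W))"

context group
begin

lemma mult_cancel_simps [simp]:
  assumes "x \<in> carrier G" "y \<in> carrier G"
  shows "inv x \<otimes> (x \<otimes> y) = y" and "x \<otimes> (inv x \<otimes> y) = y"
  using assms by (simp_all flip: m_assoc)

lemma pair_prod_closed [simp]:
  "(\<And>e e'. f e e' \<in> carrier G) \<Longrightarrow> pair_prod G f W \<in> carrier G"
  by (induction W rule: induct_list012) auto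

lemma junction_closed [simp]:
  "(\<And>e e'. f e e' \<in> carrier G) \<Longrightarrow> junction G f U W \<in> carrier G"
  by (auto simp: junction_def)

lemma pair_prod_append:
  assumes f: "\<And>e e'. f e e' \<in> carrier G"
  shows "pair_prod G f (U @ W) = pair_prod G f U \<otimes> junction G f U W \<otimes> pair_prod G f W"
proof (induction U)
  case Nil
  then show ?case using f by (simp add: junction_def)
next
  case (Cons e U)
  show ?case
  proof (cases U)
    case Nil
    then show ?thesis using f by (cases W) (auto simp: junction_def)
  next
    case (Cons e' U')
    then show ?thesis
      using Cons.IH f by (simp add: junction_def m_assoc)
  qed
qed

lemma pair_prod_inv_path:
  assumes f: "\<And>e e'. f e e' \<in> carrier G"
    and inv: "\<And>e e'. f (opp e') (opp e) = inv (f e e')"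
  shows "pair_prod G f (inv_path W) = inv (pair_prod G f W)"
proof (induction W)
  case (Cons e W)
  show ?case
  proof (cases W)
    case (Cons e' W')
    have "junction G f (inv_path W) [opp e] = inv (f e e')"
      using Cons inv by (simp add: junction_def)
    moreover have "pair_prod G f (inv_path (e # W))
        = pair_prod G f (inv_path W) \<otimes> junction G f (inv_path W) [opp e] \<otimes> pair_prod G f [opp e]"
      unfolding inv_path_simps(2) by (rule pair_prod_append[OF f])
    ultimately show ?thesis
      using Cons.IH Cons f by (simp add: inv_mult_group)
  qed simp
qed simp

lemma pair_prod_map:
  assumes f: "\<And>e e'. f e e' \<in> carrier G" and y: "y \<in> carrier G"
    and eq: "\<And>e e'. e \<in> set W \<Longrightarrow> e' \<in> set W \<Longrightarrow> f (t e) (t e') = y \<otimes> f e e' \<otimes> inv y"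
  shows "pair_prod G f (map t W) = y \<otimes> pair_prod G f W \<otimes> inv y"
  using eq
proof (induction W rule: induct_list012)
  case (3 e e' W)
  have "pair_prod G f (map t (e' # W)) = y \<otimes> pair_prod G f (e' # W) \<otimes> inv y"
    by (rule 3) (use 3 in auto)
  moreover have "f (t e) (t e') = y \<otimes> f e e' \<otimes> inv y" using 3 by simp
  ultimately show ?case
    using f y by (simp add: m_assoc)
qed (use y in auto)

lemma pair_prod_trivial:
  assumes "\<And>e e'. (e, e') \<in> set (zip W (tl W)) \<Longrightarrow> f e e' = \<one>"
  shows "pair_prod G f W = \<one>"
  using assms by (induction W rule: induct_list012) auto

text \<open>This is the property that makes such a product useful: it is multiplicative in the free group
  as soon as nothing happens at the three junctions of a tripod, since the contributions inside the
  cancelling leg are inverse to each other.\<close>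

lemma pair_prod_join:
  assumes f: "\<And>e e'. f e e' \<in> carrier G"
    and inv: "\<And>e e'. f (opp e') (opp e) = inv (f e e')"
    and ABC: "U = A @ B" "W = inv_path B @ C" "V = A @ C"
    and triv: "junction G f A B = \<one>" "junction G f (inv_path B) C = \<one>" "junction G f A C = \<one>"
  shows "pair_prod G f V = pair_prod G f U \<otimes> pair_prod G f W"
proof -
  let ?P = "pair_prod G f"
  have "?P U \<otimes> ?P W = ?P A \<otimes> ?P B \<otimes> (inv (?P B) \<otimes> ?P C)"
    unfolding ABC pair_prod_append[OF f] triv using f inv by (simp add: pair_prod_inv_path)
  also have "\<dots> = ?P A \<otimes> ?P C"
    using f by (simp add: m_assoc)
  finally show ?thesis unfolding ABC pair_prod_append[OF f] triv using f by simp
qed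

end

section \<open>Homomorphisms from presented groups\<close>

abbreviation word_class :: "'s set \<Rightarrow> ('s \<times> bool) list set \<Rightarrow> ('s \<times> bool) list \<Rightarrow> ('s \<times> bool) list set" where
  "word_class S R w \<equiv> word_cong S R `` {w}"

definition word_value :: "('h, 'm) monoid_scheme \<Rightarrow> ('s \<Rightarrow> 'h) \<Rightarrow> ('s \<times> bool) list \<Rightarrow> 'h" where
  "word_value H \<phi> w =
     foldr (\<lambda>l h. (if snd l then \<phi> (fst l) else inv\<^bsub>H\<^esub> (\<phi> (fst l))) \<otimes>\<^bsub>H\<^esub> h) w \<one>\<^bsub>H\<^esub>"

lemma word_value_simps [simp]:
  "word_value H \<phi> [] = \<one>\<^bsub>H\<^esub>"
  "word_value H \<phi> ((s, b) # w) = (if b then \<phi> s else inv\<^bsub>H\<^esub> (\<phi> s)) \<otimes>\<^bsub>H\<^esub> word_value H \<phi> w"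
  by (simp_all add: word_value_def)

context group
begin

lemma word_value_closed [simp]: "\<phi> \<in> S \<rightarrow> carrier G \<Longrightarrow> w \<in> words S \<Longrightarrow> word_value G \<phi> w \<in> carrier G"
  by (induction w) (auto simp: Pi_iff)

lemma word_value_append:
  "\<phi> \<in> S \<rightarrow> carrier G \<Longrightarrow> u \<in> words S \<Longrightarrow> v \<in> words S \<Longrightarrow>
     word_value G \<phi> (u @ v) = word_value G \<phi> u \<otimes> word_value G \<phi> v"
proof (induction u)
  case (Cons l u)
  then obtain s b where l: "l = (s, b)" "s \<in> S" by (cases l) auto
  then have "\<phi> s \<in> carrier G" using Cons by auto
  then show ?case using Cons l by (auto simp: m_assoc)
qed auto

lemma word_value_cong:
  assumes "\<phi> \<in> S \<rightarrow> carrier G"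
    and "\<And>r. r \<in> R \<Longrightarrow> r \<in> words S \<Longrightarrow> word_value G \<phi> r = \<one>"
    and "(u, v) \<in> word_cong S R"
  shows "word_value G \<phi> u = word_value G \<phi> v"
  using assms(3)
proof (induction rule: word_cong.induct)
  case (append u u' v v')
  then show ?case
    using word_value_append[OF assms(1)] word_cong_words[of _ _ S R] by metis
next
  case (cancel s b)
  then have "\<phi> s \<in> carrier G" using assms(1) by auto
  then show ?case by (cases b) auto
qed (use assms(2) in auto)

end

lemma word_class_eq: "(u, v) \<in> word_cong S R \<Longrightarrow> word_class S R u = word_class S R v"
  by (rule equiv_class_eq[OF equiv_word_cong])

lemma word_class_eqD: "word_class S R u = word_class S R v \<Longrightarrow> v \<in> words S \<Longrightarrow> (u, v) \<in> word_cong S R"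
  by (metis Image_singleton_iff word_cong.refl)

lemma word_class_in_presented: "w \<in> words S \<Longrightarrow> word_class S R w \<in> carrier (presented_group S R)"
  by (auto simp: presented_group_def quotient_def)

lemma one_presented: "\<one>\<^bsub>presented_group S R\<^esub> = word_class S R []"
  by (simp add: presented_group_def)

lemma presentedE:
  assumes "y \<in> carrier (presented_group S R)"
  obtains w where "w \<in> words S" "y = word_class S R w"
  using assms by (auto simp: presented_group_def quotient_def)

lemma generator_closed [simp]: "s \<in> S \<Longrightarrow> generator S R s \<in> carrier (presented_group S R)"
  unfolding generator_def by (rule word_class_in_presented) simp

lemma inv_generator:
  assumes "s \<in> S"
  shows "inv\<^bsub>presented_group S R\<^esub> (generator S R s) = word_class S R [(s, False)]"
proof -
  interpret P: group "presented_group S R" by (rule group_presented_group)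
  show ?thesis
  proof (rule P.inv_equality)
    show "word_class S R [(s, False)] \<otimes>\<^bsub>presented_group S R\<^esub> generator S R s = \<one>\<^bsub>presented_group S R\<^esub>"
      using assms word_class_eq[OF word_cong.cancel[OF assms, of False R]]
      unfolding generator_def one_presented by (subst mult_presented_group) auto
  qed (use assms in \<open>auto intro: word_class_in_presented\<close>)
qed

lemma word_class_eq_value:
  assumes "w \<in> words S"
  shows "word_class S R w = word_value (presented_group S R) (generator S R) w"
  using assms
proof (induction w)
  case (Cons l w)
  then obtain s b where l: "l = (s, b)" "s \<in> S" "w \<in> words S" by (cases l) auto
  have "word_class S R (l # w)
      = word_class S R [l] \<otimes>\<^bsub>presented_group S R\<^esub> word_class S R w"
    using mult_presented_group[of "[l]" S w R] l by auto
  also have "word_class S R [l] = (if b then generator S R s else inv\<^bsub>presented_group S R\<^esub> (generator S R s))"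
    using l inv_generator[of s S R] by (simp add: generator_def)
  finally show ?case using Cons l by simp
qed (simp add: one_presented)

lemma hom_word_value:
  assumes "group G" "group H" "f \<in> hom G H" "\<phi> \<in> S \<rightarrow> carrier G" "w \<in> words S"
  shows "f (word_value G \<phi> w) = word_value H (f \<circ> \<phi>) w"
  using assms(5)
proof (induction w)
  case Nil
  then show ?case using assms hom_one by auto
next
  case (Cons l w)
  then obtain s b where l: "l = (s, b)" "s \<in> S" "w \<in> words S" by (cases l) auto
  interpret group_hom G H f using assms by (simp add: group_hom_def group_hom_axioms_def)
  have "\<phi> s \<in> carrier G" using l assms by auto
  then show ?case using Cons l G.word_value_closed[OF assms(4) l(3)] by auto
qed

text \<open>The universal property of a presentation.\<close>

lemma presented_hom:
  assumes "group H" "\<phi> \<in> S \<rightarrow> carrier H"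
    and "\<And>r. r \<in> R \<Longrightarrow> r \<in> words S \<Longrightarrow> word_value H \<phi> r = \<one>\<^bsub>H\<^esub>"
  obtains f where "f \<in> hom (presented_group S R) H" "\<And>s. s \<in> S \<Longrightarrow> f (generator S R s) = \<phi> s"
proof
  interpret H: group H by fact
  define f where "f A = word_value H \<phi> (SOME w. w \<in> words S \<and> A = word_class S R w)" for A
  have f: "f (word_class S R w) = word_value H \<phi> w" if w: "w \<in> words S" for w
  proof -
    define v where "v = (SOME v. v \<in> words S \<and> word_class S R w = word_class S R v)"
    have v: "v \<in> words S \<and> word_class S R w = word_class S R v"
      unfolding v_def by (rule someI[of _ w]) (use w in simp)
    then have "(w, v) \<in> word_cong S R" using word_class_eqD by metis
    then have "word_value H \<phi> w = word_value H \<phi> v"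
      using H.word_value_cong[OF assms(2,3)] by metis
    then show ?thesis by (simp add: f_def v_def)
  qed
  show "f (generator S R s) = \<phi> s" if "s \<in> S" for s
    using that assms(2) f[of "[(s, True)]"] by (auto simp: generator_def Pi_iff)
  show "f \<in> hom (presented_group S R) H"
  proof (rule homI)
    fix x assume "x \<in> carrier (presented_group S R)"
    then show "f x \<in> carrier H" using f assms(2) by (elim presentedE) auto
  next
    fix x y assume "x \<in> carrier (presented_group S R)" "y \<in> carrier (presented_group S R)"
    then obtain u v where uv: "u \<in> words S" "v \<in> words S" "x = word_class S R u" "y = word_class S R v"
      by (elim presentedE)
    then show "f (x \<otimes>\<^bsub>presented_group S R\<^esub> y) = f x \<otimes>\<^bsub>H\<^esub> f y"
      using mult_presented_group[of u S v R] f[of u] f[of v] f[of "u @ v"] H.word_value_append[OF assms(2)]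
      by simp
  qed
qed

lemma presented_hom_eqI:
  assumes "group H" "f \<in> hom (presented_group S R) H" "g \<in> hom (presented_group S R) H"
    and "\<And>s. s \<in> S \<Longrightarrow> f (generator S R s) = g (generator S R s)"
    and "y \<in> carrier (presented_group S R)"
  shows "f y = g y"
proof -
  obtain w where w: "w \<in> words S" "y = word_class S R w" using assms(5) by (rule presentedE)
  note P = group_presented_group[of S R]
  have gen: "generator S R \<in> S \<rightarrow> carrier (presented_group S R)" by auto
  have "word_value H (f \<circ> generator S R) w = word_value H (g \<circ> generator S R) w"
    using w(1) assms(4) by (induction w) auto
  then show ?thesis
    unfolding w(2) word_class_eq_value[OF w(1)]
    using hom_word_value[OF P assms(1,2) gen w(1)] hom_word_value[OF P assms(1,3) gen w(1)] by simp
qed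

section \<open>Partially commutative groups and their parabolic subgroups\<close>

definition commutators :: "('v \<times> 'v) set \<Rightarrow> ('v \<times> bool) list set" where
  "commutators E = {[(a, False), (b, False), (a, True), (b, True)] | a b. (a, b) \<in> E}"

definition raag :: "'v set \<Rightarrow> ('v \<times> 'v) set \<Rightarrow> ('v \<times> bool) list set monoid" where
  "raag S E = presented_group S (commutators E)"

lemma pc_group_eq_raag: "pc_group \<Gamma> = raag (pverts \<Gamma>) (parcs \<Gamma>)"
  by (simp add: pc_group_def raag_def commutators_def)

definition pos :: "'v list \<Rightarrow> ('v \<times> bool) list" where
  "pos u = map (\<lambda>s. (s, True)) u"

lemma pos_simps [simp]: "pos [] = []" "pos (s # u) = (s, True) # pos u" "pos (u @ v) = pos u @ pos v"
  by (simp_all add: pos_def)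

lemma pos_in_words [simp]: "pos u \<in> words T \<longleftrightarrow> set u \<subseteq> T"
  by (induction u) auto

locale commutation_graph =
  fixes S :: "'v set" and E :: "('v \<times> 'v) set"
  assumes edges: "E \<subseteq> S \<times> S" and sym: "(s, t) \<in> E \<Longrightarrow> (t, s) \<in> E" and irrefl: "(s, s) \<notin> E"
begin

abbreviation "R \<equiv> raag S E"

sublocale group "raag S E"
  unfolding raag_def by (rule group_presented_group)

abbreviation rmult (infixl "\<cdot>" 70) where "x \<cdot> y \<equiv> x \<otimes>\<^bsub>raag S E\<^esub> y"

definition val :: "('v \<times> bool) list \<Rightarrow> ('v \<times> bool) list set" where
  "val w = word_class S (commutators E) w"

definition gen :: "'v \<Rightarrow> ('v \<times> bool) list set" where
  "gen s = val [(s, True)]"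

lemma gen_eq_generator: "gen s = generator S (commutators E) s"
  by (simp add: gen_def val_def generator_def)

lemma val_closed [simp]: "w \<in> words S \<Longrightarrow> val w \<in> carrier R"
  by (simp add: val_def raag_def word_class_in_presented)

lemma gen_closed [simp]: "s \<in> S \<Longrightarrow> gen s \<in> carrier R"
  by (simp add: gen_def)

lemma valE:
  assumes "y \<in> carrier R"
  obtains w where "w \<in> words S" "y = val w"
  using assms unfolding raag_def val_def by (rule presentedE)

lemma val_Nil: "val [] = \<one>\<^bsub>R\<^esub>"
  by (simp add: val_def raag_def one_presented)

lemma val_append: "u \<in> words S \<Longrightarrow> v \<in> words S \<Longrightarrow> val (u @ v) = val u \<cdot> val v"
  using mult_presented_group[of u S v "commutators E"] by (simp add: val_def raag_def)

lemma val_Cons: "s \<in> S \<Longrightarrow> w \<in> words S \<Longrightarrow> val ((s, b) # w) = val [(s, b)] \<cdot> val w"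
  using val_append[of "[(s, b)]" w] by simp

lemma val_eq_iff: "u \<in> words S \<Longrightarrow> v \<in> words S \<Longrightarrow> val u = val v \<longleftrightarrow> (u, v) \<in> word_cong S (commutators E)"
  unfolding val_def using word_class_eq word_class_eqD by metis

lemma inv_path_in_words [simp]: "inv_path w \<in> words T \<longleftrightarrow> w \<in> words T"
  by (induction w) (auto simp: opp_def)

lemma val_inv_path: "w \<in> words S \<Longrightarrow> val (inv_path w) = inv\<^bsub>R\<^esub> (val w)"
proof (rule inv_equality[symmetric])
  assume w: "w \<in> words S"
  have "inv_path w = rev (map (\<lambda>(s, b). (s, \<not> b)) w)"
    by (simp add: inv_path_def opp_def[abs_def] case_prod_unfold)
  then have "(inv_path w @ w, []) \<in> word_cong S (commutators E)"
    using word_inverse[OF w] by simp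
  then show "val (inv_path w) \<cdot> val w = \<one>\<^bsub>R\<^esub>"
    using w val_eq_iff[of "inv_path w @ w" "[]"] by (simp add: val_append val_Nil)
qed auto

lemma val_neg: "s \<in> S \<Longrightarrow> val [(s, False)] = inv\<^bsub>R\<^esub> (gen s)"
  using val_inv_path[of "[(s, True)]"] by (simp add: gen_def opp_def)

lemma val_letter: "s \<in> S \<Longrightarrow> val [(s, b)] = (if b then gen s else inv\<^bsub>R\<^esub> (gen s))"
  by (simp add: val_neg gen_def)

text \<open>The parabolic subgroup generated by the vertices in \<open>T\<close>.\<close>

definition par :: "'v set \<Rightarrow> ('v \<times> bool) list set set" where
  "par T = val ` words T"

lemma words_mono: "T \<subseteq> T' \<Longrightarrow> words T \<subseteq> words T'"
  by (intro lists_mono) auto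

lemma par_mono: "T \<subseteq> T' \<Longrightarrow> par T \<subseteq> par T'"
  unfolding par_def using words_mono by (intro image_mono)

lemma par_subgroup:
  assumes "T \<subseteq> S"
  shows "subgroup (par T) R"
proof (rule subgroupI)
  note TS = subsetD[OF words_mono[OF assms]]
  show "par T \<subseteq> carrier R" unfolding par_def using TS val_closed by blast
  show "par T \<noteq> {}" unfolding par_def by blast
  fix a assume "a \<in> par T"
  then obtain u where u: "u \<in> words T" "a = val u" by (auto simp: par_def)
  then have "inv\<^bsub>R\<^esub> a = val (inv_path u)" by (simp only: val_inv_path[OF TS])
  then show "inv\<^bsub>R\<^esub> a \<in> par T" using u(1) by (simp add: par_def)
  fix b assume "b \<in> par T"
  then obtain v where v: "v \<in> words T" "b = val v" by (auto simp: par_def)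
  then have "a \<cdot> b = val (u @ v)" using u by (simp only: val_append[OF TS TS])
  then show "a \<cdot> b \<in> par T" using u(1) v(1) by (simp add: par_def)
qed

lemma par_closed: "T \<subseteq> S \<Longrightarrow> h \<in> par T \<Longrightarrow> h \<in> carrier R"
  using par_subgroup subgroup.mem_carrier by metis

lemma gen_in_par: "s \<in> T \<Longrightarrow> gen s \<in> par T"
  unfolding gen_def par_def by auto

definition lk :: "'v \<Rightarrow> 'v set" where
  "lk s = {t. (s, t) \<in> E}"

lemma lk_subset: "lk s \<subseteq> S"
  using edges by (auto simp: lk_def)

lemma lk_irrefl: "s \<notin> lk s"
  using irrefl by (simp add: lk_def)

lemmas link_subgroup = par_subgroup[OF lk_subset]
lemmas link_closed = par_closed[OF lk_subset]

lemma inv_commute: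
  assumes "x \<in> carrier R" "y \<in> carrier R" "x \<cdot> y = y \<cdot> x"
  shows "inv\<^bsub>R\<^esub> x \<cdot> y = y \<cdot> inv\<^bsub>R\<^esub> x"
proof -
  have "inv\<^bsub>R\<^esub> x \<cdot> y = inv\<^bsub>R\<^esub> x \<cdot> (y \<cdot> x) \<cdot> inv\<^bsub>R\<^esub> x" using assms(1,2) by (simp add: m_assoc)
  also have "\<dots> = y \<cdot> inv\<^bsub>R\<^esub> x" using assms by (simp flip: assms(3))
  finally show ?thesis .
qed

lemma gen_commute:
  assumes "(s, t) \<in> E"
  shows "gen s \<cdot> gen t = gen t \<cdot> gen s"
proof -
  have st: "s \<in> S" "t \<in> S" using assms edges by auto
  have two: "val (pos [u, v]) = gen u \<cdot> gen v" if "u \<in> S" "v \<in> S" for u v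
    using that val_append[of "[(u, True)]" "[(v, True)]"] by (simp add: gen_def)
  let ?r = "inv_path (pos [t, s]) @ pos [s, t]"
  have words: "inv_path (pos [t, s]) \<in> words S" "pos [s, t] \<in> words S" "pos [t, s] \<in> words S"
    using st by (auto simp: opp_def)
  have "?r \<in> commutators E" using assms by (auto simp: commutators_def opp_def)
  then have "(?r, []) \<in> word_cong S (commutators E)"
    using words by (intro word_cong.relator) auto
  then have "val ?r = \<one>\<^bsub>R\<^esub>"
    unfolding val_Nil[symmetric] using words by (subst val_eq_iff) auto
  then have one: "inv\<^bsub>R\<^esub> (gen t \<cdot> gen s) \<cdot> (gen s \<cdot> gen t) = \<one>\<^bsub>R\<^esub>"
    unfolding val_append[OF words(1,2)] val_inv_path[OF words(3)] two[OF st] two[OF st(2,1)] .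
  have "gen s \<cdot> gen t = (gen t \<cdot> gen s) \<cdot> (inv\<^bsub>R\<^esub> (gen t \<cdot> gen s) \<cdot> (gen s \<cdot> gen t))"
    using st by (simp only: mult_cancel_simps m_closed gen_closed)
  then show ?thesis unfolding one using st by (simp only: r_one m_closed gen_closed)
qed

text \<open>The centralizer of a generator contains \<open>par T\<close> once it contains the generators in \<open>T\<close>.\<close>

lemma par_commute:
  assumes "T \<subseteq> S" "s \<in> S" "\<And>t. t \<in> T \<Longrightarrow> gen s \<cdot> gen t = gen t \<cdot> gen s" "h \<in> par T"
  shows "gen s \<cdot> h = h \<cdot> gen s"
proof -
  obtain w where w: "w \<in> words T" "h = val w" using assms(4) by (auto simp: par_def)
  show ?thesis unfolding w(2) using w(1)
  proof (induction w)
    case (Cons l w)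
    then obtain t b where l: "l = (t, b)" "t \<in> T" "t \<in> S" "w \<in> words S"
      using assms(1) words_mono[OF assms(1)] by (cases l) auto
    have c: "gen s \<cdot> val [(t, b)] = val [(t, b)] \<cdot> gen s"
      using inv_commute[of "gen t" "gen s"] assms(3)[OF l(2)] l(3) assms(2) by (simp add: val_letter)
    have "gen s \<cdot> val (l # w) = (gen s \<cdot> val [(t, b)]) \<cdot> val w"
      using l assms(2) by (simp add: val_Cons[of t w] m_assoc)
    also have "\<dots> = val [(t, b)] \<cdot> (val w \<cdot> gen s)"
      using l assms(2) Cons by (simp add: c m_assoc)
    also have "\<dots> = val (l # w) \<cdot> gen s"
      using l assms(2) by (simp add: val_Cons[of t w] m_assoc)
    finally show ?case .
  qed (use assms(2) in \<open>simp add: val_Nil\<close>)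
qed

lemma link_commute: "s \<in> S \<Longrightarrow> h \<in> par (lk s) \<Longrightarrow> gen s \<cdot> h = h \<cdot> gen s"
  by (rule par_commute[OF lk_subset]) (auto simp: lk_def gen_commute)

section \<open>The sequence of edges crossed by an element\<close>

text \<open>The edges of the Bass-Serre tree for the stable letter \<open>s\<close> are the cosets of the parabolic subgroup of the
  link of \<open>s\<close>: for \<open>l\<close> in this subgroup, the edges from \<open>h\<close> to \<open>h s\<close> and from \<open>h l\<close> to \<open>h l s\<close> are the same.\<close>

definition edge :: "'v \<Rightarrow> ('v \<times> bool) list set \<Rightarrow> ('v \<times> bool) list set set" where
  "edge s h = h <#\<^bsub>R\<^esub> par (lk s)"

lemma edge_eq_iff:
  assumes "h \<in> carrier R" "h' \<in> carrier R"
  shows "edge s h = edge s h' \<longleftrightarrow> inv\<^bsub>R\<^esub> h \<cdot> h' \<in> par (lk s)"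
proof -
  interpret L: subgroup "par (lk s)" R by (rule link_subgroup)
  show ?thesis
  proof
    assume "edge s h = edge s h'"
    moreover have "h' \<cdot> \<one>\<^bsub>R\<^esub> \<in> edge s h'"
      using L.one_closed unfolding edge_def l_coset_def by blast
    ultimately have "h' \<in> edge s h" using assms by simp
    then obtain l where "l \<in> par (lk s)" "h' = h \<cdot> l"
      unfolding edge_def l_coset_def by blast
    then show "inv\<^bsub>R\<^esub> h \<cdot> h' \<in> par (lk s)" using assms by (simp add: link_closed)
  next
    assume l: "inv\<^bsub>R\<^esub> h \<cdot> h' \<in> par (lk s)"
    have sub: "edge s (a \<cdot> m) \<subseteq> edge s a" if "a \<in> carrier R" "m \<in> par (lk s)" for a m
    proof
      fix z assume "z \<in> edge s (a \<cdot> m)"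
      then obtain x where x: "x \<in> par (lk s)" "z = a \<cdot> m \<cdot> x" unfolding edge_def l_coset_def by blast
      then have "z = a \<cdot> (m \<cdot> x)" using that link_closed by (simp only: m_assoc)
      then show "z \<in> edge s a" using L.m_closed[OF that(2) x(1)] unfolding edge_def l_coset_def by blast
    qed
    have "h \<cdot> (inv\<^bsub>R\<^esub> h \<cdot> h') = h'" "h' \<cdot> inv\<^bsub>R\<^esub> (inv\<^bsub>R\<^esub> h \<cdot> h') = h"
      using assms by (simp_all add: inv_mult_group)
    then show "edge s h = edge s h'"
      using sub[OF assms(1) l] sub[OF assms(2) L.m_inv_closed[OF l]] by (simp only: subset_antisym)
  qed
qed

lemma edge_shift: "y \<in> carrier R \<Longrightarrow> h \<in> carrier R \<Longrightarrow> y <#\<^bsub>R\<^esub> edge s h = edge s (y \<cdot> h)"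
  unfolding edge_def using link_closed by (intro lcos_m_assoc) auto

text \<open>The action of the group on paths by translation of the edges.\<close>

definition shift :: "('v \<times> bool) list set \<Rightarrow> (('v \<times> bool) list set set \<times> bool) list
    \<Rightarrow> (('v \<times> bool) list set set \<times> bool) list" where
  "shift y W = map (apfst (\<lambda>C. y <#\<^bsub>R\<^esub> C)) W"

lemma shift_simps [simp]: "shift y [] = []" "shift y (e # W) = apfst (\<lambda>C. y <#\<^bsub>R\<^esub> C) e # shift y W"
  "shift y (U @ W) = shift y U @ shift y W"
  by (simp_all add: shift_def)

definition edge_paths :: "'v \<Rightarrow> (('v \<times> bool) list set set \<times> bool) list set" where
  "edge_paths s = {W. reduced W \<and> (\<forall>e \<in> set W. fst e \<in> edge s ` carrier R)}"

lemma edge_paths_Nil [simp]: "[] \<in> edge_paths s"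
  by (simp add: edge_paths_def)

lemma inj_shift:
  assumes "y \<in> carrier R"
  shows "inj_on (\<lambda>C. y <#\<^bsub>R\<^esub> C) (edge s ` carrier R)"
proof (rule inj_onI, clarify)
  fix h h' assume h: "h \<in> carrier R" "h' \<in> carrier R" "y <#\<^bsub>R\<^esub> edge s h = y <#\<^bsub>R\<^esub> edge s h'"
  then show "edge s h = edge s h'"
    using assms by (simp add: edge_shift edge_eq_iff inv_mult_group m_assoc)
qed

lemma shift_in:
  assumes y: "y \<in> carrier R" and W: "W \<in> edge_paths s"
  shows "shift y W \<in> edge_paths s"
proof -
  have "fst e \<in> edge s ` carrier R" if "e \<in> set (shift y W)" for e
  proof -
    obtain e' where "e' \<in> set W" "fst e = y <#\<^bsub>R\<^esub> fst e'"
      using \<open>e \<in> set (shift y W)\<close> unfolding shift_def by auto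
    moreover from this obtain h where "h \<in> carrier R" "fst e' = edge s h"
      using W unfolding edge_paths_def by blast
    ultimately show ?thesis using y by (simp add: edge_shift)
  qed
  moreover have "reduced (shift y W)"
  proof -
    have *: "e' = opp e" if e: "e \<in> set W" "e' \<in> set W"
      and eq: "apfst (\<lambda>C. y <#\<^bsub>R\<^esub> C) e' = opp (apfst (\<lambda>C. y <#\<^bsub>R\<^esub> C) e)" for e e'
    proof -
      have "y <#\<^bsub>R\<^esub> fst e' = y <#\<^bsub>R\<^esub> fst e" "snd e' = (\<not> snd e)"
        using eq unfolding opp_def by (cases e; cases e'; simp)+
      moreover from this(1) have "fst e' = fst e"
        by (rule inj_onD[OF inj_shift[OF y, of s]]) (use e W in \<open>auto simp only: edge_paths_def\<close>)
      ultimately show ?thesis unfolding opp_def by (simp add: prod_eq_iff)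
    qed
    have "reduced W" using W by (simp only: edge_paths_def mem_Collect_eq)
    then show ?thesis
      unfolding shift_def successively_map by (rule successively_mono) (use * in blast)
  qed
  ultimately show ?thesis by (simp add: edge_paths_def)
qed

lemma push_in:
  assumes "W \<in> edge_paths s" "fst e \<in> edge s ` carrier R"
  shows "push e W \<in> edge_paths s"
  using assms set_push[of e W] reduced_push[of W e] unfolding edge_paths_def by blast

lemma edge_pathsE:
  assumes "W \<in> edge_paths s" "e \<in> set W"
  obtains h where "h \<in> carrier R" "fst e = edge s h"
proof -
  have "fst e \<in> edge s ` carrier R" using assms by (simp add: edge_paths_def)
  then show thesis using that by (rule_tac imageE)
qed

lemma shift_shift:
  assumes "W \<in> edge_paths s" "y \<in> carrier R" "z \<in> carrier R"
  shows "shift y (shift z W) = shift (y \<cdot> z) W"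
  unfolding shift_def map_map
proof (rule map_cong[OF HOL.refl])
  fix e assume "e \<in> set W"
  with assms(1) obtain h where h: "h \<in> carrier R" "fst e = edge s h" by (rule edge_pathsE)
  have "y <#\<^bsub>R\<^esub> (z <#\<^bsub>R\<^esub> fst e) = (y \<cdot> z) <#\<^bsub>R\<^esub> fst e"
    unfolding h(2) using assms(2,3) h(1) by (simp only: edge_shift m_assoc m_closed)
  then show "((apfst (\<lambda>C. y <#\<^bsub>R\<^esub> C)) \<circ> (apfst (\<lambda>C. z <#\<^bsub>R\<^esub> C))) e = apfst (\<lambda>C. (y \<cdot> z) <#\<^bsub>R\<^esub> C) e"
    by (simp only: o_apply prod_eq_iff fst_apfst snd_apfst)
qed

lemma shift_one:
  assumes "W \<in> edge_paths s"
  shows "shift \<one>\<^bsub>R\<^esub> W = W"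
  unfolding shift_def
proof (rule map_idI)
  fix e assume "e \<in> set W"
  with assms obtain h where h: "h \<in> carrier R" "fst e = edge s h" by (rule edge_pathsE)
  have "\<one>\<^bsub>R\<^esub> <#\<^bsub>R\<^esub> fst e = fst e"
    unfolding h(2) using h(1) by (simp only: edge_shift one_closed l_one)
  then show "apfst (\<lambda>C. \<one>\<^bsub>R\<^esub> <#\<^bsub>R\<^esub> C) e = e"
    by (simp only: prod_eq_iff fst_apfst snd_apfst)
qed

lemma shift_push:
  assumes "W \<in> edge_paths s" "fst e \<in> edge s ` carrier R" "y \<in> carrier R"
  shows "shift y (push e W) = push (apfst (\<lambda>C. y <#\<^bsub>R\<^esub> C) e) (shift y W)"
  unfolding shift_def
  by (rule map_push[symmetric], rule inj_on_subset[OF inj_shift[OF assms(3), of s]])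
    (use assms in \<open>auto simp: edge_paths_def\<close>)

lemma join_in: "U \<in> edge_paths s \<Longrightarrow> W \<in> edge_paths s \<Longrightarrow> join U W \<in> edge_paths s"
  using reduced_join[of W U] set_join[of U W] unfolding edge_paths_def by blast

lemma edge_paths_ConsD: "e # U \<in> edge_paths s \<Longrightarrow> U \<in> edge_paths s \<and> fst e \<in> edge s ` carrier R"
  by (auto simp: edge_paths_def successively_Cons)

lemma shift_join:
  assumes "U \<in> edge_paths s" "W \<in> edge_paths s" "y \<in> carrier R"
  shows "shift y (join U W) = join (shift y U) (shift y W)"
  using assms(1)
proof (induction U)
  case (Cons e U)
  note U = edge_paths_ConsD[OF Cons.prems]
  have "shift y (push e (join U W)) = push (apfst (\<lambda>C. y <#\<^bsub>R\<^esub> C) e) (shift y (join U W))"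
    using U assms by (intro shift_push join_in) auto
  then show ?case using Cons.IH U by simp
qed simp

text \<open>The action of one letter on reduced paths. A letter other than \<open>s\<close> only translates;
  the letter \<open>s\<close> also puts the base edge in front. For the inverse letter, the edge that is traversed
  backwards starts at the inverse of \<open>s\<close>.\<close>

definition step :: "'v \<Rightarrow> 'v \<times> bool \<Rightarrow> (('v \<times> bool) list set set \<times> bool) list
    \<Rightarrow> (('v \<times> bool) list set set \<times> bool) list" where
  "step s l W =
     (let V = shift (val [l]) W in
      if fst l = s then push (edge s (if snd l then \<one>\<^bsub>R\<^esub> else inv\<^bsub>R\<^esub> (gen s)), snd l) V else V)"

lemma step_in:
  assumes "t \<in> S" "W \<in> edge_paths s"
  shows "step s (t, b) W \<in> edge_paths s"
  unfolding step_def Let_def using assms by (auto intro!: push_in shift_in)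

lemma step_cancel:
  assumes t: "t \<in> S" and W: "W \<in> edge_paths s"
  shows "step s (t, b) (step s (t, \<not> b) W) = W"
proof -
  define g where "g = val [(t, b)]"
  have g: "g \<in> carrier R" using t by (simp add: g_def)
  have g': "val [(t, \<not> b)] = inv\<^bsub>R\<^esub> g" using t by (cases b) (simp_all add: g_def val_letter)
  have gg: "shift g (shift (inv\<^bsub>R\<^esub> g) W) = W"
    using W g by (simp add: shift_shift shift_one)
  show ?thesis
  proof (cases "t = s")
    case False
    then show ?thesis using gg by (simp add: step_def g' flip: g_def)
  next
    case True
    define e where "e b = (edge s (if b then \<one>\<^bsub>R\<^esub> else inv\<^bsub>R\<^esub> (gen s)), b)" for b
    have e: "fst (e b) \<in> edge s ` carrier R" for b using t True by (auto simp: e_def)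
    have ge: "apfst (\<lambda>C. g <#\<^bsub>R\<^esub> C) (e (\<not> b)) = opp (e b)"
      using t True by (cases b) (simp_all add: e_def opp_def g_def val_letter edge_shift)
    have "step s (t, b) (step s (t, \<not> b) W) = push (e b) (shift g (push (e (\<not> b)) (shift (inv\<^bsub>R\<^esub> g) W)))"
      unfolding step_def Let_def fst_conv snd_conv g' g_def[symmetric] e_def using True by simp
    also have "\<dots> = push (e b) (push (opp (e b)) W)"
      using g W by (subst shift_push[OF shift_in[OF _ W] e g]) (auto simp: gg ge)
    also have "\<dots> = W" using W by (intro push_opp') (simp add: edge_paths_def)
    finally show ?thesis .
  qed
qed

text \<open>The defining relations hold for the action because a neighbour of \<open>s\<close> fixes the base edge.\<close>

lemma step_commute:
  assumes ab: "(a, b) \<in> E" and W: "W \<in> edge_paths s"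
  shows "step s (a, True) (step s (b, True) W) = step s (b, True) (step s (a, True) W)"
proof -
  have *: "step s (a, True) (step s (b, True) W) = step s (b, True) (step s (a, True) W)"
    if ab: "(a, b) \<in> E" and "b \<noteq> s" for a b
  proof -
    have abS: "a \<in> S" "b \<in> S" using ab edges by auto
    have sh: "shift (gen a) (shift (gen b) W) = shift (gen b) (shift (gen a) W)"
      using abS W gen_commute[OF ab] by (simp add: shift_shift)
    show ?thesis
    proof (cases "a = s")
      case False
      then show ?thesis using \<open>b \<noteq> s\<close> sh by (simp add: step_def flip: gen_def)
    next
      case True
      have "gen b \<in> par (lk s)" using ab True by (intro gen_in_par) (auto simp: lk_def)
      then have "edge s (gen b) = edge s \<one>\<^bsub>R\<^esub>" using abS by (subst eq_commute) (simp add: edge_eq_iff)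
      then have "shift (gen b) (push (edge s \<one>\<^bsub>R\<^esub>, True) (shift (gen a) W))
          = push (edge s \<one>\<^bsub>R\<^esub>, True) (shift (gen b) (shift (gen a) W))"
        using abS by (subst shift_push[OF shift_in[OF _ W]]) (auto simp: edge_shift)
      then show ?thesis using True \<open>b \<noteq> s\<close> sh by (simp add: step_def flip: gen_def)
    qed
  qed
  show ?thesis
  proof (cases "b = s")
    case True
    then have "a \<noteq> s" using ab irrefl by auto
    then show ?thesis using *[OF sym[OF ab]] by simp
  qed (use * ab in blast)
qed

lemma steps_in: "w \<in> words S \<Longrightarrow> W \<in> edge_paths s \<Longrightarrow> foldr (step s) w W \<in> edge_paths s"
  by (induction w) (auto intro: step_in)

lemma steps_cong:
  assumes "(u, v) \<in> word_cong S (commutators E)" "W \<in> edge_paths s"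
  shows "foldr (step s) u W = foldr (step s) v W"
  using assms
proof (induction arbitrary: W rule: word_cong.induct)
  case (append u u' v v')
  have "v' \<in> words S" using word_cong_words[OF append.hyps(2)] by simp
  then have "foldr (step s) v' W \<in> edge_paths s" using append.prems by (rule steps_in)
  then show ?case using append by simp
next
  case (cancel t b)
  then show ?case by (simp add: step_cancel)
next
  case (relator r)
  then obtain a b where r: "r = [(a, False), (b, False), (a, True), (b, True)]" and ab: "(a, b) \<in> E"
    by (auto simp: commutators_def)
  have abS: "a \<in> S" "b \<in> S" using ab edges by auto
  have "foldr (step s) r W = step s (a, False) (step s (b, False) (step s (b, True) (step s (a, True) W)))"
    using r step_commute[OF ab relator(3)] by simp
  also have "\<dots> = W"
    using step_cancel[of b "step s (a, True) W" s False] step_cancel[of a W s False] abS relator(3) step_in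
    by simp
  finally show ?case by simp
qed auto

text \<open>The path of an element is the image of the empty path. By \<open>steps_cong\<close> the
  choice of the representing word is immaterial.\<close>

definition crossings :: "'v \<Rightarrow> ('v \<times> bool) list set \<Rightarrow> (('v \<times> bool) list set set \<times> bool) list" where
  "crossings s y = foldr (step s) (SOME w. w \<in> words S \<and> val w = y) []"

lemma crossings_val: "w \<in> words S \<Longrightarrow> crossings s (val w) = foldr (step s) w []"
proof -
  assume w: "w \<in> words S"
  define v where "v = (SOME v. v \<in> words S \<and> val v = val w)"
  have "v \<in> words S \<and> val v = val w" unfolding v_def by (rule someI[of _ w]) (use w in simp)
  then have "(v, w) \<in> word_cong S (commutators E)" using val_eq_iff w by blast
  then show ?thesis using steps_cong[of v w "[]" s] by (simp add: crossings_def v_def)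
qed

lemma crossings_in: "y \<in> carrier R \<Longrightarrow> crossings s y \<in> edge_paths s"
  by (elim valE) (simp add: crossings_val steps_in)

lemma steps_eq_join:
  assumes "w \<in> words S" "W \<in> edge_paths s"
  shows "foldr (step s) w W = join (crossings s (val w)) (shift (val w) W)"
  using assms(1)
proof (induction w)
  case Nil
  then show ?case using assms crossings_val[of "[]" s] by (simp add: val_Nil shift_one)
next
  case (Cons l w)
  then obtain t b where l: "l = (t, b)" "t \<in> S" "w \<in> words S" by (cases l) auto
  let ?g = "val [(t, b)]" and ?D = "crossings s (val w)"
  let ?e = "(edge s (if b then \<one>\<^bsub>R\<^esub> else inv\<^bsub>R\<^esub> (gen s)), b)"
  have D: "?D \<in> edge_paths s" using l by (intro crossings_in) simp
  have W: "shift (val w) W \<in> edge_paths s" using l assms by (intro shift_in) simp_all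
  have 1: "shift ?g (join ?D (shift (val w) W)) = join (shift ?g ?D) (shift (val (l # w)) W)"
    using l assms by (simp add: shift_join[OF D W] shift_shift[OF assms(2)] val_Cons[of t w])
  have 2: "crossings s (val (l # w)) = step s l ?D"
    using l by (simp add: crossings_val)
  have "val (l # w) \<in> carrier R" using l by (intro val_closed) auto
  then have 3: "shift ?g ?D \<in> edge_paths s" "shift (val (l # w)) W \<in> edge_paths s"
    using l(2) assms D by (auto intro!: shift_in)
  have "foldr (step s) (l # w) W = step s l (join ?D (shift (val w) W))"
    using Cons l by simp
  also have "\<dots> = join (step s l ?D) (shift (val (l # w)) W)"
  proof (cases "t = s")
    case True
    have "join (push ?e (shift ?g ?D)) (shift (val (l # w)) W) = push ?e (join (shift ?g ?D) (shift (val (l # w)) W))"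
      using 3 by (intro join_push) (simp_all add: edge_paths_def)
    then show ?thesis using True 1 by (simp add: step_def l(1))
  next
    case False
    then show ?thesis using 1 by (simp add: step_def l(1))
  qed
  finally show ?case using 2 by simp
qed

text \<open>The crossed homomorphism property.\<close>

lemma crossings_mult:
  assumes "y \<in> carrier R" "z \<in> carrier R"
  shows "crossings s (y \<cdot> z) = join (crossings s y) (shift y (crossings s z))"
proof -
  obtain u v where uv: "u \<in> words S" "y = val u" "v \<in> words S" "z = val v"
    using assms by (elim valE)
  have "crossings s (y \<cdot> z) = foldr (step s) u (foldr (step s) v [])"
    using uv crossings_val[of "u @ v" s] by (simp add: val_append)
  also have "foldr (step s) v [] = crossings s z" using uv by (simp add: crossings_val)
  finally show ?thesis using steps_eq_join[OF uv(1) crossings_in[OF assms(2)]] uv by simp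
qed

lemma crossings_one [simp]: "crossings s \<one>\<^bsub>R\<^esub> = []"
  using crossings_val[of "[]" s] by (simp add: val_Nil)

lemma crossings_par:
  assumes "T \<subseteq> S" "s \<notin> T" "h \<in> par T"
  shows "crossings s h = []"
proof -
  obtain w where w: "w \<in> words T" "h = val w" using assms(3) by (auto simp: par_def)
  have "foldr (step s) w [] = []"
    using w(1)
  proof (induction w)
    case (Cons l w)
    then have "fst l \<noteq> s" using assms(2) by auto
    then show ?case using Cons by (simp add: step_def)
  qed simp
  then show ?thesis using w words_mono[OF assms(1)] crossings_val[of w s] by auto
qed

lemma crossings_gen:
  assumes "t \<in> S"
  shows "crossings s (gen t) = (if t = s then [(edge s \<one>\<^bsub>R\<^esub>, True)] else [])"
  unfolding gen_def using assms by (simp add: crossings_val step_def)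

lemma crossings_edges_in_par:
  assumes "T \<subseteq> S" "v \<in> par T" "e \<in> set (crossings s v)"
  obtains q where "q \<in> par T" "fst e = edge s q"
proof -
  interpret P: subgroup "par T" R using assms(1) by (rule par_subgroup)
  have closed: "q \<in> par T \<Longrightarrow> q \<in> carrier R" for q using assms(1) by (rule par_closed)
  obtain w where w: "w \<in> words T" "v = val w" using assms(2) by (auto simp: par_def)
  have "\<forall>e\<in>set (foldr (step s) w []). \<exists>q\<in>par T. fst e = edge s q"
    using w(1)
  proof (induction w)
    case (Cons l w)
    then obtain t b where l: "l = (t, b)" "t \<in> T" "w \<in> words T" by (cases l) auto
    define g where "g = val [(t, b)]"
    define W where "W = foldr (step s) w []"
    have g: "g \<in> par T" using l unfolding par_def g_def by auto
    have shift: "\<exists>q\<in>par T. fst e = edge s q" if "e \<in> set (shift g W)" for e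
    proof -
      obtain e' where e': "e' \<in> set W" "fst e = g <#\<^bsub>R\<^esub> fst e'"
        using \<open>e \<in> set (shift g W)\<close> by (auto simp: shift_def)
      then obtain q where q: "q \<in> par T" "fst e' = edge s q" using Cons l unfolding W_def by auto
      then have "fst e = edge s (g \<cdot> q)" unfolding e'(2) q(2) by (intro edge_shift closed g)
      then show ?thesis using P.m_closed[OF g q(1)] by blast
    qed
    show ?case
    proof (cases "t = s")
      case False
      then have "foldr (step s) (l # w) [] = shift g W"
        unfolding W_def g_def by (simp add: step_def l(1))
      then show ?thesis using shift by simp
    next
      case True
      define q where "q = (if b then \<one>\<^bsub>R\<^esub> else inv\<^bsub>R\<^esub> (gen s))"
      have q: "q \<in> par T" unfolding q_def using P.m_inv_closed gen_in_par l(2) True by simp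
      have "foldr (step s) (l # w) [] = push (edge s q, b) (shift g W)"
        using True unfolding W_def g_def q_def by (simp add: step_def l(1))
      then show ?thesis using shift q set_push[of "(edge s q, b)" "shift g W"] by fastforce
    qed
  qed simp
  moreover have "w \<in> words S" using w(1) words_mono[OF assms(1)] by (rule rev_subsetD)
  ultimately show thesis
    using that assms(3) crossings_val[of w s] unfolding w(2) by auto
qed

lemma snd_shift: "(\<forall>e\<in>set (shift y W). snd e) \<longleftrightarrow> (\<forall>e\<in>set W. snd e)"
  by (auto simp: shift_def)

lemma push_positive: "snd e \<Longrightarrow> \<forall>e'\<in>set W. snd e' \<Longrightarrow> push e W = e # W"
  by (cases W) (auto simp: opp_def)

lemma val_pos_Cons: "t \<in> S \<Longrightarrow> set u \<subseteq> S \<Longrightarrow> val (pos (t # u)) = gen t \<cdot> val (pos u)"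
  using val_append[of "pos [t]" "pos u"] by (simp add: gen_def)

text \<open>In a positive word nothing can cancel, so that its path lists one edge per occurrence of \<open>s\<close>.
  Both parts are proved together, because the absence of cancellation rests on the orientations.\<close>

lemma crossings_pos:
  assumes "set u \<subseteq> S"
  shows "(\<forall>e\<in>set (crossings s (val (pos u))). snd e) \<and>
    (t \<in> S \<longrightarrow> crossings s (val (pos (t # u))) =
      (if t = s then [(edge s \<one>\<^bsub>R\<^esub>, True)] else []) @ shift (gen t) (crossings s (val (pos u))))"
  using assms
proof (induction u arbitrary: t)
  case Nil
  then show ?case by (simp add: val_Nil crossings_gen flip: gen_def)
next
  case (Cons a u)
  let ?W = "crossings s (val (pos (a # u)))"
  have a: "a \<in> S" "set u \<subseteq> S" using Cons by auto
  then have W: "\<forall>e\<in>set ?W. snd e" using Cons.IH[of a] snd_shift[of "gen a" "crossings s (val (pos u))"] by auto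
  have "crossings s (val (pos (t # a # u))) = step s (t, True) ?W" if "t \<in> S"
    using that a crossings_val[of "pos (t # a # u)" s] crossings_val[of "pos (a # u)" s] by simp
  then show ?case
    using W push_positive[of "(edge s \<one>\<^bsub>R\<^esub>, True)" "shift (gen t) ?W"] snd_shift[of "gen t" ?W]
    by (auto simp add: step_def simp flip: gen_def)
qed

lemmas crossings_positive = crossings_pos[THEN conjunct1]
lemmas crossings_pos_Cons = crossings_pos[THEN conjunct2, rule_format]

lemma crossings_pos_append:
  assumes "set u \<subseteq> S" "set v \<subseteq> S"
  shows "crossings s (val (pos (u @ v)))
    = crossings s (val (pos u)) @ shift (val (pos u)) (crossings s (val (pos v)))"
  using assms(1)
proof (induction u)
  case Nil
  have "crossings s (val (pos v)) \<in> edge_paths s" using assms by (intro crossings_in) simp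
  then show ?case by (simp add: val_Nil shift_one)
next
  case (Cons a u)
  have a: "a \<in> S" "set u \<subseteq> S" "set (u @ v) \<subseteq> S" using Cons assms by auto
  have "crossings s (val (pos v)) \<in> edge_paths s" using assms by (intro crossings_in) simp
  then have "shift (gen a) (shift (val (pos u)) (crossings s (val (pos v))))
      = shift (val (pos (a # u))) (crossings s (val (pos v)))"
    using a by (simp only: shift_shift gen_closed val_closed pos_in_words val_pos_Cons)
  then show ?case
    using Cons.IH[OF a(2)] crossings_pos_Cons[OF a(3,1), of s] crossings_pos_Cons[OF a(2,1), of s] by simp
qed

section \<open>Stabilizers of long walks in the complement graph\<close>

text \<open>Along a walk in the complement graph the letters cannot be
  rearranged. In a product \<open>u v\<close> with \<open>u\<close> in the link of the first letter and \<open>v\<close> in the link of \<open>a\<close>,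
  the first letter would have to come from \<open>v\<close> and the last one from \<open>u\<close>. The induction peels off the
  first letter \<open>r\<close>: the path of the next letter \<open>s\<close> does not see \<open>u\<close>, so that its first edge
  is one of the edges of \<open>v\<close>, and this splits \<open>v\<close> at a coset of the link of \<open>s\<close>.\<close>

lemma no_factorization_through_links:
  assumes "set (r # z) \<subseteq> S" "successively (\<lambda>s t. (s, t) \<notin> E) (r # z)" "last (r # z) \<notin> lk a"
    and "u \<in> par (lk r)" "v \<in> par (lk a)"
  shows "val (pos (r # z)) \<noteq> u \<cdot> v"
  using assms
proof (induction z arbitrary: r u v)
  case Nil
  show ?case
  proof
    assume eq: "val (pos [r]) = u \<cdot> v"
    have "crossings r (u \<cdot> v) = []"
      using Nil lk_irrefl[of r] crossings_par[OF lk_subset, of r] link_closed[of u] link_closed[of v]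
      by (simp add: crossings_mult)
    moreover have "crossings r (u \<cdot> v) \<noteq> []"
      unfolding eq[symmetric] using Nil by (simp add: crossings_gen flip: gen_def)
    ultimately show False by simp
  qed
next
  case (Cons s z)
  have S: "r \<in> S" "s \<in> S" "set z \<subseteq> S" using Cons.prems by auto
  have u: "u \<in> carrier R" and v: "v \<in> carrier R" using Cons.prems link_closed by auto
  show ?case
  proof
    assume eq: "val (pos (r # s # z)) = u \<cdot> v"
    let ?w = "val (pos (s # z))"
    have w: "?w \<in> carrier R" using S by simp
    have rw: "val (pos (r # s # z)) = gen r \<cdot> ?w" using S by (intro val_pos_Cons) auto
    have "crossings s u = []"
      using Cons.prems by (intro crossings_par[OF lk_subset, of s r]) (auto simp: lk_def)
    then have D: "crossings s (u \<cdot> v) = shift u (crossings s v)"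
      using u v by (simp add: crossings_mult)
    have "(edge s \<one>\<^bsub>R\<^esub>, True) \<in> set (crossings s ?w)"
      using crossings_pos_Cons[of z s s] S by simp
    then have "(gen r <#\<^bsub>R\<^esub> edge s \<one>\<^bsub>R\<^esub>, True) \<in> set (shift (gen r) (crossings s ?w))"
      unfolding shift_def by force
    then have "(edge s (gen r), True) \<in> set (crossings s (u \<cdot> v))"
      using crossings_pos_Cons[of "s # z" r s] S eq by (simp add: edge_shift)
    then obtain e where e: "e \<in> set (crossings s v)" "edge s (gen r) = u <#\<^bsub>R\<^esub> fst e"
      unfolding D by (auto simp: shift_def)
    obtain q where q: "q \<in> par (lk a)" "fst e = edge s q"
      using crossings_edges_in_par[OF lk_subset Cons.prems(5) e(1)] by blast
    have q': "q \<in> carrier R" using q link_closed by auto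
    define l where "l = inv\<^bsub>R\<^esub> (gen r) \<cdot> (u \<cdot> q)"
    have l: "l \<in> par (lk s)"
      using e(2) q' u S unfolding q(2) l_def by (simp add: edge_shift edge_eq_iff)
    have v': "inv\<^bsub>R\<^esub> q \<cdot> v \<in> par (lk a)"
      using q(1) Cons.prems(5) subgroup.m_closed[OF link_subgroup] subgroup.m_inv_closed[OF link_subgroup] by simp
    have "?w = inv\<^bsub>R\<^esub> (gen r) \<cdot> (gen r \<cdot> ?w)" using w S by simp
    also have "gen r \<cdot> ?w = u \<cdot> v" using eq rw by simp
    also have "inv\<^bsub>R\<^esub> (gen r) \<cdot> (u \<cdot> v) = l \<cdot> (inv\<^bsub>R\<^esub> q \<cdot> v)"
      unfolding l_def using u v q' S by (simp add: m_assoc)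
    finally show False
      using Cons.IH[OF _ _ _ l v'] Cons.prems S by (auto simp: successively_Cons split: if_splits)
  qed
qed

text \<open>An element \<open>h\<close> of the link of \<open>r\<close> which the walk conjugates into the link of \<open>a\<close> must be in the link
  of each letter of the walk. Compare the paths of the first letter \<open>t\<close> on both sides of
  \<open>h z = z h'\<close>. On the left the path starts with the translate of the base edge by \<open>h\<close>. If this is a different edge, the
  base edge at the start of the path on the right has to cancel against an edge coming from \<open>h'\<close>, which would
  give a factorization that \<open>no_factorization_through_links\<close> excludes. So \<open>h\<close> fixes the base edge,
  commutes with \<open>t\<close>, and \<open>t\<close> can be removed.\<close>

lemma conjugate_into_link:
  assumes "set (r # z) \<subseteq> S" "successively (\<lambda>s t. (s, t) \<notin> E) (r # z)" "last (r # z) \<notin> lk a"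
    and "h \<in> par (lk r)" "h' \<in> par (lk a)" "h \<cdot> val (pos z) = val (pos z) \<cdot> h'"
  shows "\<forall>s\<in>set z. h \<in> par (lk s)"
  using assms
proof (induction z arbitrary: r)
  case (Cons t z)
  have S: "r \<in> S" "t \<in> S" "set z \<subseteq> S" using Cons.prems by auto
  have h: "h \<in> carrier R" and h': "h' \<in> carrier R" using Cons.prems link_closed by auto
  let ?z = "val (pos (t # z))"
  have z: "?z \<in> carrier R" using S by simp
  have tz: "?z = gen t \<cdot> val (pos z)" using S by (intro val_pos_Cons) auto
  have "crossings t h = []"
    using Cons.prems by (intro crossings_par[OF lk_subset, of t r]) (auto simp: lk_def)
  then have D: "shift h (crossings t ?z) = join (crossings t ?z) (shift ?z (crossings t h'))"
    using crossings_mult[OF h z, of t] crossings_mult[OF z h', of t] Cons.prems(6) by simp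
  obtain U where U: "crossings t ?z = (edge t \<one>\<^bsub>R\<^esub>, True) # U" "\<forall>e\<in>set U. snd e"
    using crossings_pos_Cons[of z t t] crossings_positive[of "t # z" t] S by auto
  have "h \<in> par (lk t)"
  proof (rule ccontr)
    assume "h \<notin> par (lk t)"
    let ?V = "join U (shift ?z (crossings t h'))"
    have "hd (shift h (crossings t ?z)) \<noteq> (edge t \<one>\<^bsub>R\<^esub>, True)"
      using \<open>h \<notin> par (lk t)\<close> h edge_eq_iff[of "\<one>\<^bsub>R\<^esub>" h t] unfolding U by (auto simp: edge_shift)
    moreover have "shift h (crossings t ?z) = push (edge t \<one>\<^bsub>R\<^esub>, True) ?V"
      by (unfold D, unfold U(1), simp only: join_simps)
    ultimately have "hd (push (edge t \<one>\<^bsub>R\<^esub>, True) ?V) \<noteq> (edge t \<one>\<^bsub>R\<^esub>, True)" by simp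
    then have "(edge t \<one>\<^bsub>R\<^esub>, False) \<in> set ?V"
      by (cases ?V) (auto simp: opp_def split: if_splits)
    then have "(edge t \<one>\<^bsub>R\<^esub>, False) \<in> set (shift ?z (crossings t h'))"
      using set_join[of U] U(2) by fastforce
    then obtain e where e: "e \<in> set (crossings t h')" "edge t \<one>\<^bsub>R\<^esub> = ?z <#\<^bsub>R\<^esub> fst e"
      unfolding shift_def by auto
    obtain q where q: "q \<in> par (lk a)" "fst e = edge t q"
      using crossings_edges_in_par[OF lk_subset Cons.prems(5) e(1)] by blast
    have q': "q \<in> carrier R" using q link_closed by auto
    have l: "?z \<cdot> q \<in> par (lk t)"
      using e(2) q' z unfolding q(2) by (simp add: edge_shift edge_eq_iff)
    have "?z = (?z \<cdot> q) \<cdot> inv\<^bsub>R\<^esub> q" using z q' by (simp add: m_assoc)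
    moreover have "?z \<noteq> (?z \<cdot> q) \<cdot> inv\<^bsub>R\<^esub> q"
      by (rule no_factorization_through_links[OF _ _ _ l, where a = a])
        (use Cons.prems S q(1) subgroup.m_inv_closed[OF link_subgroup] in \<open>auto simp: successively_Cons\<close>)
    ultimately show False by simp
  qed
  moreover have "h \<cdot> val (pos z) = val (pos z) \<cdot> h'"
  proof -
    let ?y = "val (pos z)"
    have y: "?y \<in> carrier R" using S by simp
    have "gen t \<cdot> (h \<cdot> ?y) = gen t \<cdot> (?y \<cdot> h')"
      using Cons.prems(6) link_commute[OF S(2) calculation] S h h' y unfolding tz
      by (simp add: m_assoc[symmetric]) 
    then show ?thesis using S h h' y by simp
  qed
  ultimately show ?case
    using Cons.IH[of t] Cons.prems by (auto simp: successively_Cons)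
qed simp

text \<open>Deleting all letters outside \<open>T\<close> is the retraction onto \<open>par T\<close>, on the level of words.\<close>

lemma val_filter:
  assumes "(u, v) \<in> word_cong S (commutators E)"
  shows "(filter (\<lambda>l. fst l \<in> T) u, filter (\<lambda>l. fst l \<in> T) v) \<in> word_cong S (commutators E)"
  using assms
proof (induction rule: word_cong.induct)
  case (relator r)
  then obtain a b where r: "r = [(a, False), (b, False), (a, True), (b, True)]" and ab: "a \<in> S" "b \<in> S"
    by (auto simp: commutators_def)
  show ?case
    using relator word_cong.cancel[OF ab(1), of False "commutators E"]
      word_cong.cancel[OF ab(2), of False "commutators E"]
    by (cases "a \<in> T"; cases "b \<in> T") (auto simp: r intro: word_cong.intros)
next
  case (refl w)
  then show ?case by (intro word_cong.refl) auto
qed (auto intro: word_cong.intros)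

lemma par_Int: "T \<subseteq> S \<Longrightarrow> T' \<subseteq> S \<Longrightarrow> par T \<inter> par T' = par (T \<inter> T')"
proof (intro equalityI subsetI IntI)
  fix h assume T: "T \<subseteq> S" "T' \<subseteq> S" and h: "h \<in> par T \<inter> par T'"
  then obtain u v where uv: "u \<in> words T" "h = val u" "v \<in> words T'" "h = val v"
    unfolding par_def by blast
  let ?f = "filter (\<lambda>l. fst l \<in> T)"
  have "u \<in> words S" "v \<in> words S" using uv T words_mono by blast+
  moreover have "?f v \<in> words (T \<inter> T')" using uv(3) by auto
  moreover have "words (T \<inter> T') \<subseteq> words S" using T by (intro words_mono) auto
  moreover have "?f u = u" using uv(1) by (auto simp: filter_id_conv)
  ultimately have "val u = val (?f v)"
    using val_filter[of u v T] uv by (metis subsetD val_eq_iff)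
  then show "h \<in> par (T \<inter> T')" using uv \<open>?f v \<in> words (T \<inter> T')\<close> unfolding par_def by auto
qed (use par_mono[of "T \<inter> T'"] in auto)

lemma par_empty: "par {} = {\<one>\<^bsub>R\<^esub>}"
  by (auto simp: par_def val_Nil)

text \<open>No vertex is in its own link, so the intersection of all these parabolic subgroups is generated
  by the empty set.\<close>

lemma trivial_if_in_all_links:
  assumes "finite V" "par (lk a) \<subseteq> par V" "V \<subseteq> S" "h \<in> par (lk a)" "\<And>s. s \<in> V \<Longrightarrow> h \<in> par (lk s)"
  shows "h = \<one>\<^bsub>R\<^esub>"
proof -
  have "h \<in> par (V - U)" if "finite U" "U \<subseteq> V" for U
    using that
  proof (induction U)
    case empty
    then show ?case using assms by auto
  next
    case (insert s U)
    then have "h \<in> par (V - U) \<inter> par (lk s)" using assms by auto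
    also have "\<dots> = par ((V - U) \<inter> lk s)" using assms(3) lk_subset by (intro par_Int) auto
    also have "\<dots> \<subseteq> par (V - insert s U)" using lk_irrefl[of s] by (intro par_mono) auto
    finally show ?case .
  qed
  from this[OF assms(1) order_refl] show ?thesis by (simp add: par_empty)
qed

end

section \<open>Replacing one block\<close>

text \<open>\<open>V\<close> is the set of vertices that the generic element may use, while \<open>S\<close> may contain further
  vertices, none of them joined to \<open>a\<close>. The walk \<open>w\<close> visits all of \<open>V\<close> except \<open>a\<close>, so that a block, which is \<open>a\<close>
  followed by \<open>w\<close> and a power of \<open>b\<close>, contributes a single edge to a path.\<close>

locale separating_walk = commutation_graph S E for S :: "'v set" and E +
  fixes V :: "'v set" and a b :: 'v and w :: "'v list"
  assumes V: "finite V" "V \<subseteq> S" "a \<in> V" "lk a \<subseteq> V"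
    and w: "set w = V - {a}" "w \<noteq> []" "last w = b"
    and walk: "successively (\<lambda>s t. (s, t) \<notin> E) (a # w)" "b \<notin> lk a"
begin

lemma a_in [simp]: "a \<in> S" and b_in [simp]: "b \<in> S" and b_neq_a: "b \<noteq> a"
  using V w last_in_set[OF w(2)] by auto

text \<open>The number of final letters \<open>b\<close> tells the blocks apart. Repeating \<open>b\<close> keeps the word a walk,
  since a vertex is not joined to itself.\<close>

definition block :: "nat \<Rightarrow> 'v list" where
  "block i = a # w @ replicate i b"

lemma set_block: "set (block i) \<subseteq> V"
  using w V last_in_set[OF w(2)] by (auto simp: block_def)

definition block_val :: "nat \<Rightarrow> ('v \<times> bool) list set" where
  "block_val i = val (pos (block i))"

lemma block_val_closed [simp]: "block_val i \<in> carrier R"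
  unfolding block_val_def using set_block V by (intro val_closed) auto

text \<open>The stabilizer of the pair of edges \<open>(L, B\<^sub>i L)\<close> is trivial, as a block visits all vertices of \<open>V\<close>.\<close>

lemma block_stabilizer:
  assumes h: "h \<in> par (lk a)" and h': "inv\<^bsub>R\<^esub> (block_val i) \<cdot> h \<cdot> block_val i \<in> par (lk a)"
  shows "h = \<one>\<^bsub>R\<^esub>"
proof -
  have hc: "h \<in> carrier R" using h by (rule link_closed)
  let ?z = "w @ replicate i b"
  have S: "set ?z \<subseteq> S" "a \<in> S" using w V last_in_set[OF w(2)] by auto
  have block_val: "block_val i = gen a \<cdot> val (pos ?z)"
    unfolding block_val_def block_def using S by (intro val_pos_Cons) auto
  have z: "val (pos ?z) \<in> carrier R" using S by simp
  have rep: "successively (\<lambda>s t. (s, t) \<notin> E) (replicate i b)" for i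
    by (induction i) (auto simp: successively_Cons irrefl)
  define k where "k = inv\<^bsub>R\<^esub> (block_val i) \<cdot> h \<cdot> block_val i"
  have k: "k \<in> carrier R" unfolding k_def using hc by simp
  have "h \<cdot> block_val i = block_val i \<cdot> k"
    unfolding k_def using hc by (simp add: m_assoc)
  then have "gen a \<cdot> (h \<cdot> val (pos ?z)) = gen a \<cdot> (val (pos ?z) \<cdot> k)"
    unfolding block_val using link_commute[OF S(2) h] S(2) hc z k by (simp only: gen_closed flip: m_assoc)
  then have "h \<cdot> val (pos ?z) = val (pos ?z) \<cdot> k"
    using S(2) hc z k by simp
  moreover have "successively (\<lambda>s t. (s, t) \<notin> E) (a # ?z)"
    using walk(1) w(2,3) rep[of i] irrefl[of b]
    by (cases i) (auto simp: successively_append_iff successively_Cons)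
  moreover have "last (a # ?z) = b" using w by (cases i) auto
  ultimately have "\<forall>s\<in>set ?z. h \<in> par (lk s)"
    using walk S by (intro conjugate_into_link[OF _ _ _ h h'[folded k_def]]) auto
  then have "h \<in> par (lk s)" if "s \<in> V" for s
    using h w(1) that by (cases "s = a") auto
  then show ?thesis
    using V h par_mono by (intro trivial_if_in_all_links[of V a]) auto
qed

lemma edge_block_position:
  assumes h: "h \<in> carrier R" "h' \<in> carrier R"
    and "edge a h = edge a h'" "edge a (h \<cdot> block_val i) = edge a (h' \<cdot> block_val i)"
  shows "h = h'"
proof -
  have "inv\<^bsub>R\<^esub> h \<cdot> h' \<in> par (lk a)" "inv\<^bsub>R\<^esub> (h \<cdot> block_val i) \<cdot> (h' \<cdot> block_val i) \<in> par (lk a)"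
    using assms edge_eq_iff by auto
  then have "inv\<^bsub>R\<^esub> h \<cdot> h' = \<one>\<^bsub>R\<^esub>"
    using h by (intro block_stabilizer[of _ i]) (auto simp: inv_mult_group m_assoc)
  then have "h \<cdot> (inv\<^bsub>R\<^esub> h \<cdot> h') = h" using h by simp
  then show ?thesis using h by simp
qed

lemma length_crossings_pos: "set u \<subseteq> S \<Longrightarrow> length (crossings s (val (pos u))) = count_list u s"
proof (induction u)
  case (Cons t u)
  then show ?case using crossings_pos_Cons[of u t s] by (simp add: shift_def)
qed (simp add: val_Nil)

text \<open>The index can be read off as the number of \<open>b\<close>-edges in the path of the block, which does not change on
  multiplication by elements of the link of \<open>a\<close>, because \<open>b\<close> is not in this link.\<close>

lemma edge_block_index:
  assumes h: "h \<in> carrier R" "h' \<in> carrier R"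
    and "edge a h = edge a h'" "edge a (h \<cdot> block_val i) = edge a (h' \<cdot> block_val j)"
  shows "i = j"
proof -
  define k where "k = inv\<^bsub>R\<^esub> h \<cdot> h'"
  define l where "l = inv\<^bsub>R\<^esub> (h \<cdot> block_val i) \<cdot> (h' \<cdot> block_val j)"
  have kl: "k \<in> par (lk a)" "l \<in> par (lk a)"
    unfolding k_def l_def using assms edge_eq_iff by auto
  then have kl': "k \<in> carrier R" "l \<in> carrier R" using link_closed by auto
  have "k \<cdot> block_val j = block_val i \<cdot> l"
    unfolding k_def l_def using h by (simp add: inv_mult_group m_assoc)
  moreover have "crossings b (k \<cdot> block_val j) = shift k (crossings b (block_val j))"
    using crossings_par[OF lk_subset walk(2) kl(1)] kl' by (simp add: crossings_mult)
  moreover have "crossings b (block_val i \<cdot> l) = crossings b (block_val i)"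
    using crossings_par[OF lk_subset walk(2) kl(2)] kl' crossings_in[of "block_val i" b]
    by (simp add: crossings_mult edge_paths_def join_Nil_right)
  ultimately have "length (crossings b (block_val j)) = length (crossings b (block_val i))"
    by (simp add: shift_def)
  moreover have "count_list (replicate n b) b = n" for n by (induction n) auto
  then have "length (crossings b (block_val n)) = count_list w b + n" for n
    unfolding block_val_def using set_block[of n] V(2) b_neq_a
    by (subst length_crossings_pos) (auto simp: block_def)
  ultimately show ?thesis by simp
qed

text \<open>The pair \<open>(e, e')\<close> is the translate by \<open>h\<close> of the two edges at the ends of the \<open>i\<close>-th block.\<close>

definition spans :: "nat \<Rightarrow> ('v \<times> bool) list set \<Rightarrow> ('v \<times> bool) list set set \<times> bool
    \<Rightarrow> ('v \<times> bool) list set set \<times> bool \<Rightarrow> bool" where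
  "spans i h e e' \<longleftrightarrow> h \<in> carrier R \<and> e = (edge a h, True) \<and> e' = (edge a (h \<cdot> block_val i), True)"

definition occurs :: "nat \<Rightarrow> ('v \<times> bool) list set set \<times> bool \<Rightarrow> ('v \<times> bool) list set set \<times> bool \<Rightarrow> bool" where
  "occurs i e e' \<longleftrightarrow> (\<exists>h. spans i h e e' \<or> spans i h (opp e') (opp e))"

text \<open>The factor for two consecutive edges: \<open>c h\<close> for the translate by \<open>h\<close> of the block, its inverse
  if the block is traversed backwards, and 1 otherwise. By \<open>spans_unique\<close> the element \<open>h\<close> is determined.\<close>

definition turn :: "nat \<Rightarrow> (('v \<times> bool) list set \<Rightarrow> ('v \<times> bool) list set) \<Rightarrow> ('v \<times> bool) list set set \<times> bool
    \<Rightarrow> ('v \<times> bool) list set set \<times> bool \<Rightarrow> ('v \<times> bool) list set" where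
  "turn i c e e' =
     (if \<exists>h. spans i h e e' then c (THE h. spans i h e e')
      else if \<exists>h. spans i h (opp e') (opp e) then inv\<^bsub>R\<^esub> (c (THE h. spans i h (opp e') (opp e)))
      else \<one>\<^bsub>R\<^esub>)"

lemma spans_unique: "spans i h e e' \<Longrightarrow> spans i h' e e' \<Longrightarrow> h = h'"
  unfolding spans_def using edge_block_position by auto

lemma the_spans: "spans i h e e' \<Longrightarrow> (THE h. spans i h e e') = h"
  by (rule the_equality) (assumption | rule spans_unique)+

lemma spans_orientation: "spans i h e e' \<Longrightarrow> \<not> spans j h' (opp e') (opp e)"
  by (auto simp: spans_def opp_def)

lemma turn_spans: "spans i h e e' \<Longrightarrow> turn i c e e' = c h"
  unfolding turn_def using the_spans[of i h e e'] by auto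

lemma turn_spans_opp: "spans i h (opp e') (opp e) \<Longrightarrow> turn i c e e' = inv\<^bsub>R\<^esub> (c h)"
  unfolding turn_def using the_spans[of i h "opp e'" "opp e"] spans_orientation[of i h "opp e'" "opp e" i]
  by auto

lemma turn_trivial: "\<not> occurs i e e' \<Longrightarrow> turn i c e e' = \<one>\<^bsub>R\<^esub>"
  by (auto simp: turn_def occurs_def)

lemma occurs_unique: "occurs i e e' \<Longrightarrow> occurs j e e' \<Longrightarrow> i = j"
  unfolding occurs_def using spans_orientation edge_block_index
  unfolding spans_def by (auto simp: opp_def)

end

text \<open>The factors \<open>c h\<close> that are inserted have to be compatible with translation; then the whole
  substitution is compatible with the crossed homomorphism \<open>crossings a\<close>.\<close>

locale block_substitution = separating_walk S E V a b w
  for S :: "'v set" and E V a b w +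
  fixes c :: "('v \<times> bool) list set \<Rightarrow> ('v \<times> bool) list set" and i :: nat
  assumes c_closed: "h \<in> carrier R \<Longrightarrow> c h \<in> carrier R"
    and c_equivariant: "h \<in> carrier R \<Longrightarrow> y \<in> carrier R \<Longrightarrow> c (y \<cdot> h) = y \<cdot> c h \<cdot> inv\<^bsub>R\<^esub> y"
begin

lemma turn_closed [simp]: "turn i c e e' \<in> carrier R"
proof (cases "occurs i e e'")
  case True
  then obtain h where h: "spans i h e e' \<or> spans i h (opp e') (opp e)" by (auto simp: occurs_def)
  then have "c h \<in> carrier R" by (auto simp: spans_def c_closed)
  then show ?thesis using h turn_spans[of i h e e' c] turn_spans_opp[of i h e' e c] by auto
qed (simp add: turn_trivial)

lemma turn_opp: "turn i c (opp e') (opp e) = inv\<^bsub>R\<^esub> (turn i c e e')"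
proof (cases "occurs i e e'")
  case True
  then obtain h where h: "spans i h e e' \<or> spans i h (opp e') (opp e)" by (auto simp: occurs_def)
  then have "c h \<in> carrier R" by (auto simp: spans_def c_closed)
  then show ?thesis
    using h turn_spans[of i h e e' c] turn_spans[of i h "opp e'" "opp e" c] turn_spans_opp[of i h e' e c]
      turn_spans_opp[of i h "opp e" "opp e'" c] by auto
next
  case False
  then have "\<not> occurs i (opp e') (opp e)" by (auto simp: occurs_def)
  then show ?thesis using False by (simp add: turn_trivial)
qed

lemma spans_shift: "spans i h e e' \<Longrightarrow> y \<in> carrier R \<Longrightarrow>
    spans i (y \<cdot> h) (apfst (\<lambda>C. y <#\<^bsub>R\<^esub> C) e) (apfst (\<lambda>C. y <#\<^bsub>R\<^esub> C) e')"
  by (simp add: spans_def edge_shift m_assoc)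

lemma opp_apfst: "opp (apfst f e) = apfst f (opp e)"
  by (cases e) (simp add: opp_def)

lemma occurs_shift: "occurs i e e' \<Longrightarrow> y \<in> carrier R \<Longrightarrow>
    occurs i (apfst (\<lambda>C. y <#\<^bsub>R\<^esub> C) e) (apfst (\<lambda>C. y <#\<^bsub>R\<^esub> C) e')"
  unfolding occurs_def opp_apfst using spans_shift by blast

lemma turn_shift:
  assumes y: "y \<in> carrier R" and e: "fst e \<in> edge a ` carrier R" "fst e' \<in> edge a ` carrier R"
  shows "turn i c (apfst (\<lambda>C. y <#\<^bsub>R\<^esub> C) e) (apfst (\<lambda>C. y <#\<^bsub>R\<^esub> C) e') = y \<cdot> turn i c e e' \<cdot> inv\<^bsub>R\<^esub> y"
proof (cases "occurs i e e'")
  case True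
  then obtain h where h: "spans i h e e' \<or> spans i h (opp e') (opp e)" by (auto simp: occurs_def)
  then have hc: "h \<in> carrier R" by (auto simp: spans_def)
  from h show ?thesis
  proof
    assume "spans i h e e'"
    then show ?thesis using turn_spans spans_shift[of h e e' y] y hc c_equivariant by simp
  next
    assume h: "spans i h (opp e') (opp e)"
    have "turn i c (apfst (\<lambda>C. y <#\<^bsub>R\<^esub> C) e) (apfst (\<lambda>C. y <#\<^bsub>R\<^esub> C) e') = inv\<^bsub>R\<^esub> (c (y \<cdot> h))"
      using spans_shift[OF h y] by (intro turn_spans_opp) (simp add: opp_apfst)
    also have "\<dots> = y \<cdot> inv\<^bsub>R\<^esub> (c h) \<cdot> inv\<^bsub>R\<^esub> y"
      using y hc c_closed[OF hc] by (simp add: c_equivariant inv_mult_group m_assoc)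
    finally show ?thesis using turn_spans_opp[OF h] by simp
  qed
next
  case False
  have unshift: "apfst (\<lambda>C. inv\<^bsub>R\<^esub> y <#\<^bsub>R\<^esub> C) (apfst (\<lambda>C. y <#\<^bsub>R\<^esub> C) e) = e" if e: "fst e \<in> edge a ` carrier R" for e
  proof -
    obtain h where "h \<in> carrier R" "fst e = edge a h" using e by auto
    then show ?thesis using y by (simp add: prod_eq_iff edge_shift)
  qed
  have "\<not> occurs i (apfst (\<lambda>C. y <#\<^bsub>R\<^esub> C) e) (apfst (\<lambda>C. y <#\<^bsub>R\<^esub> C) e')"
    using occurs_shift[of "apfst (\<lambda>C. y <#\<^bsub>R\<^esub> C) e" "apfst (\<lambda>C. y <#\<^bsub>R\<^esub> C) e'" "inv\<^bsub>R\<^esub> y"] False y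
    unfolding unshift[OF e(1)] unshift[OF e(2)] by auto
  then show ?thesis using False y by (simp add: turn_trivial)
qed

text \<open>Inserting the factor \<open>c h\<close> at each occurrence of the block, read from left to right, amounts
  to multiplying by the product of all factors, since they are already conjugated to the position where
  they occur.\<close>

definition subst :: "('v \<times> bool) list set \<Rightarrow> ('v \<times> bool) list set" where
  "subst y = pair_prod R (turn i c) (crossings a y) \<cdot> y"

lemma subst_closed [simp]: "y \<in> carrier R \<Longrightarrow> subst y \<in> carrier R"
  by (simp add: subst_def)

lemma subst_fixes:
  assumes "y \<in> carrier R"
    and "\<And>e e'. (e, e') \<in> set (zip (crossings a y) (tl (crossings a y))) \<Longrightarrow> \<not> occurs i e e'"
  shows "subst y = y"
  using assms by (simp add: subst_def pair_prod_trivial turn_trivial)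

text \<open>The only obstruction to multiplicativity is a block that straddles a junction of the tripod.\<close>

lemma subst_mult:
  assumes y: "y \<in> carrier R" and z: "z \<in> carrier R"
    and ABC: "crossings a y = P @ Q" "shift y (crossings a z) = inv_path Q @ W" "crossings a (y \<cdot> z) = P @ W"
    and free: "\<not> occurs i (last P) (hd Q)" "\<not> occurs i (last (inv_path Q)) (hd W)"
      "\<not> occurs i (last P) (hd W)"
  shows "subst (y \<cdot> z) = subst y \<cdot> subst z"
proof -
  let ?P = "pair_prod R (turn i c)"
  have "?P (crossings a (y \<cdot> z)) = ?P (crossings a y) \<cdot> ?P (shift y (crossings a z))"
    by (rule pair_prod_join[where f = "turn i c", OF turn_closed turn_opp ABC]) (use free in \<open>auto simp: junction_def turn_trivial\<close>)
  also have "?P (shift y (crossings a z)) = y \<cdot> ?P (crossings a z) \<cdot> inv\<^bsub>R\<^esub> y"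
    unfolding shift_def
    by (rule pair_prod_map[OF _ y], simp, rule turn_shift[OF y])
      (use crossings_in[OF z, of a] in \<open>auto simp: edge_paths_def\<close>)
  finally show ?thesis
    unfolding subst_def using y z by (simp add: m_assoc)
qed

text \<open>A position at which a block occurs is a coset representative of an edge of the path of \<open>y\<close>, and these
  edges are cosets of elements of \<open>par T\<close>.\<close>

lemma subst_in_subgroup:
  assumes "lk a \<subseteq> T" "T \<subseteq> S" "y \<in> par T" "\<And>h. h \<in> par T \<Longrightarrow> c h \<in> par T"
  shows "subst y \<in> par T"
proof -
  interpret T: subgroup "par T" R using assms(2) by (rule par_subgroup)
  have L: "h \<in> par T" if h: "h \<in> carrier R" and e: "fst e = edge a h" "e \<in> set (crossings a y)" for h e
  proof -
    obtain q where q: "q \<in> par T" "fst e = edge a q"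
      using crossings_edges_in_par[OF assms(2,3) e(2)] by blast
    have qc: "q \<in> carrier R" using q(1) by (rule T.mem_carrier)
    have "inv\<^bsub>R\<^esub> q \<cdot> h \<in> par (lk a)"
      using q(2) e(1) edge_eq_iff[OF qc h, of a] by simp
    then have "inv\<^bsub>R\<^esub> q \<cdot> h \<in> par T" using par_mono[OF assms(1)] by (rule rev_subsetD)
    with q(1) have "q \<cdot> (inv\<^bsub>R\<^esub> q \<cdot> h) \<in> par T" by (rule T.m_closed)
    then show ?thesis using qc h by simp
  qed
  have turn: "turn i c e e' \<in> par T" if "e \<in> set (crossings a y)" "e' \<in> set (crossings a y)" for e e'
  proof (cases "occurs i e e'")
    case True
    then obtain h where h: "spans i h e e' \<or> spans i h (opp e') (opp e)" by (auto simp: occurs_def)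
    then have "h \<in> par T"
    proof
      assume "spans i h e e'"
      then show ?thesis using that by (intro L[of h e]) (simp_all add: spans_def)
    next
      assume "spans i h (opp e') (opp e)"
      then have "h \<in> carrier R" "fst (opp e') = edge a h" by (simp_all add: spans_def)
      then show ?thesis using that(2) by (intro L[of h e']) (simp_all add: opp_def)
    qed
    then have "c h \<in> par T" "inv\<^bsub>R\<^esub> (c h) \<in> par T" using assms(4) T.m_inv_closed by simp_all
    then show ?thesis using h turn_spans[of i h e e' c] turn_spans_opp[of i h e' e c] by metis
  qed (simp add: turn_trivial)
  have "pair_prod R (turn i c) W \<in> par T" if "set W \<subseteq> set (crossings a y)" for W
    using that
  proof (induction W rule: induct_list012)
    case (3 e e' W)
    then show ?case using turn[of e e'] by (simp add: T.m_closed)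
  qed simp_all
  then show ?thesis unfolding subst_def using assms(3) by (intro T.m_closed) simp_all
qed

lemma hom_subst:
  assumes "group H" "f \<in> hom R H" "\<And>h. h \<in> carrier R \<Longrightarrow> f (c h) = \<one>\<^bsub>H\<^esub>" "y \<in> carrier R"
  shows "f (subst y) = f y"
proof -
  interpret f: group_hom R H f using assms is_group by (simp add: group_hom_def group_hom_axioms_def)
  have "f (turn i c e e') = \<one>\<^bsub>H\<^esub>" for e e'
  proof (cases "occurs i e e'")
    case True
    then obtain h where h: "spans i h e e' \<or> spans i h (opp e') (opp e)" by (auto simp: occurs_def)
    then have "h \<in> carrier R" by (auto simp: spans_def)
    then have "f (c h) = \<one>\<^bsub>H\<^esub>" "f (inv\<^bsub>R\<^esub> (c h)) = \<one>\<^bsub>H\<^esub>" using assms(3) c_closed by auto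
    then show ?thesis using h turn_spans[of i h e e' c] turn_spans_opp[of i h e' e c] by auto
  qed (simp add: turn_trivial)
  then have "f (pair_prod R (turn i c) W) = \<one>\<^bsub>H\<^esub>" for W
    by (induction W rule: induct_list012) auto
  then show ?thesis unfolding subst_def using assms(4) by simp
qed

end

section \<open>A generic element\<close>

context commutation_graph
begin

text \<open>The properties of a map \<open>f\<close> that replaces \<open>g\<close> by \<open>x\<close>: it fixes the constants \<open>C\<close> and the generators
  outside \<open>V\<close>, respects the products of the pairs in \<open>Q\<close>, does not leave parabolic subgroups that contain
  \<open>V\<close> and \<open>x\<close>, and becomes invisible under homomorphisms to \<open>H\<close> that do not distinguish \<open>x\<close> from \<open>g\<close>.\<close>

definition generic_lift :: "'v set \<Rightarrow> ('h, 'm) monoid_scheme \<Rightarrow> ('v \<times> bool) list set set \<Rightarrow> ('v \<times> bool) list set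
    \<Rightarrow> ('v \<times> bool) list set \<Rightarrow> (('v \<times> bool) list set \<times> ('v \<times> bool) list set) set
    \<Rightarrow> (('v \<times> bool) list set \<Rightarrow> ('v \<times> bool) list set) \<Rightarrow> bool" where
  "generic_lift V H C g x Q f \<longleftrightarrow>
     f \<in> carrier R \<rightarrow> carrier R \<and> f g = x \<and> (\<forall>y\<in>C. f y = y) \<and> (\<forall>s\<in>S - V. f (gen s) = gen s) \<and>
     f \<one>\<^bsub>R\<^esub> = \<one>\<^bsub>R\<^esub> \<and> (\<forall>(y, z)\<in>Q. f (y \<cdot> z) = f y \<cdot> f z) \<and>
     (\<forall>T. V \<subseteq> T \<and> T \<subseteq> S \<and> x \<in> par T \<longrightarrow> f \<in> par T \<rightarrow> par T) \<and>
     (\<forall>h\<in>hom R H. h x = h g \<longrightarrow> (\<forall>y\<in>carrier R. h (f y) = h y))"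

end

context separating_walk
begin

definition blocks_word :: "nat \<Rightarrow> 'v list" where
  "blocks_word n = concat (map block [0..<n])"

definition prefix_val :: "nat \<Rightarrow> ('v \<times> bool) list set" where
  "prefix_val n = val (pos (blocks_word n))"

lemma set_blocks_word: "set (blocks_word n) \<subseteq> V"
  using set_block by (fastforce simp: blocks_word_def)

lemma set_blocks_word_S: "set (blocks_word n) \<subseteq> S"
  using set_blocks_word[of n] V(2) by blast

lemma prefix_val_closed [simp]: "prefix_val n \<in> carrier R"
  unfolding prefix_val_def using set_blocks_word_S[of n] by simp

lemma prefix_val_Suc: "prefix_val (Suc n) = prefix_val n \<cdot> block_val n"
  using set_blocks_word_S[of n] set_block[of n] V(2)
  unfolding prefix_val_def block_val_def blocks_word_def by (simp add: val_append del: set_concat)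

lemma crossings_val_pos_avoid: "set u \<subseteq> S \<Longrightarrow> a \<notin> set u \<Longrightarrow> crossings a (val (pos u)) = []"
  by (metis length_0_conv length_crossings_pos count_list_0_iff)

lemma crossings_block_val: "crossings a (block_val i) = [(edge a \<one>\<^bsub>R\<^esub>, True)]"
proof -
  let ?z = "w @ replicate i b"
  have "set ?z \<subseteq> S" "a \<notin> set ?z" using w V last_in_set[OF w(2)] by auto
  then show ?thesis
    using crossings_val_pos_avoid[of ?z] crossings_pos_Cons[of ?z a a] V
    unfolding block_val_def block_def by simp
qed

lemma crossings_prefix_val: "crossings a (prefix_val n) = map (\<lambda>n. (edge a (prefix_val n), True)) [0..<n]"
proof (induction n)
  case (Suc n)
  have "pos (blocks_word (Suc n)) = pos (blocks_word n @ block n)" by (simp add: blocks_word_def)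
  then have "crossings a (prefix_val (Suc n)) = crossings a (prefix_val n) @ shift (prefix_val n) (crossings a (block_val n))"
    unfolding prefix_val_def block_val_def using set_block[of n] V(2) set_blocks_word_S[of n]
    by (simp only: crossings_pos_append)
  then show ?case using Suc by (simp add: crossings_block_val edge_shift)
qed (simp add: prefix_val_def blocks_word_def val_Nil)

lemma crossings_generic: "crossings a (val (pos (blocks_word n @ [a]))) = map (\<lambda>n. (edge a (prefix_val n), True)) [0..<Suc n]"
proof -
  have "crossings a (val (pos (blocks_word n @ [a])))
      = crossings a (prefix_val n) @ shift (prefix_val n) (crossings a (val (pos [a])))"
    unfolding prefix_val_def using set_blocks_word_S by (intro crossings_pos_append) auto
  also have "crossings a (val (pos [a])) = [(edge a \<one>\<^bsub>R\<^esub>, True)]"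
    by (simp add: crossings_gen flip: gen_def)
  finally show ?thesis by (simp add: crossings_prefix_val edge_shift)
qed

lemma spans_prefix_val: "spans n (prefix_val n) (edge a (prefix_val n), True) (edge a (prefix_val (Suc n)), True)"
  by (simp add: spans_def prefix_val_Suc)

text \<open>The path of the product of blocks turns exactly once in the \<open>i\<close>-th way.\<close>

lemma turn_product_generic:
  assumes "c (prefix_val i) \<in> carrier R" "i < n"
  shows "pair_prod R (turn i c) (map (\<lambda>n. (edge a (prefix_val n), True)) [0..<Suc n]) = c (prefix_val i)"
proof -
  let ?F = "\<lambda>n. (edge a (prefix_val n), True)"
  have turn: "turn i c (?F m) (?F (Suc m)) = (if m = i then c (prefix_val i) else \<one>\<^bsub>R\<^esub>)" for m
  proof (cases "m = i")
    case True
    then show ?thesis using turn_spans[OF spans_prefix_val, of i c] by simp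
  next
    case False
    have "occurs m (?F m) (?F (Suc m))" using spans_prefix_val occurs_def by blast
    then have "\<not> occurs i (?F m) (?F (Suc m))" using False occurs_unique by blast
    then show ?thesis using False turn_trivial by simp
  qed
  have "pair_prod R (turn i c) (map ?F [m..<Suc n]) = (if m \<le> i then c (prefix_val i) else \<one>\<^bsub>R\<^esub>)" if "m \<le> n" for m
    using that
  proof (induction rule: inc_induct)
    case base
    then show ?case using assms by simp
  next
    case (step m)
    have "[m..<Suc n] = m # Suc m # [Suc (Suc m)..<Suc n]" "[Suc m..<Suc n] = Suc m # [Suc (Suc m)..<Suc n]"
      using step by (simp_all add: upt_conv_Cons)
    then have "pair_prod R (turn i c) (map ?F [m..<Suc n])
        = turn i c (?F m) (?F (Suc m)) \<cdot> pair_prod R (turn i c) (map ?F [Suc m..<Suc n])" by simp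
    then show ?case unfolding turn step.IH using assms by auto
  qed
  from this[of 0] show ?thesis by simp
qed

text \<open>By \<open>occurs_unique\<close>, a pair of edges can be bad for at most one index.\<close>

lemma exists_free_index:
  assumes "finite Q" "card Q < n"
  shows "\<exists>i<n. \<forall>q\<in>Q. \<not> occurs i (fst q) (snd q)"
proof (rule ccontr)
  assume "\<not> ?thesis"
  then have "\<forall>i<n. \<exists>q\<in>Q. occurs i (fst q) (snd q)" by simp
  then obtain q where q: "\<And>i. i < n \<Longrightarrow> q i \<in> Q \<and> occurs i (fst (q i)) (snd (q i))" by metis
  then have "inj_on q {..<n}" using occurs_unique by (intro inj_onI) (metis lessThan_iff)
  moreover have "q ` {..<n} \<subseteq> Q" using q by auto
  ultimately have "card {..<n} \<le> card Q" using assms(1) by (rule card_inj_on_le)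
  then show False using assms(2) by simp
qed

text \<open>The word \<open>u\<close> depends on the constants \<open>C\<close> and on the number \<open>N\<close> of products, but neither on \<open>x\<close> nor on
  the elements to be multiplied. This is what allows the answers in the game to be arbitrarily
  complicated: a product of two elements spoils at most three indices, however long they are.\<close>

theorem exists_generic_lift:
  fixes H :: "('h, 'm) monoid_scheme"
  assumes H: "group H" and C: "finite C" "C \<subseteq> carrier R"
  obtains u where "set u \<subseteq> V"
    "\<And>x Q. x \<in> carrier R \<Longrightarrow> finite Q \<Longrightarrow> card Q \<le> N \<Longrightarrow> Q \<subseteq> carrier R \<times> carrier R \<Longrightarrow>
       \<exists>f. generic_lift V H C (val (pos u)) x Q f"
proof
  define turns where "turns y = set (zip (crossings a y) (tl (crossings a y)))" for y
  \<comment> \<open>more blocks than there can be bad pairs: three junctions for each product, and the turns of the constants\<close>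
  define n where "n = Suc (3 * N + (\<Sum>y\<in>C. card (turns y)))"
  define u where "u = blocks_word n @ [a]"
  define g where "g = val (pos u)"
  show u: "set u \<subseteq> V" unfolding u_def using set_blocks_word V(3) by simp
  have g: "g \<in> carrier R" unfolding g_def using u V(2) by (intro val_closed) auto
  fix x and Q :: "(('v \<times> bool) list set \<times> ('v \<times> bool) list set) set"
  assume x: "x \<in> carrier R" and Q: "finite Q" "card Q \<le> N" "Q \<subseteq> carrier R \<times> carrier R"
  define splits where "splits q p \<longleftrightarrow> crossings a (fst q) = fst p @ fst (snd p) \<and>
    shift (fst q) (crossings a (snd q)) = inv_path (fst (snd p)) @ snd (snd p) \<and>
    crossings a (fst q \<cdot> snd q) = fst p @ snd (snd p)" for q p
  have "\<forall>q\<in>Q. \<exists>p. splits q p"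
  proof
    fix q assume "q \<in> Q"
    then have q: "fst q \<in> carrier R" "snd q \<in> carrier R" using Q(3) by auto
    have "reduced (crossings a (fst q))"
      using crossings_in[OF q(1), of a] by (simp add: edge_paths_def)
    moreover have "reduced (shift (fst q) (crossings a (snd q)))"
      using shift_in[OF q(1) crossings_in[OF q(2), of a]] by (simp add: edge_paths_def)
    ultimately obtain K L M where "crossings a (fst q) = K @ L"
      "shift (fst q) (crossings a (snd q)) = inv_path L @ M"
      "join (crossings a (fst q)) (shift (fst q) (crossings a (snd q))) = K @ M"
      using tripod by blast
    then have "splits q (K, L, M)"
      unfolding splits_def crossings_mult[OF q] by (simp only: fst_conv snd_conv)
    then show "\<exists>p. splits q p" by blast
  qed
  then obtain p where p: "\<forall>q\<in>Q. splits q (p q)" by (rule bchoice[THEN exE])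
  define K L M where "K q = fst (p q)" and "L q = fst (snd (p q))" and "M q = snd (snd (p q))" for q
  have KLM: "crossings a (fst q) = K q @ L q \<and>
      shift (fst q) (crossings a (snd q)) = inv_path (L q) @ M q \<and> crossings a (fst q \<cdot> snd q) = K q @ M q"
    if "q \<in> Q" for q
    using bspec[OF p that] unfolding splits_def K_def L_def M_def .
  define bad where "bad q = {(last (K q), hd (L q)), (last (inv_path (L q)), hd (M q)), (last (K q), hd (M q))}" for q
  let ?bad = "(\<Union>q\<in>Q. bad q) \<union> (\<Union>y\<in>C. turns y)"
  have "card (\<Union>q\<in>Q. bad q) \<le> (\<Sum>q\<in>Q. card (bad q))" using Q(1) by (rule card_UN_le)
  also have "\<dots> \<le> card Q * 3"
    using sum_bounded_above[of Q "\<lambda>q. card (bad q)" 3] unfolding bad_def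
    by (simp add: card_insert_if)
  finally have "card (\<Union>q\<in>Q. bad q) \<le> 3 * N" using Q(2) by simp
  moreover have "card (\<Union>y\<in>C. turns y) \<le> (\<Sum>y\<in>C. card (turns y))" using C(1) by (rule card_UN_le)
  ultimately have "card ?bad < n"
    using card_Un_le[of "\<Union>q\<in>Q. bad q" "\<Union>y\<in>C. turns y"] by (simp add: n_def)
  moreover have "finite ?bad" using Q(1) C(1) by (simp add: bad_def turns_def)
  ultimately obtain i where i: "i < n" and "\<forall>q\<in>?bad. \<not> occurs i (fst q) (snd q)"
    using exists_free_index by blast
  then have free: "\<And>q e. q \<in> Q \<Longrightarrow> e \<in> bad q \<Longrightarrow> \<not> occurs i (fst e) (snd e)"
    "\<And>y e. y \<in> C \<Longrightarrow> e \<in> turns y \<Longrightarrow> \<not> occurs i (fst e) (snd e)"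
    by blast+
  \<comment> \<open>The factor at the position \<open>h\<close> of the \<open>i\<close>-th block in \<open>g\<close> itself has to be \<open>x g\<^sup>-\<^sup>1\<close>; the factors at other
    positions are forced by equivariance.\<close>
  define c where "c h = (h \<cdot> inv\<^bsub>R\<^esub> (prefix_val i)) \<cdot> (x \<cdot> inv\<^bsub>R\<^esub> g) \<cdot> inv\<^bsub>R\<^esub> (h \<cdot> inv\<^bsub>R\<^esub> (prefix_val i))" for h
  interpret block_substitution S E V a b w c i
    by unfold_locales (use x g in \<open>simp_all add: c_def inv_mult_group m_assoc\<close>)
  have c_prefix: "c (prefix_val i) = x \<cdot> inv\<^bsub>R\<^esub> g" unfolding c_def using x g by simp
  have generic: "subst g = x"
    unfolding subst_def g_def u_def crossings_generic
    using turn_product_generic[of c i n] i c_prefix x g unfolding g_def u_def by (simp add: m_assoc)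
  have fixes_C: "subst y = y" if "y \<in> C" for y
    using that C(2) free(2)[of y] unfolding turns_def by (intro subst_fixes) auto
  have fixes_gen: "subst (gen s) = gen s" if "s \<in> S - V" for s
  proof -
    have "s \<noteq> a" "s \<in> S" using that V(3) by auto
    then have "crossings a (gen s) = []" by (simp add: crossings_gen)
    then show ?thesis using \<open>s \<in> S\<close> by (intro subst_fixes) simp_all
  qed
  have mult: "subst (y \<cdot> z) = subst y \<cdot> subst z" if "(y, z) \<in> Q" for y z
  proof (rule subst_mult)
    show "y \<in> carrier R" "z \<in> carrier R" using that Q(3) by blast+
    show "crossings a y = K (y, z) @ L (y, z)" "shift y (crossings a z) = inv_path (L (y, z)) @ M (y, z)"
      "crossings a (y \<cdot> z) = K (y, z) @ M (y, z)"
      using KLM[OF that] by (simp_all only: fst_conv snd_conv)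
    note avoid = free(1)[OF that, unfolded bad_def]
    show "\<not> occurs i (last (K (y, z))) (hd (L (y, z)))"
      using avoid[of "(last (K (y, z)), hd (L (y, z)))"] by simp
    show "\<not> occurs i (last (inv_path (L (y, z)))) (hd (M (y, z)))"
      using avoid[of "(last (inv_path (L (y, z))), hd (M (y, z)))"] by simp
    show "\<not> occurs i (last (K (y, z))) (hd (M (y, z)))"
      using avoid[of "(last (K (y, z)), hd (M (y, z)))"] by simp
  qed
  have par: "subst y \<in> par T" if T: "V \<subseteq> T" "T \<subseteq> S" "x \<in> par T" and y: "y \<in> par T" for T y
  proof -
    interpret T: subgroup "par T" R using T(2) by (rule par_subgroup)
    have "g \<in> par T" "prefix_val i \<in> par T"
      unfolding g_def prefix_val_def par_def using u T(1) set_blocks_word[of i] by auto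
    then have "c k \<in> par T" if "k \<in> par T" for k
      unfolding c_def using T(3) that by (intro T.m_closed T.m_inv_closed)
    moreover have "lk a \<subseteq> T" using V(4) T(1) by blast
    ultimately show ?thesis using T(2) y by (intro subst_in_subgroup)
  qed
  have hom: "h (subst y) = h y" if h: "h \<in> hom R H" "h x = h g" and y: "y \<in> carrier R" for h y
  proof (rule hom_subst[OF H h(1) _ y])
    interpret h: group_hom R H h using H h(1) is_group by (simp add: group_hom_def group_hom_axioms_def)
    fix k assume "k \<in> carrier R"
    then show "h (c k) = \<one>\<^bsub>H\<^esub>" unfolding c_def using x g h(2) by (simp add: h.hom_inv)
  qed
  have one: "subst \<one>\<^bsub>R\<^esub> = \<one>\<^bsub>R\<^esub>" by (intro subst_fixes) auto
  have "generic_lift V H C g x Q subst"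
    unfolding generic_lift_def
  proof (intro conjI)
    show "subst \<in> carrier R \<rightarrow> carrier R" by simp
    show "\<forall>(y, z)\<in>Q. subst (y \<cdot> z) = subst y \<cdot> subst z" using mult by (intro ballI) (simp add: case_prod_unfold)
    show "\<forall>T. V \<subseteq> T \<and> T \<subseteq> S \<and> x \<in> par T \<longrightarrow> subst \<in> par T \<rightarrow> par T"
      by (intro allI impI Pi_I) (elim conjE, rule par)
    show "\<forall>h\<in>hom R H. h x = h g \<longrightarrow> (\<forall>y\<in>carrier R. h (subst y) = h y)"
      by (intro ballI impI) (rule hom)
  qed (intro ballI generic one fixes_C fixes_gen; assumption)+
  then show "\<exists>f. generic_lift V H C (val (pos u)) x Q f" unfolding g_def by blast
qed

end

section \<open>Indecomposability and connectedness of the complement\<close>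

lemma commutator_value:
  assumes "group H" "\<phi> s \<in> carrier H" "\<phi> t \<in> carrier H" "\<phi> s \<otimes>\<^bsub>H\<^esub> \<phi> t = \<phi> t \<otimes>\<^bsub>H\<^esub> \<phi> s"
  shows "word_value H \<phi> [(s, False), (t, False), (s, True), (t, True)] = \<one>\<^bsub>H\<^esub>"
proof -
  interpret group H by fact
  show ?thesis using assms by simp
qed

context commutation_graph
begin

lemma raag_hom:
  assumes "group H" "\<phi> \<in> S \<rightarrow> carrier H" "\<And>s t. (s, t) \<in> E \<Longrightarrow> \<phi> s \<otimes>\<^bsub>H\<^esub> \<phi> t = \<phi> t \<otimes>\<^bsub>H\<^esub> \<phi> s"
  obtains f where "f \<in> hom R H" "\<And>s. s \<in> S \<Longrightarrow> f (gen s) = \<phi> s"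
proof -
  have "word_value H \<phi> r = \<one>\<^bsub>H\<^esub>" if r: "r \<in> commutators E" for r
  proof -
    obtain s t where "r = [(s, False), (t, False), (s, True), (t, True)]" "(s, t) \<in> E"
      using r by (auto simp: commutators_def)
    moreover from this have "s \<in> S" "t \<in> S" using edges by auto
    ultimately show ?thesis using assms commutator_value[of H \<phi> s t] by blast
  qed
  then obtain f where f: "f \<in> hom (presented_group S (commutators E)) H"
      "\<And>s. s \<in> S \<Longrightarrow> f (generator S (commutators E) s) = \<phi> s"
    using presented_hom[OF assms(1,2), of "commutators E"] by blast
  show thesis
    by (rule that[of f]) (use f in \<open>simp_all only: raag_def gen_eq_generator\<close>)
qed

lemma raag_hom_eqI:
  assumes "group H" "f \<in> hom R H" "f' \<in> hom R H" "\<And>s. s \<in> S \<Longrightarrow> f (gen s) = f' (gen s)" "y \<in> carrier R"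
  shows "f y = f' y"
  using assms unfolding raag_def gen_eq_generator by (rule presented_hom_eqI)

lemma hom_par_subset:
  assumes "group H" "f \<in> hom R H" "subgroup K H" "T \<subseteq> S" "\<And>s. s \<in> T \<Longrightarrow> f (gen s) \<in> K" "y \<in> par T"
  shows "f y \<in> K"
proof -
  interpret f: group_hom R H f using assms is_group by (simp add: group_hom_def group_hom_axioms_def)
  interpret K: subgroup K H by fact
  obtain v where v: "v \<in> words T" "y = val v" using assms(6) by (auto simp: par_def)
  show ?thesis unfolding v(2) using v(1)
  proof (induction v)
    case (Cons l v)
    then obtain t b where l: "l = (t, b)" "t \<in> T" "t \<in> S" "v \<in> words S"
      using assms(4) subsetD[OF words_mono[OF assms(4)]] by (cases l) auto
    have "f (val [(t, b)]) \<in> K"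
      using l assms(5)[of t] by (simp add: val_letter f.hom_inv)
    moreover have "f (val (l # v)) = f (val [(t, b)]) \<otimes>\<^bsub>H\<^esub> f (val v)"
      using l val_Cons[of t v b] by simp
    ultimately show ?case using Cons by simp
  qed (simp add: val_Nil)
qed

lemma gen_neq_one: "s \<in> S \<Longrightarrow> gen s \<noteq> \<one>\<^bsub>R\<^esub>"
  using crossings_gen[of s s] by auto

lemma par_S: "par S = carrier R"
  using par_closed[of S] by (auto simp: par_def elim: valE)

lemma commutative_if_generators_commute:
  assumes "\<And>s t. s \<in> S \<Longrightarrow> t \<in> S \<Longrightarrow> gen s \<cdot> gen t = gen t \<cdot> gen s"
  shows "comm_group R"
proof (rule group.group_comm_groupI[OF is_group])
  fix x y assume xy: "x \<in> carrier R" "y \<in> carrier R"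
  have central: "gen s \<cdot> z = z \<cdot> gen s" if "s \<in> S" "z \<in> carrier R" for s z
    by (rule par_commute[OF order_refl that(1)]) (use assms that in \<open>auto simp: par_S\<close>)
  obtain v where v: "v \<in> words S" "x = val v" using xy(1) by (rule valE)
  show "x \<cdot> y = y \<cdot> x"
    unfolding v(2) using v(1)
  proof (induction v)
    case (Cons l v)
    then obtain t b where l: "l = (t, b)" "t \<in> S" "v \<in> words S" by (cases l) auto
    let ?g = "val [(t, b)]"
    have g: "?g \<in> carrier R" using l by simp
    have "?g \<cdot> y = y \<cdot> ?g"
      using central[OF l(2) xy(2)] inv_commute[of "gen t" y] l(2) xy(2) by (simp add: val_letter)
    then have "?g \<cdot> val v \<cdot> y = y \<cdot> (?g \<cdot> val v)"
      using Cons.IH l(3) g xy(2) val_closed[OF l(3)] by (metis m_assoc)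
    then show ?case using l val_Cons[of t v b] by simp
  qed (use xy in \<open>simp add: val_Nil\<close>)
qed

lemma par_split:
  assumes "T \<subseteq> S" "\<And>s t. s \<in> T \<Longrightarrow> t \<in> S - T \<Longrightarrow> (s, t) \<in> E"
  shows "x \<in> par T \<Longrightarrow> y \<in> par (S - T) \<Longrightarrow> x \<cdot> y = y \<cdot> x"
    and "z \<in> carrier R \<Longrightarrow> \<exists>x\<in>par T. \<exists>y\<in>par (S - T). z = x \<cdot> y"
proof -
  have sub: "S - T \<subseteq> S" by auto
  interpret T: subgroup "par T" R using assms(1) by (rule par_subgroup)
  interpret T': subgroup "par (S - T)" R using sub by (rule par_subgroup)
  have gen: "gen t \<cdot> x = x \<cdot> gen t" if "t \<in> S - T" "x \<in> par T" for t x
  proof (rule par_commute[OF assms(1)])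
    show "gen t \<cdot> gen s = gen s \<cdot> gen t" if "s \<in> T" for s
      using \<open>t \<in> S - T\<close> that by (intro gen_commute sym[OF assms(2)])
  qed (use that in auto)
  have comm: "x \<cdot> y = y \<cdot> x" if x: "x \<in> par T" and y: "y \<in> par (S - T)" for x y
  proof -
    obtain v where v: "v \<in> words (S - T)" "y = val v" using y by (auto simp: par_def)
    have xc: "x \<in> carrier R" using x by (rule T.mem_carrier)
    show ?thesis unfolding v(2) using v(1)
    proof (induction v)
      case (Cons l v)
      then obtain t b where l: "l = (t, b)" "t \<in> S - T" "v \<in> words S"
        using subsetD[OF words_mono[OF sub]] by (cases l) auto
      let ?g = "val [(t, b)]"
      have g: "?g \<in> carrier R" using l by simp
      have "?g \<cdot> x = x \<cdot> ?g"
        using gen[OF l(2) x] inv_commute[of "gen t" x] l(2) xc by (simp add: val_letter)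
      then have "x \<cdot> (?g \<cdot> val v) = ?g \<cdot> val v \<cdot> x"
        using Cons.IH Cons.prems g xc val_closed[OF l(3)] by (metis Cons_in_lists_iff m_assoc)
      then show ?case using l val_Cons[of t v b] by simp
    qed (use xc in \<open>simp add: val_Nil\<close>)
  qed
  then show "x \<in> par T \<Longrightarrow> y \<in> par (S - T) \<Longrightarrow> x \<cdot> y = y \<cdot> x" .
  show "\<exists>x\<in>par T. \<exists>y\<in>par (S - T). z = x \<cdot> y" if z: "z \<in> carrier R"
  proof -
    obtain v where v: "v \<in> words S" "z = val v" using z by (rule valE)
    show ?thesis unfolding v(2) using v(1)
    proof (induction v)
      case Nil
      then show ?case by (intro bexI[of _ "\<one>\<^bsub>R\<^esub>"]) (simp_all add: val_Nil)
    next
      case (Cons l v)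
      then obtain t b where l: "l = (t, b)" "t \<in> S" "v \<in> words S" by (cases l) auto
      obtain x y where xy: "x \<in> par T" "y \<in> par (S - T)" "val v = x \<cdot> y" using Cons l by auto
      have xyc: "x \<in> carrier R" "y \<in> carrier R" using xy by (auto intro: T.mem_carrier T'.mem_carrier)
      let ?g = "val [(t, b)]"
      have g: "?g \<in> carrier R" using l by simp
      have eq: "val (l # v) = ?g \<cdot> (x \<cdot> y)" using l xy val_Cons[of t v b] by simp
      show ?case
      proof (cases "t \<in> T")
        case True
        then have "?g \<in> par T" unfolding par_def by auto
        then show ?thesis unfolding eq using xy xyc g
          by (intro bexI[of _ "?g \<cdot> x"] bexI[of _ y]) (simp_all add: m_assoc)
      next
        case False
        then have "?g \<in> par (S - T)" using l unfolding par_def by auto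
        moreover from this have "?g \<cdot> (x \<cdot> y) = x \<cdot> (?g \<cdot> y)"
          using comm[OF xy(1)] xyc g by (metis m_assoc)
        ultimately show ?thesis unfolding eq using xy
          by (intro bexI[of _ x] bexI[of _ "?g \<cdot> y"]) simp_all
      qed
    qed
  qed
qed

text \<open>The two parabolic subgroups commute elementwise, generate the group, and meet trivially by
  \<open>par_Int\<close>. They are nontrivial, since the path of a generator is not empty.\<close>

lemma decomposable_if_complement_disconnected:
  assumes T: "T \<subseteq> S" "T \<noteq> {}" "T \<noteq> S" and E: "\<And>s t. s \<in> T \<Longrightarrow> t \<in> S - T \<Longrightarrow> (s, t) \<in> E"
  shows "\<not> directly_indecomposable R"
proof -
  have sub: "S - T \<subseteq> S" by auto
  interpret T: subgroup "par T" R using T(1) by (rule par_subgroup)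
  interpret T': subgroup "par (S - T)" R using sub by (rule par_subgroup)
  define H where "H = R\<lparr>carrier := par T\<rparr>"
  define K where "K = R\<lparr>carrier := par (S - T)\<rparr>"
  have "group H" "group K"
    unfolding H_def K_def by (rule T.subgroup_is_group[OF is_group], rule T'.subgroup_is_group[OF is_group])
  have nontrivial: "par U \<noteq> {\<one>\<^bsub>R\<^esub>}" if "U \<subseteq> S" "U \<noteq> {}" for U
    using that gen_in_par[of _ U] gen_neq_one by fastforce
  have "\<not> trivial_group H" "\<not> trivial_group K"
    using nontrivial[of T] nontrivial[of "S - T"] T by (auto simp: trivial_group_def H_def K_def)
  let ?f = "\<lambda>(x, y). x \<cdot> y"
  have xy: "x \<in> par T \<Longrightarrow> x \<in> carrier R" "y \<in> par (S - T) \<Longrightarrow> y \<in> carrier R" for x y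
    by (auto intro: T.mem_carrier T'.mem_carrier)
  note split = par_split[OF T(1) E]
  have "?f \<in> hom (H \<times>\<times> K) R"
  proof (rule homI)
    fix p q assume "p \<in> carrier (H \<times>\<times> K)" "q \<in> carrier (H \<times>\<times> K)"
    then obtain x y x' y' where pq: "p = (x, y)" "q = (x', y')" "x \<in> par T" "x' \<in> par T"
        "y \<in> par (S - T)" "y' \<in> par (S - T)"
      by (auto simp: DirProd_def H_def K_def)
    have c: "x \<in> carrier R" "x' \<in> carrier R" "y \<in> carrier R" "y' \<in> carrier R" using pq xy by auto
    show "?f (p \<otimes>\<^bsub>H \<times>\<times> K\<^esub> q) = ?f p \<cdot> ?f q"
    proof -
      have "x \<cdot> x' \<cdot> (y \<cdot> y') = x \<cdot> ((x' \<cdot> y) \<cdot> y')" using c by (simp add: m_assoc)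
      also have "x' \<cdot> y = y \<cdot> x'" using split(1) pq by blast
      finally show ?thesis using c unfolding pq(1,2) by (simp add: H_def K_def m_assoc)
    qed
  qed (auto simp: DirProd_def H_def K_def xy)
  moreover have "bij_betw ?f (carrier (H \<times>\<times> K)) (carrier R)"
  proof (rule bij_betw_imageI)
    show "inj_on ?f (carrier (H \<times>\<times> K))"
    proof (rule inj_onI)
      fix p q assume "p \<in> carrier (H \<times>\<times> K)" "q \<in> carrier (H \<times>\<times> K)" and eq: "?f p = ?f q"
      then obtain x y x' y' where pq: "p = (x, y)" "q = (x', y')" "x \<in> par T" "x' \<in> par T"
          "y \<in> par (S - T)" "y' \<in> par (S - T)"
        by (auto simp: DirProd_def H_def K_def)
      have c: "x \<in> carrier R" "x' \<in> carrier R" "y \<in> carrier R" "y' \<in> carrier R" using pq xy by auto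
      have eq': "x \<cdot> y = x' \<cdot> y'" using eq pq by simp
      have "inv\<^bsub>R\<^esub> x' \<cdot> x = inv\<^bsub>R\<^esub> x' \<cdot> (x \<cdot> y) \<cdot> inv\<^bsub>R\<^esub> y" using c by (simp add: m_assoc)
      also have "\<dots> = y' \<cdot> inv\<^bsub>R\<^esub> y" unfolding eq' using c by simp
      finally have k: "inv\<^bsub>R\<^esub> x' \<cdot> x = y' \<cdot> inv\<^bsub>R\<^esub> y" .
      have "inv\<^bsub>R\<^esub> x' \<cdot> x \<in> par T" using pq by (intro T.m_closed T.m_inv_closed)
      moreover have "inv\<^bsub>R\<^esub> x' \<cdot> x \<in> par (S - T)"
        unfolding k using pq by (intro T'.m_closed T'.m_inv_closed)
      moreover have "par T \<inter> par (S - T) = {\<one>\<^bsub>R\<^esub>}"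
        using par_Int[OF T(1) sub] par_empty by simp
      ultimately have one: "inv\<^bsub>R\<^esub> x' \<cdot> x = \<one>\<^bsub>R\<^esub>" by blast
      have "x = x' \<cdot> (inv\<^bsub>R\<^esub> x' \<cdot> x)" using c by simp
      then have "x = x'" unfolding one using c by simp
      moreover from this have "y = y'" using eq' c by simp
      ultimately show "p = q" using pq by simp
    qed
    show "?f ` carrier (H \<times>\<times> K) = carrier R"
    proof
      show "?f ` carrier (H \<times>\<times> K) \<subseteq> carrier R" using xy by (auto simp: DirProd_def H_def K_def)
      show "carrier R \<subseteq> ?f ` carrier (H \<times>\<times> K)"
      proof
        fix z assume "z \<in> carrier R"
        then obtain x y where "x \<in> par T" "y \<in> par (S - T)" "z = x \<cdot> y" using split(2) by blast
        then show "z \<in> ?f ` carrier (H \<times>\<times> K)"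
          by (intro image_eqI[of _ _ "(x, y)"]) (simp_all add: H_def K_def)
      qed
    qed
  qed
  ultimately have "?f \<in> iso (H \<times>\<times> K) R" by (simp add: iso_def)
  then have "H \<times>\<times> K \<cong> R" unfolding is_iso_def by blast
  then have "R \<cong> H \<times>\<times> K"
    using group.iso_sym[OF DirProd_group[OF \<open>group H\<close> \<open>group K\<close>]] by blast
  then show ?thesis
    unfolding directly_indecomposable_def
    using \<open>group H\<close> \<open>group K\<close> \<open>\<not> trivial_group H\<close> \<open>\<not> trivial_group K\<close> by blast
qed

text \<open>A connected set of vertices is enlarged by one vertex \<open>t\<close> at a time: the walk is extended by
  the detour \<open>s, t, s\<close>. Growing connected sets in this way, instead of taking all vertices at once, leaves in the
  end a last vertex whose removal does not disconnect the complement graph.\<close>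

lemma exists_walk_of_size:
  assumes cut: "\<And>T. T \<subseteq> S \<Longrightarrow> T \<noteq> {} \<Longrightarrow> T \<noteq> S \<Longrightarrow> \<exists>s\<in>T. \<exists>t\<in>S - T. (s, t) \<notin> E"
    and "1 \<le> n" "n \<le> card S"
  shows "\<exists>u. set u \<subseteq> S \<and> card (set u) = n \<and> successively (\<lambda>s t. (s, t) \<notin> E) u"
  using assms(2,3)
proof (induction n rule: nat_induct_at_least)
  case base
  then have "S \<noteq> {}" by auto
  then obtain s where "s \<in> S" by blast
  then show ?case by (intro exI[of _ "[s]"]) simp
next
  case (Suc n)
  then obtain u where u: "set u \<subseteq> S" "card (set u) = n" "successively (\<lambda>s t. (s, t) \<notin> E) u" by auto
  have "set u \<noteq> {}" "set u \<noteq> S" using u Suc by auto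
  then obtain s t where st: "s \<in> set u" "t \<in> S - set u" "(s, t) \<notin> E" using cut[OF u(1)] by blast
  obtain p q where pq: "u = p @ s # q" using st(1) by (meson split_list)
  have "(t, s) \<notin> E" using st(3) sym by blast
  then have "successively (\<lambda>s t. (s, t) \<notin> E) (p @ s # t # s # q)"
    using u(3) st(3) unfolding pq by (simp add: successively_append_iff successively_Cons)
  moreover have "set (p @ s # t # s # q) = insert t (set u)" unfolding pq by auto
  ultimately show ?case
    using u st by (intro exI[of _ "p @ s # t # s # q"]) (auto simp del: set_append)
qed

text \<open>The vertex \<open>a\<close> is the last one to be reached. The walk through the others is traversed back and forth, so as
  to start and end in a vertex \<open>b\<close> that is not joined to \<open>a\<close>.\<close>

lemma exists_separating_walk:
  assumes "finite S" "directly_indecomposable R" "\<not> comm_group R"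
  obtains a b w where "a \<in> S" "set w = S - {a}" "w \<noteq> []" "last w = b"
    "successively (\<lambda>s t. (s, t) \<notin> E) (a # w)" "b \<notin> lk a"
proof -
  have cut: "\<exists>s\<in>T. \<exists>t\<in>S - T. (s, t) \<notin> E" if "T \<subseteq> S" "T \<noteq> {}" "T \<noteq> S" for T
    using decomposable_if_complement_disconnected[OF that] assms(2) by blast
  obtain s t where st: "s \<in> S" "t \<in> S" "s \<noteq> t" using commutative_if_generators_commute assms(3) by blast
  then have "card {s, t} \<le> card S" using assms(1) by (intro card_mono) auto
  then have "2 \<le> card S" using st by simp
  then have "1 \<le> card S - 1" "card S - 1 \<le> card S" by auto
  then obtain u where u: "set u \<subseteq> S" "card (set u) = card S - 1" "successively (\<lambda>s t. (s, t) \<notin> E) u"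
    using exists_walk_of_size[OF cut] by blast
  have ne: "set u \<noteq> {}" "set u \<noteq> S" using u(2) \<open>2 \<le> card S\<close> by auto
  then obtain b a where ab: "b \<in> set u" "a \<in> S - set u" "(b, a) \<notin> E" using cut[OF u(1)] by blast
  have "card (insert a (set u)) = card S" using u(2) ab(2) \<open>2 \<le> card S\<close> by simp
  then have S: "insert a (set u) = S" using u(1) ab(2) assms(1) by (intro card_subset_eq) auto
  obtain p q where pq: "u = p @ b # q" using ab(1) by (meson split_list)
  have ba: "(a, b) \<notin> E" using ab(3) sym by blast
  have rev: "successively (\<lambda>s t. (s, t) \<notin> E) (rev v)" if "successively (\<lambda>s t. (s, t) \<notin> E) v" for v
    unfolding successively_rev using that by (rule successively_mono) (use sym in blast)
  \<comment> \<open>from \<open>b\<close> back to the start of \<open>u\<close>, then along all of \<open>u\<close>, and from its end back to \<open>b\<close>\<close>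
  define w where "w = rev (p @ [b]) @ u @ rev (b # q)"
  have 1: "successively (\<lambda>s t. (s, t) \<notin> E) (p @ [b])" "successively (\<lambda>s t. (s, t) \<notin> E) (b # q)"
    using u(3) unfolding pq by (auto simp: successively_append_iff successively_Cons)
  have 2: "last (rev (p @ [b])) = hd u" "last u = hd (rev (b # q))" "hd (rev (p @ [b])) = b"
    unfolding pq by (cases p; simp add: hd_rev last_rev)+
  have "successively (\<lambda>s t. (s, t) \<notin> E) (a # w)"
    unfolding w_def using rev[OF 1(1)] rev[OF 1(2)] u(3) 2 ba irrefl ne(1)
    by (simp only: successively_append_iff successively_Cons hd_append2) (auto simp: hd_append2)
  moreover have "set w = S - {a}" using S ab(2) unfolding w_def pq by auto
  ultimately show thesis
    using that[of a w b] ab ba by (auto simp: w_def lk_def)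
qed

end

section \<open>Transfer of formulas along partial homomorphisms\<close>

text \<open>The pairs of elements that are multiplied during the evaluation of a term. The entry for an inverse
  makes sure that a map which respects these products also respects the inverse.\<close>

primrec trm_pairs :: "('h, 'm) monoid_scheme \<Rightarrow> ('c \<Rightarrow> 'h) \<Rightarrow> (var \<Rightarrow> 'h) \<Rightarrow> 'c trm \<Rightarrow> ('h \<times> 'h) set" where
  "trm_pairs H c e (Var v) = {}"
| "trm_pairs H c e (Const a) = {}"
| "trm_pairs H c e One = {}"
| "trm_pairs H c e (Mult s t) =
     insert (trm_val H c e s, trm_val H c e t) (trm_pairs H c e s \<union> trm_pairs H c e t)"
| "trm_pairs H c e (Inv t) = insert (trm_val H c e t, inv\<^bsub>H\<^esub> (trm_val H c e t)) (trm_pairs H c e t)"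

lemma finite_trm_pairs [simp]: "finite (trm_pairs H c e t)"
  by (induction t) auto

lemma card_trm_pairs: "card (trm_pairs H c e t) \<le> size t"
proof (induction t)
  case (Mult s t)
  have "card (trm_pairs H c e (Mult s t)) \<le> Suc (card (trm_pairs H c e s \<union> trm_pairs H c e t))"
    by (simp add: card_insert_if)
  also have "\<dots> \<le> Suc (card (trm_pairs H c e s) + card (trm_pairs H c e t))"
    using card_Un_le by simp
  finally show ?case using Mult by simp
next
  case (Inv t)
  then show ?case by (simp add: card_insert_if)
qed simp_all

lemma trm_val_closed:
  assumes "group H" "\<And>v. v \<in> trm_vars t \<Longrightarrow> e v \<in> carrier H" "\<And>a. a \<in> trm_consts t \<Longrightarrow> c a \<in> carrier H"
  shows "trm_val H c e t \<in> carrier H"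
proof -
  interpret group H by fact
  show ?thesis using assms(2,3) by (induction t) auto
qed

lemma trm_pairs_closed:
  assumes "group H" "\<And>v. v \<in> trm_vars t \<Longrightarrow> e v \<in> carrier H" "\<And>a. a \<in> trm_consts t \<Longrightarrow> c a \<in> carrier H"
  shows "trm_pairs H c e t \<subseteq> carrier H \<times> carrier H"
proof -
  interpret group H by fact
  show ?thesis using assms(2,3) by (induction t) (simp_all add: trm_val_closed[OF assms(1)])
qed

lemma trm_val_map:
  assumes "group H" "group H'" "f \<in> carrier H \<rightarrow> carrier H'" "f \<one>\<^bsub>H\<^esub> = \<one>\<^bsub>H'\<^esub>"
    and "\<And>v. v \<in> trm_vars t \<Longrightarrow> e v \<in> carrier H" "\<And>a. a \<in> trm_consts t \<Longrightarrow> c a \<in> carrier H"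
    and "\<And>v. v \<in> trm_vars t \<Longrightarrow> e' v = f (e v)" "\<And>a. a \<in> trm_consts t \<Longrightarrow> c' a = f (c a)"
    and "\<And>y z. (y, z) \<in> trm_pairs H c e t \<Longrightarrow> f (y \<otimes>\<^bsub>H\<^esub> z) = f y \<otimes>\<^bsub>H'\<^esub> f z"
  shows "trm_val H' c' e' t = f (trm_val H c e t)"
  using assms(5-9)
proof (induction t)
  case (Inv t)
  interpret H: group H by fact
  interpret H': group H' by fact
  let ?y = "trm_val H c e t"
  have y: "?y \<in> carrier H" using Inv.prems by (intro trm_val_closed[OF assms(1)]) auto
  then have iy: "inv\<^bsub>H\<^esub> ?y \<in> carrier H" by (rule H.inv_closed)
  have fy: "f ?y \<in> carrier H'" "f (inv\<^bsub>H\<^esub> ?y) \<in> carrier H'"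
    by (fact funcset_mem[OF assms(3) y], fact funcset_mem[OF assms(3) iy])
  have "f ?y \<otimes>\<^bsub>H'\<^esub> f (inv\<^bsub>H\<^esub> ?y) = f (?y \<otimes>\<^bsub>H\<^esub> inv\<^bsub>H\<^esub> ?y)"
    using Inv.prems(5)[of ?y "inv\<^bsub>H\<^esub> ?y"] by simp
  also have "\<dots> = \<one>\<^bsub>H'\<^esub>" unfolding H.r_inv[OF y] by (rule assms(4))
  finally have "f (inv\<^bsub>H\<^esub> ?y) \<otimes>\<^bsub>H'\<^esub> f ?y = \<one>\<^bsub>H'\<^esub>" using fy by (rule H'.inv_comm)
  then have "inv\<^bsub>H'\<^esub> (f ?y) = f (inv\<^bsub>H\<^esub> ?y)" using fy by (rule H'.inv_equality)
  moreover have "trm_val H' c' e' t = f ?y" using Inv.prems by (intro Inv.IH) simp_all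
  ultimately show ?case by simp
next
  case (Mult s t)
  have "trm_val H' c' e' s = f (trm_val H c e s)" "trm_val H' c' e' t = f (trm_val H c e t)"
    using Mult.prems by (intro Mult.IH; simp)+
  then show ?case using Mult.prems(5) by simp
qed (simp_all add: assms(4))

lemma trm_val_hom:
  assumes "group H" "group H'" "f \<in> hom H H'"
    and "\<And>v. v \<in> trm_vars t \<Longrightarrow> e v \<in> carrier H" "\<And>a. a \<in> trm_consts t \<Longrightarrow> c a \<in> carrier H"
    and "\<And>v. v \<in> trm_vars t \<Longrightarrow> e' v = f (e v)" "\<And>a. a \<in> trm_consts t \<Longrightarrow> c' a = f (c a)"
  shows "trm_val H' c' e' t = f (trm_val H c e t)"
proof (rule trm_val_map[OF assms(1,2) _ _ assms(4-7)])
  show "f \<in> carrier H \<rightarrow> carrier H'" using assms(3) by (rule hom_in_carrier[THEN Pi_I])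
  show "f \<one>\<^bsub>H\<^esub> = \<one>\<^bsub>H'\<^esub>" using assms(3,1,2) by (rule hom_one)
  show "f (y \<otimes>\<^bsub>H\<^esub> z) = f y \<otimes>\<^bsub>H'\<^esub> f z" if "(y, z) \<in> trm_pairs H c e t" for y z
  proof (rule hom_mult[OF assms(3)])
    show "y \<in> carrier H" "z \<in> carrier H" using subsetD[OF trm_pairs_closed[OF assms(1), of t e c] that] assms(4,5) by simp_all
  qed
qed

primrec equations :: "'c formula \<Rightarrow> ('c trm \<times> 'c trm) set" where
  "equations (Eq s t) = {(s, t)}"
| "equations (Neg \<phi>) = equations \<phi>"
| "equations (Conj \<phi> \<psi>) = equations \<phi> \<union> equations \<psi>"
| "equations (Disj \<phi> \<psi>) = equations \<phi> \<union> equations \<psi>"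
| "equations (Forall v \<phi>) = equations \<phi>"
| "equations (Exists v \<phi>) = equations \<phi>"

lemma finite_equations [simp]: "finite (equations \<phi>)"
  by (induction \<phi>) auto

lemma equations_vars: "quantifier_free \<phi> \<Longrightarrow> (s, t) \<in> equations \<phi> \<Longrightarrow>
    trm_vars s \<subseteq> free_vars \<phi> \<and> trm_vars t \<subseteq> free_vars \<phi>"
  by (induction \<phi>) auto

lemma equations_consts: "(s, t) \<in> equations \<phi> \<Longrightarrow> trm_consts s \<subseteq> consts_of \<phi> \<and> trm_consts t \<subseteq> consts_of \<phi>"
  by (induction \<phi>) auto

lemma sat_equations_cong:
  assumes "quantifier_free \<phi>"
    and "\<And>s t. (s, t) \<in> equations \<phi> \<Longrightarrow>
      (trm_val H c e s = trm_val H c e t) = (trm_val H' c' e' s = trm_val H' c' e' t)"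
  shows "sat H c e \<phi> = sat H' c' e' \<phi>"
  using assms
proof (induction \<phi>)
  case (Conj \<phi> \<psi>)
  have "sat H c e \<phi> = sat H' c' e' \<phi>" "sat H c e \<psi> = sat H' c' e' \<psi>"
    using Conj.prems by (intro Conj.IH; simp)+
  then show ?case by (simp only: sat.simps)
next
  case (Disj \<phi> \<psi>)
  have "sat H c e \<phi> = sat H' c' e' \<phi>" "sat H c e \<psi> = sat H' c' e' \<psi>"
    using Disj.prems by (intro Disj.IH; simp)+
  then show ?case by (simp only: sat.simps)
next
  case (Neg \<phi>)
  have "sat H c e \<phi> = sat H' c' e' \<phi>" using Neg.prems by (intro Neg.IH; simp)
  then show ?case by (simp only: sat.simps)
qed simp_all

definition formula_pairs :: "('h, 'm) monoid_scheme \<Rightarrow> ('c \<Rightarrow> 'h) \<Rightarrow> (var \<Rightarrow> 'h) \<Rightarrow> 'c formula \<Rightarrow> ('h \<times> 'h) set" where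
  "formula_pairs H c e \<phi> = (\<Union>(s, t)\<in>equations \<phi>. trm_pairs H c e s \<union> trm_pairs H c e t)"

lemma finite_formula_pairs [simp]: "finite (formula_pairs H c e \<phi>)"
  by (auto simp: formula_pairs_def)

text \<open>The bound does not depend on the assignment, hence it is known before the game starts.\<close>

lemma card_formula_pairs: "card (formula_pairs H c e \<phi>) \<le> (\<Sum>(s, t)\<in>equations \<phi>. size s + size t)"
proof -
  have "card (formula_pairs H c e \<phi>) \<le> (\<Sum>p\<in>equations \<phi>. card (case p of (s, t) \<Rightarrow> trm_pairs H c e s \<union> trm_pairs H c e t))"
    unfolding formula_pairs_def by (rule card_UN_le) simp
  also have "\<dots> \<le> (\<Sum>(s, t)\<in>equations \<phi>. size s + size t)"
  proof (rule sum_mono)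
    fix p :: "'c trm \<times> 'c trm"
    obtain s t where p: "p = (s, t)" by (cases p)
    show "card (case p of (s, t) \<Rightarrow> trm_pairs H c e s \<union> trm_pairs H c e t) \<le> (case p of (s, t) \<Rightarrow> size s + size t)"
      using card_Un_le[of "trm_pairs H c e s" "trm_pairs H c e t"] card_trm_pairs[of H c e s] card_trm_pairs[of H c e t]
      unfolding p by simp
  qed
  finally show ?thesis .
qed

section \<open>The group of words with constants\<close>

lemma poly_group_is_group: "group (poly_group G k)"
  unfolding poly_group_def free_product_def by (rule group_presented_group)

lemma poly_const_hom:
  assumes "group G"
  shows "poly_const G k \<in> hom G (poly_group G k)"
proof -
  interpret G: group G by fact
  let ?F = "free_group {1..k}"
  let ?S = "carrier G <+> carrier ?F" and ?R = "free_product_relators G ?F"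
  interpret M: group "poly_group G k" by (rule poly_group_is_group)
  have M: "poly_group G k = presented_group ?S ?R" by (simp add: poly_group_def free_product_def)
  have const: "poly_const G k g = generator ?S ?R (Inl g)" for g
    by (simp add: poly_const_def free_product_inl_def)
  have closed: "poly_const G k g \<in> carrier (poly_group G k)" if "g \<in> carrier G" for g
    unfolding const M using that by (intro generator_closed) auto
  show ?thesis
  proof (rule homI)
    fix g h assume gh: "g \<in> carrier G" "h \<in> carrier G"
    let ?r = "[(Inl g, True), (Inl h, True), (Inl (g \<otimes>\<^bsub>G\<^esub> h), False)]"
    have r: "?r \<in> ?R" using gh unfolding free_product_relators_def by blast
    have rw: "?r \<in> words ?S" using gh by auto
    have "word_class ?S ?R ?r = \<one>\<^bsub>poly_group G k\<^esub>"
      unfolding M one_presented using word_cong.relator[OF r rw] by (rule word_class_eq)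
    then have "poly_const G k g \<otimes>\<^bsub>poly_group G k\<^esub> (poly_const G k h \<otimes>\<^bsub>poly_group G k\<^esub>
        inv\<^bsub>poly_group G k\<^esub> (poly_const G k (g \<otimes>\<^bsub>G\<^esub> h))) = \<one>\<^bsub>poly_group G k\<^esub>"
      unfolding word_class_eq_value[OF rw] const M[symmetric] using gh closed[unfolded const] by simp
    then have eq: "(poly_const G k g \<otimes>\<^bsub>poly_group G k\<^esub> poly_const G k h) \<otimes>\<^bsub>poly_group G k\<^esub>
        inv\<^bsub>poly_group G k\<^esub> (poly_const G k (g \<otimes>\<^bsub>G\<^esub> h)) = \<one>\<^bsub>poly_group G k\<^esub>"
      using gh closed by (simp add: M.m_assoc)
    have "inv\<^bsub>poly_group G k\<^esub> (inv\<^bsub>poly_group G k\<^esub> (poly_const G k (g \<otimes>\<^bsub>G\<^esub> h)))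
        = poly_const G k g \<otimes>\<^bsub>poly_group G k\<^esub> poly_const G k h"
      by (rule M.inv_equality[OF eq]) (use gh closed in auto)
    then show "poly_const G k (g \<otimes>\<^bsub>G\<^esub> h) = poly_const G k g \<otimes>\<^bsub>poly_group G k\<^esub> poly_const G k h"
      using gh closed by simp
  qed (rule closed)
qed

lemma poly_var_closed: "i \<in> {1..k} \<Longrightarrow> poly_var G k i \<in> carrier (poly_group G k)"
  unfolding poly_var_def free_product_inr_def poly_group_def free_product_def free_gen_def free_group_def
  by (intro generator_closed) auto

text \<open>The specialization of the variables to elements of \<open>G\<close>.\<close>

lemma poly_evaluation:
  assumes "group G" "\<gamma> \<in> {1..k} \<rightarrow> carrier G"
  obtains h where "h \<in> hom (poly_group G k) G" "\<And>g. g \<in> carrier G \<Longrightarrow> h (poly_const G k g) = g"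
    "\<And>i. i \<in> {1..k} \<Longrightarrow> h (poly_var G k i) = \<gamma> i"
proof -
  interpret G: group G by fact
  let ?F = "free_group {1..k}"
  let ?S = "carrier G <+> carrier ?F" and ?R = "free_product_relators G ?F"
  have "\<exists>f\<in>hom ?F G. \<forall>i\<in>{1..k}. f (free_gen {1..k} i) = \<gamma> i"
    unfolding free_group_def free_gen_def
  proof (rule presented_hom[OF assms, where R = "{}"])
    fix f assume "f \<in> hom (presented_group {1..k} {}) G" "\<And>s. s \<in> {1..k} \<Longrightarrow> f (generator {1..k} {} s) = \<gamma> s"
    then show "\<exists>f\<in>hom (presented_group {1..k} {}) G. \<forall>i\<in>{1..k}. f (generator {1..k} {} i) = \<gamma> i"
      by (intro bexI[of _ f] ballI)
  qed (simp only: empty_iff)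
  then obtain f where f: "f \<in> hom ?F G" "\<And>i. i \<in> {1..k} \<Longrightarrow> f (free_gen {1..k} i) = \<gamma> i" by blast
  have fc: "u \<in> carrier ?F \<Longrightarrow> f u \<in> carrier G" for u using hom_in_carrier[OF f(1)] by blast
  let ?\<phi> = "case_sum (\<lambda>g. g) f"
  have \<phi>: "?\<phi> \<in> ?S \<rightarrow> carrier G"
    by (intro Pi_I, elim PlusE) (simp_all add: fc)
  have rel: "word_value G ?\<phi> r = \<one>\<^bsub>G\<^esub>" if "r \<in> ?R" for r
    using that unfolding free_product_relators_def
  proof (elim UnE CollectE exE conjE)
    fix a b assume ab: "r = [(Inl a, True), (Inl b, True), (Inl (a \<otimes>\<^bsub>G\<^esub> b), False)]" "a \<in> carrier G" "b \<in> carrier G"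
    show ?thesis unfolding ab(1) using ab(2,3) G.m_assoc[of a b "inv\<^bsub>G\<^esub> (a \<otimes>\<^bsub>G\<^esub> b)"] by simp
  next
    fix a b assume ab: "r = [(Inr a, True), (Inr b, True), (Inr (a \<otimes>\<^bsub>?F\<^esub> b), False)]" "a \<in> carrier ?F" "b \<in> carrier ?F"
    have "f (a \<otimes>\<^bsub>?F\<^esub> b) = f a \<otimes>\<^bsub>G\<^esub> f b" using hom_mult[OF f(1) ab(2,3)] .
    then show ?thesis
      unfolding ab(1) using fc[OF ab(2)] fc[OF ab(3)] G.m_assoc[of "f a" "f b" "inv\<^bsub>G\<^esub> (f a \<otimes>\<^bsub>G\<^esub> f b)"]
      by simp
  qed
  have "\<exists>h\<in>hom (presented_group ?S ?R) G. \<forall>s\<in>?S. h (generator ?S ?R s) = ?\<phi> s"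
  proof (rule presented_hom[OF assms(1) \<phi>, where R = ?R])
    fix h assume "h \<in> hom (presented_group ?S ?R) G" "\<And>s. s \<in> ?S \<Longrightarrow> h (generator ?S ?R s) = ?\<phi> s"
    then show "\<exists>h\<in>hom (presented_group ?S ?R) G. \<forall>s\<in>?S. h (generator ?S ?R s) = ?\<phi> s"
      by (intro bexI[of _ h] ballI)
  qed (rule rel)
  then obtain h where h: "h \<in> hom (presented_group ?S ?R) G" "\<And>s. s \<in> ?S \<Longrightarrow> h (generator ?S ?R s) = ?\<phi> s"
    by blast
  have gen: "free_gen {1..k} i \<in> carrier ?F" if "i \<in> {1..k}" for i
    using that unfolding free_group_def free_gen_def by (rule generator_closed)
  show thesis
  proof (rule that)
    show "h \<in> hom (poly_group G k) G" using h(1) by (simp add: poly_group_def free_product_def)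
    show "h (poly_const G k g) = g" if "g \<in> carrier G" for g
      using h(2)[OF InlI[OF that]] by (simp add: poly_const_def free_product_inl_def)
    show "h (poly_var G k i) = \<gamma> i" if "i \<in> {1..k}" for i
      using h(2)[OF InrI[OF gen[OF that]]] f(2)[OF that]
      by (simp add: poly_var_def free_product_inr_def)
  qed
qed

section \<open>Lifting the variables one after the other\<close>

text \<open>The variables \<open>x\<^sub>i\<close> become isolated vertices \<open>Inr i\<close> of the extended graph. In the complement graph they
  are joined to everything, and the blocks of the generic elements use only the vertices \<open>Inl s\<close>.\<close>

locale lifting_game =
  fixes V :: "'a set" and E :: "('a \<times> 'a) set" and k :: nat
  assumes graph: "commutation_graph V E" and finite_V: "finite V"
    and indecomposable: "directly_indecomposable (raag V E)" and nonabelian: "\<not> comm_group (raag V E)"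
begin

abbreviation ext_verts :: "('a + nat) set" where
  "ext_verts \<equiv> Inl ` V \<union> Inr ` {0<..k}"

abbreviation ext_edges :: "(('a + nat) \<times> ('a + nat)) set" where
  "ext_edges \<equiv> map_prod Inl Inl ` E"

sublocale base: commutation_graph V E
  by (rule graph)

sublocale ext: commutation_graph ext_verts ext_edges
proof
  show "ext_edges \<subseteq> ext_verts \<times> ext_verts" using base.edges by auto
  show "(t, s) \<in> ext_edges" if "(s, t) \<in> ext_edges" for s t
    using that base.sym by (auto simp: map_prod_def)
  show "(s, s) \<notin> ext_edges" for s using base.irrefl by auto
qed

abbreviation "G \<equiv> raag V E"
abbreviation "P \<equiv> raag ext_verts ext_edges"
abbreviation "M \<equiv> poly_group (raag V E) k"

definition embed :: "('a \<times> bool) list set \<Rightarrow> (('a + nat) \<times> bool) list set" where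
  "embed = (SOME f. f \<in> hom G P \<and> (\<forall>s\<in>V. f (base.gen s) = ext.gen (Inl s)))"

definition to_poly :: "(('a + nat) \<times> bool) list set \<Rightarrow> ('a \<times> bool) list set poly" where
  "to_poly = (SOME f. f \<in> hom P M \<and> (\<forall>s\<in>V. f (ext.gen (Inl s)) = poly_const G k (base.gen s)) \<and>
     (\<forall>i\<in>{1..k}. f (ext.gen (Inr i)) = poly_var G k i))"

definition poly_ev :: "(nat \<Rightarrow> ('a \<times> bool) list set) \<Rightarrow> ('a \<times> bool) list set poly \<Rightarrow> ('a \<times> bool) list set" where
  "poly_ev \<gamma> = (SOME h. h \<in> hom M G \<and> (\<forall>g\<in>carrier G. h (poly_const G k g) = g) \<and>
     (\<forall>i\<in>{1..k}. h (poly_var G k i) = \<gamma> i))"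

text \<open>The specialization is defined through \<open>G[X]\<close>; this makes it agree with \<open>poly_ev\<close> on the images of elements of \<open>P\<close>
  by definition.\<close>

definition ev :: "(nat \<Rightarrow> ('a \<times> bool) list set) \<Rightarrow> (('a + nat) \<times> bool) list set \<Rightarrow> ('a \<times> bool) list set" where
  "ev \<gamma> y = poly_ev \<gamma> (to_poly y)"

lemma embed: "embed \<in> hom G P" "s \<in> V \<Longrightarrow> embed (base.gen s) = ext.gen (Inl s)"
proof -
  have "(\<lambda>s. ext.gen (Inl s)) \<in> V \<rightarrow> carrier P" by (intro Pi_I ext.gen_closed) simp
  moreover have "ext.gen (Inl s) \<otimes>\<^bsub>P\<^esub> ext.gen (Inl t) = ext.gen (Inl t) \<otimes>\<^bsub>P\<^esub> ext.gen (Inl s)"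
    if "(s, t) \<in> E" for s t
  proof (rule ext.gen_commute)
    show "(Inl s, Inl t) \<in> ext_edges" using that by (rule map_prod_imageI)
  qed
  ultimately have "\<exists>f. f \<in> hom G P \<and> (\<forall>s\<in>V. f (base.gen s) = ext.gen (Inl s))"
  proof (rule base.raag_hom[OF ext.is_group])
    fix f assume "f \<in> hom G P" "\<And>s. s \<in> V \<Longrightarrow> f (base.gen s) = ext.gen (Inl s)"
    then show ?thesis by (intro exI[of _ f] conjI ballI)
  qed
  then have "embed \<in> hom G P \<and> (\<forall>s\<in>V. embed (base.gen s) = ext.gen (Inl s))"
    unfolding embed_def by (rule someI_ex)
  then show "embed \<in> hom G P" "s \<in> V \<Longrightarrow> embed (base.gen s) = ext.gen (Inl s)" by simp_all
qed

lemma const_hom: "poly_const G k \<in> hom G M"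
  by (rule poly_const_hom[OF base.is_group])

lemma to_poly: "to_poly \<in> hom P M" "s \<in> V \<Longrightarrow> to_poly (ext.gen (Inl s)) = poly_const G k (base.gen s)"
  "i \<in> {1..k} \<Longrightarrow> to_poly (ext.gen (Inr i)) = poly_var G k i"
proof -
  let ?\<phi> = "case_sum (\<lambda>s. poly_const G k (base.gen s)) (poly_var G k)"
  have "?\<phi> \<in> ext_verts \<rightarrow> carrier M"
    using hom_in_carrier[OF const_hom base.gen_closed] poly_var_closed[of _ k G]
    by (intro Pi_I, elim UnE imageE) simp_all
  moreover have "?\<phi> s \<otimes>\<^bsub>M\<^esub> ?\<phi> t = ?\<phi> t \<otimes>\<^bsub>M\<^esub> ?\<phi> s" if st: "(s, t) \<in> ext_edges" for s t
  proof -
    obtain a b where ab: "s = Inl a" "t = Inl b" "(a, b) \<in> E" using st by auto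
    have S: "a \<in> V" "b \<in> V" using ab(3) base.edges by auto
    show ?thesis
      unfolding ab(1,2) sum.case
      using base.gen_commute[OF ab(3)] hom_mult[OF const_hom base.gen_closed[OF S(1)] base.gen_closed[OF S(2)]]
        hom_mult[OF const_hom base.gen_closed[OF S(2)] base.gen_closed[OF S(1)]] by simp
  qed
  ultimately have "\<exists>f. f \<in> hom P M \<and> (\<forall>s\<in>V. f (ext.gen (Inl s)) = poly_const G k (base.gen s)) \<and>
     (\<forall>i\<in>{1..k}. f (ext.gen (Inr i)) = poly_var G k i)"
  proof (rule ext.raag_hom[OF poly_group_is_group])
    fix f assume "f \<in> hom P M" and f: "\<And>s. s \<in> ext_verts \<Longrightarrow> f (ext.gen s) = ?\<phi> s"
    moreover have "f (ext.gen (Inl s)) = poly_const G k (base.gen s)" if "s \<in> V" for s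
      using f[of "Inl s"] that by simp
    moreover have "f (ext.gen (Inr i)) = poly_var G k i" if "i \<in> {1..k}" for i
      using f[of "Inr i"] that by simp
    ultimately show ?thesis by (intro exI[of _ f] conjI ballI)
  qed
  then have "to_poly \<in> hom P M \<and> (\<forall>s\<in>V. to_poly (ext.gen (Inl s)) = poly_const G k (base.gen s)) \<and>
     (\<forall>i\<in>{1..k}. to_poly (ext.gen (Inr i)) = poly_var G k i)"
    unfolding to_poly_def by (rule someI_ex)
  then show "to_poly \<in> hom P M" "s \<in> V \<Longrightarrow> to_poly (ext.gen (Inl s)) = poly_const G k (base.gen s)"
    "i \<in> {1..k} \<Longrightarrow> to_poly (ext.gen (Inr i)) = poly_var G k i" by simp_all
qed

lemma to_poly_embed: "g \<in> carrier G \<Longrightarrow> to_poly (embed g) = poly_const G k g"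
proof -
  assume g: "g \<in> carrier G"
  have "(to_poly \<circ> embed) g = poly_const G k g"
  proof (rule base.raag_hom_eqI[OF poly_group_is_group _ const_hom _ g])
    show "to_poly \<circ> embed \<in> hom G M" by (rule hom_compose[OF embed(1) to_poly(1)])
    show "(to_poly \<circ> embed) (base.gen s) = poly_const G k (base.gen s)" if "s \<in> V" for s
      using that by (simp add: embed(2) to_poly(2))
  qed
  then show ?thesis by simp
qed

lemma poly_ev:
  assumes "range \<gamma> \<subseteq> carrier G"
  shows "poly_ev \<gamma> \<in> hom M G" "g \<in> carrier G \<Longrightarrow> poly_ev \<gamma> (poly_const G k g) = g"
    "i \<in> {1..k} \<Longrightarrow> poly_ev \<gamma> (poly_var G k i) = \<gamma> i"
proof -
  have \<gamma>: "\<gamma> \<in> {1..k} \<rightarrow> carrier G" using assms by (intro Pi_I) (simp add: subset_iff)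
  have "\<exists>h. h \<in> hom M G \<and> (\<forall>g\<in>carrier G. h (poly_const G k g) = g) \<and> (\<forall>i\<in>{1..k}. h (poly_var G k i) = \<gamma> i)"
  proof (rule poly_evaluation[OF base.is_group \<gamma>])
    fix h assume "h \<in> hom M G" "\<And>g. g \<in> carrier G \<Longrightarrow> h (poly_const G k g) = g"
      "\<And>i. i \<in> {1..k} \<Longrightarrow> h (poly_var G k i) = \<gamma> i"
    then show ?thesis by (intro exI[of _ h] conjI ballI)
  qed
  then have "poly_ev \<gamma> \<in> hom M G \<and> (\<forall>g\<in>carrier G. poly_ev \<gamma> (poly_const G k g) = g) \<and>
     (\<forall>i\<in>{1..k}. poly_ev \<gamma> (poly_var G k i) = \<gamma> i)"
    unfolding poly_ev_def by (rule someI_ex)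
  then show "poly_ev \<gamma> \<in> hom M G" "g \<in> carrier G \<Longrightarrow> poly_ev \<gamma> (poly_const G k g) = g"
    "i \<in> {1..k} \<Longrightarrow> poly_ev \<gamma> (poly_var G k i) = \<gamma> i" by simp_all
qed

lemma ev:
  assumes "range \<gamma> \<subseteq> carrier G"
  shows "ev \<gamma> \<in> hom P G" "g \<in> carrier G \<Longrightarrow> ev \<gamma> (embed g) = g"
    "i \<in> {1..k} \<Longrightarrow> ev \<gamma> (ext.gen (Inr i)) = \<gamma> i"
proof -
  have "ev \<gamma> = poly_ev \<gamma> \<circ> to_poly" by (rule ext) (simp add: ev_def)
  then show "ev \<gamma> \<in> hom P G" using hom_compose[OF to_poly(1) poly_ev(1)[OF assms]] by (simp only:)
  show "g \<in> carrier G \<Longrightarrow> ev \<gamma> (embed g) = g"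
    by (simp only: ev_def to_poly_embed poly_ev(2)[OF assms])
  show "i \<in> {1..k} \<Longrightarrow> ev \<gamma> (ext.gen (Inr i)) = \<gamma> i"
    by (simp only: ev_def to_poly(3) poly_ev(3)[OF assms])
qed

lemma embed_closed: "g \<in> carrier G \<Longrightarrow> embed g \<in> carrier P"
  using embed(1) by (rule hom_in_carrier)

lemma embed_in_par:
  assumes "g \<in> carrier G"
  shows "embed g \<in> ext.par (Inl ` V)"
proof (rule base.hom_par_subset[OF ext.is_group embed(1) _ order_refl])
  show "subgroup (ext.par (Inl ` V)) P" by (rule ext.par_subgroup) simp
  show "embed (base.gen s) \<in> ext.par (Inl ` V)" if "s \<in> V" for s
    unfolding embed(2)[OF that] using that by (intro ext.gen_in_par imageI)
  show "g \<in> base.par V" using assms by (simp only: base.par_S)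
qed

lemma embed_pos: "set u \<subseteq> V \<Longrightarrow> embed (base.val (pos u)) = ext.val (pos (map Inl u))"
proof (induction u)
  case Nil
  then show ?case
    using hom_one[OF embed(1) base.is_group ext.is_group] by (simp add: base.val_Nil ext.val_Nil)
next
  case (Cons s u)
  then have s: "s \<in> V" "set u \<subseteq> V" by auto
  have "set (map Inl u) \<subseteq> ext_verts" using s by auto
  then have "ext.val (pos (map Inl (s # u))) = ext.gen (Inl s) \<otimes>\<^bsub>P\<^esub> ext.val (pos (map Inl u))"
    unfolding list.map using s by (intro ext.val_pos_Cons) auto
  moreover have "embed (base.val (pos (s # u))) = embed (base.gen s) \<otimes>\<^bsub>P\<^esub> embed (base.val (pos u))"
    unfolding base.val_pos_Cons[OF s] using s by (intro hom_mult[OF embed(1)]) simp_all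
  ultimately show ?case using Cons.IH[OF s(2)] embed(2)[OF s(1)] by (simp only:)
qed

lemma exists_generic_element:
  assumes "finite C" "C \<subseteq> carrier P"
  obtains g where "g \<in> carrier G"
    "\<And>x Q. x \<in> carrier P \<Longrightarrow> finite Q \<Longrightarrow> card Q \<le> N \<Longrightarrow> Q \<subseteq> carrier P \<times> carrier P \<Longrightarrow>
       \<exists>f. ext.generic_lift (Inl ` V) G C (embed g) x Q f"
proof (rule base.exists_separating_walk[OF finite_V indecomposable nonabelian])
  fix a b w assume w: "a \<in> V" "set w = V - {a}" "w \<noteq> []" "last w = b"
    "successively (\<lambda>s t. (s, t) \<notin> E) (a # w)" "b \<notin> base.lk a"
  have E: "(Inl s, Inl t) \<in> ext_edges \<longleftrightarrow> (s, t) \<in> E" for s t by (auto simp: map_prod_def)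
  have lk: "ext.lk (Inl s) = Inl ` base.lk s" for s unfolding ext.lk_def base.lk_def by auto
  interpret separating_walk ext_verts ext_edges "Inl ` V" "Inl a" "Inl b" "map Inl w"
  proof
    show "finite (Inl ` V)" using finite_V by simp
    show "Inl ` V \<subseteq> ext_verts" by simp
    show "Inl a \<in> Inl ` V" using w(1) by simp
    show "ext.lk (Inl a) \<subseteq> Inl ` V" unfolding lk using base.lk_subset by (rule image_mono)
    show "set (map Inl w) = Inl ` V - {Inl a}" using w(2) by auto
    show "map Inl w \<noteq> []" using w(3) by simp
    show "last (map Inl w) = Inl b" using w(3,4) by (simp add: last_map)
    show "Inl b \<notin> ext.lk (Inl a)" using w(6) unfolding lk by auto
    have "successively (\<lambda>s t. (s, t) \<notin> ext_edges) (map Inl (a # w))"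
      unfolding successively_map E using w(5) .
    then show "successively (\<lambda>s t. (s, t) \<notin> ext_edges) (Inl a # map Inl w)" by simp
  qed
  show thesis
  proof (rule exists_generic_lift[OF base.is_group assms, of N])
    fix u assume u: "set u \<subseteq> Inl ` V" and lift: "\<And>x Q. x \<in> carrier P \<Longrightarrow> finite Q \<Longrightarrow> card Q \<le> N \<Longrightarrow>
       Q \<subseteq> carrier P \<times> carrier P \<Longrightarrow> \<exists>f. ext.generic_lift (Inl ` V) G C (ext.val (pos u)) x Q f"
    define u' where "u' = map projl u"
    have "map Inl u' = u" unfolding u'_def map_map using u by (intro map_idI) auto
    moreover have u': "set u' \<subseteq> V" using u unfolding u'_def by auto
    ultimately have eq: "ext.val (pos u) = embed (base.val (pos u'))" using embed_pos[OF u'] by (simp only:)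
    show thesis
    proof (rule that)
      show "base.val (pos u') \<in> carrier G" using u' by (intro base.val_closed) simp
    qed (rule lift[unfolded eq])
  qed
qed

text \<open>The state after the variables with index above \<open>n\<close> have been lifted. The values \<open>e\<close> of the first \<open>n\<close> pairs of variables are
  still in \<open>G\<close>; the values of the other \<open>x\<^sub>i\<close> are the free generators, and the answers \<open>y\<^sub>i\<close> are words in \<open>G\<close> and
  \<open>x\<^bsub>n+1\<^esub>, \<dots>, x\<^sub>i\<close>. The point \<open>\<gamma>\<close> specializes the assignment \<open>eP\<close> to the values in \<open>G\<close> for which the formula
  was found to be true, and each equation that holds after specialization already holds in \<open>P\<close>.\<close>

definition lifted :: "('a \<times> bool) list set formula \<Rightarrow> nat \<Rightarrow> (var \<Rightarrow> ('a \<times> bool) list set) \<Rightarrow>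
    (var \<Rightarrow> (('a + nat) \<times> bool) list set) \<Rightarrow> (nat \<Rightarrow> ('a \<times> bool) list set) \<Rightarrow> bool" where
  "lifted \<phi> n e eP \<gamma> \<longleftrightarrow>
     range eP \<subseteq> carrier P \<and> range \<gamma> \<subseteq> carrier G \<and> (\<forall>i\<in>{1..n}. \<gamma> i = e (X i)) \<and>
     (\<forall>v\<in>vars_upto n. eP v = embed (e v)) \<and>
     (\<forall>i\<in>{n<..k}. eP (X i) = ext.gen (Inr i) \<and> eP (Y i) \<in> ext.par (Inl ` V \<union> Inr ` {n<..i})) \<and>
     sat G (\<lambda>g. g) (\<lambda>v. ev \<gamma> (eP v)) \<phi> \<and>
     (\<forall>(s, t)\<in>equations \<phi>.
        trm_val G (\<lambda>g. g) (\<lambda>v. ev \<gamma> (eP v)) s = trm_val G (\<lambda>g. g) (\<lambda>v. ev \<gamma> (eP v)) t \<longrightarrow>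
        trm_val P embed eP s = trm_val P embed eP t)"

lemma lifted_start:
  assumes "consts_of \<phi> \<subseteq> carrier G" "range e \<subseteq> carrier G" "sat G (\<lambda>g. g) e \<phi>"
  shows "\<exists>eP \<gamma>. lifted \<phi> k e eP \<gamma>"
proof -
  define \<gamma> where "\<gamma> i = e (X i)" for i
  have e: "e v \<in> carrier G" for v using assms(2) by (rule subsetD) simp
  have \<gamma>: "range \<gamma> \<subseteq> carrier G" unfolding \<gamma>_def using e by (intro image_subsetI)
  have ev_e: "(\<lambda>v. ev \<gamma> (embed (e v))) = e" using ev(2)[OF \<gamma> e] by (rule ext)
  have "trm_val P embed (\<lambda>v. embed (e v)) s = embed (trm_val G (\<lambda>g. g) e s)"
    if "trm_consts s \<subseteq> carrier G" for s
    by (rule trm_val_hom[OF base.is_group ext.is_group embed(1)]) (use that e in \<open>simp_all add: subset_iff\<close>)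
  then have val: "trm_val P embed (\<lambda>v. embed (e v)) s = embed (trm_val G (\<lambda>g. g) e s) \<and>
      trm_val P embed (\<lambda>v. embed (e v)) t = embed (trm_val G (\<lambda>g. g) e t)"
    if "(s, t) \<in> equations \<phi>" for s t
    using equations_consts[OF that] assms(1) by (meson order_trans)
  have "lifted \<phi> k e (\<lambda>v. embed (e v)) \<gamma>"
    unfolding lifted_def ev_e
  proof (intro conjI)
    show "range (\<lambda>v. embed (e v)) \<subseteq> carrier P" by (intro image_subsetI embed_closed e)
    show "\<forall>(s, t)\<in>equations \<phi>. trm_val G (\<lambda>g. g) e s = trm_val G (\<lambda>g. g) e t \<longrightarrow>
        trm_val P embed (\<lambda>v. embed (e v)) s = trm_val P embed (\<lambda>v. embed (e v)) t"
    proof (intro ballI, clarify)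
      fix s t assume "(s, t) \<in> equations \<phi>" "trm_val G (\<lambda>g. g) e s = trm_val G (\<lambda>g. g) e t"
      then show "trm_val P embed (\<lambda>v. embed (e v)) s = trm_val P embed (\<lambda>v. embed (e v)) t"
        using val by simp
    qed
  qed (use \<gamma> assms(3) in \<open>simp_all add: \<gamma>_def\<close>)
  then show ?thesis by blast
qed

text \<open>The element \<open>g\<close> was generic for the constants and for the values of the first \<open>n\<close> pairs of variables. After the later variables have
  been lifted, the finitely many products in the evaluation of the formula are known, and \<open>g\<close> is replaced by
  the next variable. As \<open>\<gamma>\<close> maps this variable to \<open>g\<close>, the specialized values do not change.\<close>

lemma lifted_step:
  assumes \<phi>: "consts_of \<phi> \<subseteq> carrier G" and n: "n < k"
    and e: "range e \<subseteq> carrier G" and b: "b \<in> carrier G"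
    and g: "g \<in> carrier G"
    and generic: "\<And>x Q. x \<in> carrier P \<Longrightarrow> finite Q \<Longrightarrow> card Q \<le> (\<Sum>(s, t)\<in>equations \<phi>. size s + size t) \<Longrightarrow>
       Q \<subseteq> carrier P \<times> carrier P \<Longrightarrow>
       \<exists>f. ext.generic_lift (Inl ` V) G (embed ` (consts_of \<phi> \<union> e ` vars_upto n)) (embed g) x Q f"
    and lift: "lifted \<phi> (Suc n) (e(X (Suc n) := g, Y (Suc n) := b)) eP \<gamma>"
  shows "\<exists>eP \<gamma>. lifted \<phi> n e eP \<gamma>"
proof -
  let ?C = "embed ` (consts_of \<phi> \<union> e ` vars_upto n)" and ?x = "ext.gen (Inr (Suc n))"
  let ?Q = "formula_pairs P embed eP \<phi>" and ?e = "e(X (Suc n) := g, Y (Suc n) := b)"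
  note L = lift[unfolded lifted_def]
  have eP: "eP v \<in> carrier P" for v using L by (simp add: image_subset_iff)
  have \<gamma>: "range \<gamma> \<subseteq> carrier G" using L by simp
  have \<gamma>_n: "\<gamma> i = ?e (X i)" if "i \<in> {1..Suc n}" for i using L that by simp
  have old: "eP v = embed (?e v)" if "v \<in> vars_upto (Suc n)" for v using L that by simp
  have new: "eP (X i) = ext.gen (Inr i)" "eP (Y i) \<in> ext.par (Inl ` V \<union> Inr ` {Suc n<..i})"
    if "i \<in> {Suc n<..k}" for i using L that by simp_all
  have const_closed: "embed a \<in> carrier P" if "a \<in> consts_of \<phi>" for a
    using that \<phi> by (intro embed_closed) blast
  have x: "?x \<in> carrier P" using n by (intro ext.gen_closed) simp
  have Q: "?Q \<subseteq> carrier P \<times> carrier P"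
    unfolding formula_pairs_def
  proof (intro UN_least, clarify)
    fix s t y z assume st: "(s, t) \<in> equations \<phi>" "(y, z) \<in> trm_pairs P embed eP s \<union> trm_pairs P embed eP t"
    have "trm_pairs P embed eP s \<subseteq> carrier P \<times> carrier P" "trm_pairs P embed eP t \<subseteq> carrier P \<times> carrier P"
      by (rule trm_pairs_closed[OF ext.is_group eP const_closed], use equations_consts[OF st(1)] in blast)+
    then show "y \<in> carrier P \<and> z \<in> carrier P" using st(2) by blast
  qed
  obtain f where "ext.generic_lift (Inl ` V) G ?C (embed g) ?x ?Q f"
    using generic[OF x finite_formula_pairs card_formula_pairs Q] by (elim exE)
  note f = this[unfolded ext.generic_lift_def]
  have f_closed: "f \<in> carrier P \<rightarrow> carrier P" using f by (elim conjE)
  have f_g: "f (embed g) = ?x" using f by (elim conjE)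
  have f_one: "f \<one>\<^bsub>P\<^esub> = \<one>\<^bsub>P\<^esub>" using f by (elim conjE)
  have f_C: "f y = y" if "y \<in> ?C" for y using f that by (elim conjE) (rule bspec)
  have f_gen: "f (ext.gen s) = ext.gen s" if "s \<in> ext_verts - Inl ` V" for s
    using f that by (elim conjE) (rule bspec)
  have f_Q: "f (y \<otimes>\<^bsub>P\<^esub> z) = f y \<otimes>\<^bsub>P\<^esub> f z" if "(y, z) \<in> ?Q" for y z
  proof -
    have "\<forall>(y, z)\<in>?Q. f (y \<otimes>\<^bsub>P\<^esub> z) = f y \<otimes>\<^bsub>P\<^esub> f z" using f by (elim conjE)
    from bspec[OF this that] show ?thesis by simp
  qed
  have f_par: "f y \<in> ext.par T" if "Inl ` V \<subseteq> T" "T \<subseteq> ext_verts" "?x \<in> ext.par T" "y \<in> ext.par T" for T y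
  proof -
    have "\<forall>T. Inl ` V \<subseteq> T \<and> T \<subseteq> ext_verts \<and> ?x \<in> ext.par T \<longrightarrow> f \<in> ext.par T \<rightarrow> ext.par T"
      using f by (elim conjE)
    then have "f \<in> ext.par T \<rightarrow> ext.par T" using that(1-3) by simp
    then show ?thesis using that(4) by (rule funcset_mem)
  qed
  have f_hom: "h (f y) = h y" if "h \<in> hom P G" "h ?x = h (embed g)" "y \<in> carrier P" for h y
  proof -
    have "\<forall>h\<in>hom P G. h ?x = h (embed g) \<longrightarrow> (\<forall>y\<in>carrier P. h (f y) = h y)" using f by (elim conjE)
    from bspec[OF this that(1)] show ?thesis using that(2,3) by simp
  qed
  \<comment> \<open>the specialization does not distinguish the new variable from \<open>g\<close>, so it does not notice the replacement\<close>
  have "ev \<gamma> ?x = ev \<gamma> (embed g)"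
    using ev(2)[OF \<gamma> g] ev(3)[OF \<gamma>, of "Suc n"] \<gamma>_n[of "Suc n"] n by simp
  then have ev_f: "ev \<gamma> (f (eP v)) = ev \<gamma> (eP v)" for v
    using ev(1)[OF \<gamma>] eP by (intro f_hom)
  have x_par: "?x \<in> ext.par (Inl ` V \<union> Inr ` {n<..i})" if "Suc n \<le> i" for i
    using that by (intro ext.gen_in_par) simp
  have par_sub: "Inl ` V \<union> Inr ` {n<..i} \<subseteq> ext_verts" if "i \<le> k" for i using that by auto
  have val: "trm_val P embed (\<lambda>v. f (eP v)) s = f (trm_val P embed eP s)"
    if st: "trm_consts s \<subseteq> consts_of \<phi>" "trm_pairs P embed eP s \<subseteq> ?Q" for s
  proof (rule trm_val_map[OF ext.is_group ext.is_group f_closed f_one])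
    show "embed a \<in> carrier P" if "a \<in> trm_consts s" for a using st(1) that by (intro const_closed) blast
    show "embed a = f (embed a)" if "a \<in> trm_consts s" for a
      using st(1) that by (intro f_C[symmetric]) blast
    show "f (y \<otimes>\<^bsub>P\<^esub> z) = f y \<otimes>\<^bsub>P\<^esub> f z" if "(y, z) \<in> trm_pairs P embed eP s" for y z
      using st(2) that by (intro f_Q) blast
  qed (rule eP HOL.refl)+
  have "lifted \<phi> n e (\<lambda>v. f (eP v)) \<gamma>"
    unfolding lifted_def ev_f
  proof (intro conjI)
    show "range (\<lambda>v. f (eP v)) \<subseteq> carrier P" using f_closed eP by (intro image_subsetI) (rule funcset_mem)
    show "range \<gamma> \<subseteq> carrier G" by (rule \<gamma>)
    show "\<forall>i\<in>{1..n}. \<gamma> i = e (X i)" using \<gamma>_n by simp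
    show "\<forall>v\<in>vars_upto n. f (eP v) = embed (e v)"
    proof
      fix v assume v: "v \<in> vars_upto n"
      then have "v \<in> vars_upto (Suc n)" "v \<noteq> X (Suc n)" "v \<noteq> Y (Suc n)" by (auto simp: vars_upto_def)
      then have "eP v = embed (e v)" using old[of v] by simp
      moreover have "embed (e v) \<in> ?C" using v by simp
      ultimately show "f (eP v) = embed (e v)" using f_C by simp
    qed
    show "\<forall>i\<in>{n<..k}. f (eP (X i)) = ext.gen (Inr i) \<and> f (eP (Y i)) \<in> ext.par (Inl ` V \<union> Inr ` {n<..i})"
    proof
      fix i assume i: "i \<in> {n<..k}"
      have par: "f y \<in> ext.par (Inl ` V \<union> Inr ` {n<..i})" if "y \<in> ext.par (Inl ` V \<union> Inr ` {n<..i})" for y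
        using i by (intro f_par[OF _ par_sub x_par that]) simp_all
      show "f (eP (X i)) = ext.gen (Inr i) \<and> f (eP (Y i)) \<in> ext.par (Inl ` V \<union> Inr ` {n<..i})"
      proof (cases "i = Suc n")
        case True
        have "eP (X i) = embed g" "eP (Y i) = embed b"
          using old[of "X i"] old[of "Y i"] True by (simp_all add: vars_upto_def)
        moreover have "embed b \<in> ext.par (Inl ` V \<union> Inr ` {n<..i})"
          using ext.par_mono[OF Un_upper1] embed_in_par[OF b] by (rule subsetD)
        ultimately show ?thesis using f_g par True by simp
      next
        case False
        then have i': "i \<in> {Suc n<..k}" using i by simp
        have "{Suc n<..i} \<subseteq> {n<..i}" by auto
        then have "Inl ` V \<union> Inr ` {Suc n<..i} \<subseteq> Inl ` V \<union> Inr ` {n<..i}" by blast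
        then have "eP (Y i) \<in> ext.par (Inl ` V \<union> Inr ` {n<..i})"
          using ext.par_mono new(2)[OF i'] by (meson subsetD)
        moreover have "f (ext.gen (Inr i)) = ext.gen (Inr i)" using i by (intro f_gen) auto
        ultimately show ?thesis using par new(1)[OF i'] by simp
      qed
    qed
    show "sat G (\<lambda>g. g) (\<lambda>v. ev \<gamma> (eP v)) \<phi>" using L by (elim conjE)
    show "\<forall>(s, t)\<in>equations \<phi>.
        trm_val G (\<lambda>g. g) (\<lambda>v. ev \<gamma> (eP v)) s = trm_val G (\<lambda>g. g) (\<lambda>v. ev \<gamma> (eP v)) t \<longrightarrow>
        trm_val P embed (\<lambda>v. f (eP v)) s = trm_val P embed (\<lambda>v. f (eP v)) t"
    proof (intro ballI, clarify)
      fix s t assume st: "(s, t) \<in> equations \<phi>"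
        and eq: "trm_val G (\<lambda>g. g) (\<lambda>v. ev \<gamma> (eP v)) s = trm_val G (\<lambda>g. g) (\<lambda>v. ev \<gamma> (eP v)) t"
      have "\<forall>(s, t)\<in>equations \<phi>.
        trm_val G (\<lambda>g. g) (\<lambda>v. ev \<gamma> (eP v)) s = trm_val G (\<lambda>g. g) (\<lambda>v. ev \<gamma> (eP v)) t \<longrightarrow>
        trm_val P embed eP s = trm_val P embed eP t" using L by (elim conjE)
      from bspec[OF this st] have "trm_val P embed eP s = trm_val P embed eP t" using eq by simp
      moreover have "trm_pairs P embed eP s \<subseteq> ?Q" "trm_pairs P embed eP t \<subseteq> ?Q"
        unfolding formula_pairs_def using st by blast+
      ultimately show "trm_val P embed (\<lambda>v. f (eP v)) s = trm_val P embed (\<lambda>v. f (eP v)) t"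
        using val equations_consts[OF st] by simp
    qed
  qed
  then show ?thesis by blast
qed

text \<open>The generic elements are chosen on the way down, from \<open>x\<^sub>1\<close> to \<open>x\<^sub>k\<close>, and the lifting takes place on the
  way back.\<close>

lemma lifted_if_blocks:
  assumes \<phi>: "consts_of \<phi> \<subseteq> carrier G" "finite (consts_of \<phi>)"
    and "n + m = k" "range e \<subseteq> carrier G" "blocks (carrier G) n m (\<lambda>e. sat G (\<lambda>g. g) e \<phi>) e"
  shows "\<exists>eP \<gamma>. lifted \<phi> n e eP \<gamma>"
  using assms(3-5)
proof (induction m arbitrary: n e)
  case 0
  then show ?case using lifted_start[OF \<phi>(1)] by simp
next
  case (Suc m)
  let ?C = "embed ` (consts_of \<phi> \<union> e ` vars_upto n)"
  have "finite ?C" using \<phi>(2) by (simp add: vars_upto_def)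
  moreover have "?C \<subseteq> carrier P"
    using Suc.prems(2) \<phi>(1) by (intro image_subsetI embed_closed) auto
  ultimately obtain g where g: "g \<in> carrier G" and generic: "\<And>x Q. x \<in> carrier P \<Longrightarrow> finite Q \<Longrightarrow>
      card Q \<le> (\<Sum>(s, t)\<in>equations \<phi>. size s + size t) \<Longrightarrow> Q \<subseteq> carrier P \<times> carrier P \<Longrightarrow>
      \<exists>f. ext.generic_lift (Inl ` V) G ?C (embed g) x Q f"
    by (rule exists_generic_element) (rule that)
  obtain b where b: "b \<in> carrier G"
      "blocks (carrier G) (Suc n) m (\<lambda>e. sat G (\<lambda>g. g) e \<phi>) (e(X (Suc n) := g, Y (Suc n) := b))"
    using Suc.prems(3) g by (auto simp: fun_upd_def)
  have range: "range (e(X (Suc n) := g, Y (Suc n) := b)) \<subseteq> carrier G"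
    using Suc.prems(2) g b(1) by (rule range_upd)
  have nk: "Suc n + m = k" "n < k" using Suc.prems(1) by simp_all
  obtain eP \<gamma> where "lifted \<phi> (Suc n) (e(X (Suc n) := g, Y (Suc n) := b)) eP \<gamma>"
    using Suc.IH[OF nk(1) range b(2)] by (elim exE)
  then have lift: "lifted \<phi> (Suc n) (e(X (Suc n) := g, Y (Suc n) := b)) eP \<gamma>" .
  show ?case
    by (rule lifted_step[OF \<phi>(1) nk(2) Suc.prems(2) b(1) g _ lift]) (rule generic)
qed

text \<open>Every equation travels around the circle \<open>G\<close>, \<open>P\<close>, \<open>G[X]\<close>, \<open>G\<close>: if it holds for the values in
  \<open>G\<close>, then by construction in \<open>P\<close>, hence in \<open>G[X]\<close>, hence after specialization again in \<open>G\<close>.\<close>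

theorem freely_lifts_if_true:
  assumes \<phi>: "standard_matrix G k \<phi>" "finite (consts_of \<phi>)" and true: "true_in G (standard_sentence k \<phi>)"
  shows "freely_lifts_standard G k \<phi>"
proof -
  have m: "quantifier_free \<phi>" "free_vars \<phi> \<subseteq> vars_upto k" "consts_of \<phi> \<subseteq> carrier G"
    using \<phi>(1) by (simp_all add: standard_matrix_def)
  define e0 :: "var \<Rightarrow> ('a \<times> bool) list set" where "e0 = (\<lambda>_. \<one>\<^bsub>G\<^esub>)"
  have e0: "range e0 \<subseteq> carrier G" by (simp add: e0_def image_subset_iff)
  then have "e0 \<in> UNIV \<rightarrow> carrier G" by (simp add: e0_def)
  then have "sat G (\<lambda>g. g) e0 (standard_sentence k \<phi>)"
    using true by (simp add: true_in_def models_def)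
  then have "blocks (carrier G) 0 k (\<lambda>e. sat G (\<lambda>g. g) e \<phi>) e0"
    using sat_quantify[of G "\<lambda>g. g" e0 0 k \<phi>] by (simp add: standard_sentence_def)
  then obtain eP \<gamma> where "lifted \<phi> 0 e0 eP \<gamma>"
    using lifted_if_blocks[OF m(3) \<phi>(2) _ e0, of 0 k] by auto
  note L = this[unfolded lifted_def]
  have eP: "eP v \<in> carrier P" for v using L by (simp add: image_subset_iff)
  have \<gamma>: "range \<gamma> \<subseteq> carrier G" using L by simp
  have new: "eP (X i) = ext.gen (Inr i)" "eP (Y i) \<in> ext.par (Inl ` V \<union> Inr ` {0<..i})"
    if "i \<in> {1..k}" for i using L that by simp_all
  define q where "q i = to_poly (eP (Y i))" for i
  let ?e = "lift_assignment G k q"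
  have e: "?e v = to_poly (eP v)" if v: "v \<in> vars_upto k" for v
  proof (cases v)
    case (X i)
    then show ?thesis using v new(1)[of i] to_poly(3)[of i] by (auto simp: vars_upto_def lift_assignment_def)
  qed (simp add: lift_assignment_def q_def)
  have e_closed: "?e v \<in> carrier M" if "v \<in> vars_upto k" for v
    unfolding e[OF that] using to_poly(1) eP by (rule hom_in_carrier)
  have "q i \<in> poly_upto G k i" if i: "i \<in> {1..k}" for i
  proof -
    let ?gens = "poly_const G k ` carrier G \<union> poly_var G k ` {1..i}"
    have gens: "?gens \<subseteq> carrier M"
      using hom_in_carrier[OF const_hom] poly_var_closed[of _ k G] i by (intro Un_least image_subsetI) auto
    have sub: "subgroup (generate M ?gens) M"
      by (rule group.generate_is_subgroup[OF poly_group_is_group gens])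
    show ?thesis
      unfolding q_def poly_upto_def
    proof (rule ext.hom_par_subset[OF poly_group_is_group to_poly(1) sub _ _ new(2)[OF i]])
      show "Inl ` V \<union> Inr ` {0<..i} \<subseteq> ext_verts" using i by auto
      fix s assume "s \<in> Inl ` V \<union> Inr ` {0<..i}"
      then have "to_poly (ext.gen s) \<in> ?gens"
      proof (elim UnE imageE)
        fix a assume a: "s = Inl a" "a \<in> V"
        show ?thesis unfolding a(1) to_poly(2)[OF a(2)] using a(2) by (intro UnI1 imageI base.gen_closed)
      next
        fix j assume j: "s = Inr j" "j \<in> {0<..i}"
        then have j': "j \<in> {1..k}" "j \<in> {1..i}" using i by auto
        show ?thesis unfolding j(1) to_poly(3)[OF j'(1)] using j'(2) by (intro UnI2 imageI)
      qed
      then show "to_poly (ext.gen s) \<in> generate M ?gens" by (rule generate.incl)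
    qed
  qed
  moreover have "sat M (poly_const G k) ?e \<phi> = sat G (\<lambda>g. g) (\<lambda>v. ev \<gamma> (eP v)) \<phi>"
  proof (rule sat_equations_cong[OF m(1)])
    fix s t assume st: "(s, t) \<in> equations \<phi>"
    note ev = equations_vars[OF m(1) st] and ec = equations_consts[OF st]
    note vars = subset_trans[OF conjunct1[OF ev] m(2)] subset_trans[OF conjunct2[OF ev] m(2)]
      and cs = subset_trans[OF conjunct1[OF ec] m(3)] subset_trans[OF conjunct2[OF ec] m(3)]
    have down: "trm_val G (\<lambda>g. g) (\<lambda>v. ev \<gamma> (eP v)) r = poly_ev \<gamma> (trm_val M (poly_const G k) ?e r)"
      and up: "trm_val M (poly_const G k) ?e r = to_poly (trm_val P embed eP r)"
      if r: "trm_vars r \<subseteq> vars_upto k" "trm_consts r \<subseteq> carrier G" for r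
    proof -
      have vr: "?e v = to_poly (eP v)" "?e v \<in> carrier M" if "v \<in> trm_vars r" for v
        using e e_closed subsetD[OF r(1) that] by simp_all
      have cr: "a \<in> carrier G" if "a \<in> trm_consts r" for a using r(2) that by (rule subsetD)
      show "trm_val G (\<lambda>g. g) (\<lambda>v. ev \<gamma> (eP v)) r = poly_ev \<gamma> (trm_val M (poly_const G k) ?e r)"
        by (rule trm_val_hom[OF poly_group_is_group base.is_group poly_ev(1)[OF \<gamma>]])
          (simp_all only: vr cr ev_def poly_ev(2)[OF \<gamma>] hom_in_carrier[OF const_hom] hom_in_carrier[OF to_poly(1) eP])
      show "trm_val M (poly_const G k) ?e r = to_poly (trm_val P embed eP r)"
        by (rule trm_val_hom[OF ext.is_group poly_group_is_group to_poly(1)])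
          (simp_all only: vr cr eP embed_closed to_poly_embed)
    qed
    have "\<forall>(s, t)\<in>equations \<phi>.
      trm_val G (\<lambda>g. g) (\<lambda>v. ev \<gamma> (eP v)) s = trm_val G (\<lambda>g. g) (\<lambda>v. ev \<gamma> (eP v)) t \<longrightarrow>
      trm_val P embed eP s = trm_val P embed eP t" using L by (elim conjE)
    from bspec[OF this st] have "trm_val G (\<lambda>g. g) (\<lambda>v. ev \<gamma> (eP v)) s = trm_val G (\<lambda>g. g) (\<lambda>v. ev \<gamma> (eP v)) t \<longrightarrow>
      trm_val P embed eP s = trm_val P embed eP t" by simp
    then show "(trm_val M (poly_const G k) ?e s = trm_val M (poly_const G k) ?e t) =
        (trm_val G (\<lambda>g. g) (\<lambda>v. ev \<gamma> (eP v)) s = trm_val G (\<lambda>g. g) (\<lambda>v. ev \<gamma> (eP v)) t)"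
      (is "?M = ?G")
    proof (intro iffI)
      assume ?M
      then show ?G by (simp only: down[OF vars(1) cs(1)] down[OF vars(2) cs(2)])
    next
      assume "?G \<longrightarrow> trm_val P embed eP s = trm_val P embed eP t" ?G
      then have "trm_val P embed eP s = trm_val P embed eP t" by (rule mp)
      then show ?M by (simp only: up[OF vars(1) cs(1)] up[OF vars(2) cs(2)])
    qed
  qed
  moreover have "sat G (\<lambda>g. g) (\<lambda>v. ev \<gamma> (eP v)) \<phi>" using L by (elim conjE)
  ultimately show ?thesis unfolding freely_lifts_standard_def by (intro exI[of _ q]) simp
qed

end

lemma finite_consts_of: "finite (consts_of \<phi>)"
proof -
  have "finite (trm_consts t)" for t :: "'c trm" by (induction t) auto
  then show ?thesis by (induction \<phi>) auto
qed

theorem theorem7p10: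
  fixes \<Gamma> :: "'a pair_pre_digraph"
    and \<phi> :: "('a \<times> bool) list set formula"
  assumes "pair_graph \<Gamma>"
    and "\<not> comm_group (pc_group \<Gamma>)"
    and "directly_indecomposable (pc_group \<Gamma>)"
    and "sentence (pc_group \<Gamma>) \<phi>"
    and "true_in (pc_group \<Gamma>) \<phi>"
  shows "freely_lifts (pc_group \<Gamma>) \<phi>"
  unfolding freely_lifts_def
proof (intro allI impI)
  interpret \<Gamma>: pair_graph \<Gamma> by fact
  fix k \<phi>\<^sub>0 assume std: "standard_form_of (pc_group \<Gamma>) \<phi> k \<phi>\<^sub>0"
  have graph: "commutation_graph (pverts \<Gamma>) (parcs \<Gamma>)"
  proof
    show "parcs \<Gamma> \<subseteq> pverts \<Gamma> \<times> pverts \<Gamma>" using \<Gamma>.in_arcsD1 \<Gamma>.in_arcsD2 by auto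
    show "(t, s) \<in> parcs \<Gamma>" if "(s, t) \<in> parcs \<Gamma>" for s t using that \<Gamma>.arcs_symmetric by auto
    show "(s, s) \<notin> parcs \<Gamma>" for s using \<Gamma>.no_loops by force
  qed
  interpret lifting_game "pverts \<Gamma>" "parcs \<Gamma>" k
    by (rule lifting_game.intro[OF graph \<Gamma>.pair_finite_verts assms(3,2)[unfolded pc_group_eq_raag]])
  have "models (pc_group \<Gamma>) (\<lambda>g. g) (standard_sentence k \<phi>\<^sub>0)"
    using std assms(5) base.is_group
    unfolding standard_form_of_def equivalent_def true_in_def pc_group_eq_raag by simp
  then show "freely_lifts_standard (pc_group \<Gamma>) k \<phi>\<^sub>0"
    using freely_lifts_if_true[of \<phi>\<^sub>0] std finite_consts_of
    unfolding standard_form_of_def true_in_def pc_group_eq_raag by simp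
qed

end
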